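(* Let $0<r<1$ and let $B_1,\dots,B_m$ be doubly commuting $2\times 2$ complex matrices, each an $\mathbb{A}_r$-contraction on $\mathcal{H}=\mathbb{C}^2$. Then there exist a Hilbert space $\mathcal{K}\supseteq\mathcal{H}$ and commuting $\mathbb{A}_r$-unitaries $U_1,\dots,U_m$ on $\mathcal{K}$ such that $$f(B_1,\dots,B_m)=P_{\mathcal{H}}f(U_1,\dots,U_m)|_{\mathcal{H}}\quad\text{for every } f\in Rat(\overline{\mathbb{A}}_r^m).$$
   Context: $\mathbb{A}_r=\{z: r<|z|<1\}$, $\partial\mathbb{A}_r=\mathbb{T}\cup r\mathbb{T}$, $\mathbb{A}_r^m$ the $m$-fold product. $Rat(X)$ is the algebra of rational functions $p/q$ with $q$ zero-free on $X$, $f(\underline{T})=p(\underline{T})q(\underline{T})^{-1}$. An $\mathbb{A}_r$-contraction is an operator $T$ with $\sigma(T)\subseteq\overline{\mathbb{A}}_r$ and $\|f(T)\|\le\sup_{\overline{\mathbb{A}}_r}|f|$ for all $f\in Rat(\overline{\mathbb{A}}_r)$. An $\mathbb{A}_r$-unitary is a normal operator with spectrum in $\partial\mathbb{A}_r$. A commuting tuple $(A_1,\dots,A_m)$ is doubly commuting if $A_iA_j^*=A_j^*A_i$ for $i\ne j$. $P_{\mathcal{H}}$ is the orthogonal projection onto $\mathcal{H}$. *)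

theory Defs
  imports "HOL-Analysis.Analysis" "HOL-Computational_Algebra.Polynomial"
begin

section \<open>Annuli\<close>

definition closed_annulus :: "real \<Rightarrow> complex set" where
  "closed_annulus r = {z. r \<le> cmod z \<and> cmod z \<le> 1}"

definition annulus_boundary :: "real \<Rightarrow> complex set" where
  "annulus_boundary r = {z. cmod z = 1 \<or> cmod z = r}"

section \<open>Complex 2x2 matrices: functional calculus, spectrum, adjoint\<close>

type_synonym cmat2 = "complex^2^2"

definition mat_pow :: "cmat2 \<Rightarrow> nat \<Rightarrow> cmat2" where
  "mat_pow A k = (((**) A) ^^ k) (mat 1)"

definition mat_adj :: "cmat2 \<Rightarrow> cmat2" where
  "mat_adj A = (\<chi> i j. cnj (A $ j $ i))"

definition mat_spectrum :: "cmat2 \<Rightarrow> complex set" where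
  "mat_spectrum A = {c. \<not> invertible (A - mat c)}"

text \<open>operator norm of a matrix acting on C^2 with the Euclidean norm\<close>
definition mat_norm :: "cmat2 \<Rightarrow> real" where
  "mat_norm A = onorm (\<lambda>x. A *v x)"

text \<open>one-variable polynomial calculus p(T) and rational calculus p(T) q(T)^(-1)\<close>
definition mat_poly :: "complex poly \<Rightarrow> cmat2 \<Rightarrow> cmat2" where
  "mat_poly p A = (\<Sum>i\<le>degree p. mat (coeff p i) ** mat_pow A i)"

definition mat_rat :: "complex poly \<Rightarrow> complex poly \<Rightarrow> cmat2 \<Rightarrow> cmat2" where
  "mat_rat p q A = mat_poly p A ** matrix_inv (mat_poly q A)"

text \<open>Rat(closed annulus): f = p/q with q zero-free on the closed annulus\<close>
definition Ar_contraction_mat :: "real \<Rightarrow> cmat2 \<Rightarrow> bool" where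
  "Ar_contraction_mat r T \<longleftrightarrow>
     mat_spectrum T \<subseteq> closed_annulus r \<and>
     (\<forall>p q. (\<forall>z\<in>closed_annulus r. poly q z \<noteq> 0) \<longrightarrow>
        mat_norm (mat_rat p q T) \<le> (SUP z\<in>closed_annulus r. cmod (poly p z / poly q z)))"

definition doubly_commuting_mat :: "nat \<Rightarrow> (nat \<Rightarrow> cmat2) \<Rightarrow> bool" where
  "doubly_commuting_mat m B \<longleftrightarrow>
     (\<forall>i<m. \<forall>j<m. B i ** B j = B j ** B i) \<and>
     (\<forall>i<m. \<forall>j<m. i \<noteq> j \<longrightarrow> B i ** mat_adj (B j) = mat_adj (B j) ** B i)"

section \<open>Polynomials in m complex variables\<close>

text \<open>A polynomial in the variables z_0, ..., z_(m-1) is given by a finitely supported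
  coefficient function on multi-indices alpha (with alpha i = 0 for i >= m).\<close>

definition mpolys :: "nat \<Rightarrow> ((nat \<Rightarrow> nat) \<Rightarrow> complex) set" where
  "mpolys m = {c. finite {\<alpha>. c \<alpha> \<noteq> 0} \<and> (\<forall>\<alpha>. c \<alpha> \<noteq> 0 \<longrightarrow> (\<forall>i\<ge>m. \<alpha> i = 0))}"

definition mpoly_eval :: "nat \<Rightarrow> ((nat \<Rightarrow> nat) \<Rightarrow> complex) \<Rightarrow> (nat \<Rightarrow> complex) \<Rightarrow> complex" where
  "mpoly_eval m c z = (\<Sum>\<alpha>\<in>{\<alpha>. c \<alpha> \<noteq> 0}. c \<alpha> * (\<Prod>i<m. z i ^ \<alpha> i))"

text \<open>Rat(closed annulus^m): pairs (p,q), q zero-free on the closed polyannulus\<close>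
definition Rat_polyannulus :: "real \<Rightarrow> nat \<Rightarrow>
    (((nat \<Rightarrow> nat) \<Rightarrow> complex) \<times> ((nat \<Rightarrow> nat) \<Rightarrow> complex)) set" where
  "Rat_polyannulus r m = {(p, q). p \<in> mpolys m \<and> q \<in> mpolys m \<and>
      (\<forall>z. (\<forall>i<m. z i \<in> closed_annulus r) \<longrightarrow> mpoly_eval m q z \<noteq> 0)}"

definition mpoly_mat :: "nat \<Rightarrow> ((nat \<Rightarrow> nat) \<Rightarrow> complex) \<Rightarrow> (nat \<Rightarrow> cmat2) \<Rightarrow> cmat2" where
  "mpoly_mat m c B = (\<Sum>\<alpha>\<in>{\<alpha>. c \<alpha> \<noteq> 0}.
      mat (c \<alpha>) ** foldr (\<lambda>i M. mat_pow (B i) (\<alpha> i) ** M) [0..<m] (mat 1))"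

definition mrat_mat :: "nat \<Rightarrow> ((nat \<Rightarrow> nat) \<Rightarrow> complex) \<Rightarrow> ((nat \<Rightarrow> nat) \<Rightarrow> complex)
    \<Rightarrow> (nat \<Rightarrow> cmat2) \<Rightarrow> cmat2" where
  "mrat_mat m p q B = mpoly_mat m p B ** matrix_inv (mpoly_mat m q B)"

section \<open>The separable Hilbert space l2(N) and operators on it\<close>

definition l2 :: "(nat \<Rightarrow> complex) set" where
  "l2 = {x. summable (\<lambda>n. (cmod (x n))\<^sup>2)}"

definition l2_inner :: "(nat \<Rightarrow> complex) \<Rightarrow> (nat \<Rightarrow> complex) \<Rightarrow> complex" where
  "l2_inner x y = (\<Sum>n. cnj (x n) * y n)"

definition l2_norm :: "(nat \<Rightarrow> complex) \<Rightarrow> real" where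
  "l2_norm x = sqrt (\<Sum>n. (cmod (x n))\<^sup>2)"

type_synonym l2op = "(nat \<Rightarrow> complex) \<Rightarrow> (nat \<Rightarrow> complex)"

definition l2_bounded_op :: "l2op \<Rightarrow> bool" where
  "l2_bounded_op T \<longleftrightarrow>
     (\<forall>x\<in>l2. T x \<in> l2) \<and>
     (\<forall>x\<in>l2. \<forall>y\<in>l2. \<forall>a b. T (\<lambda>n. a * x n + b * y n) = (\<lambda>n. a * T x n + b * T y n)) \<and>
     (\<exists>C. \<forall>x\<in>l2. l2_norm (T x) \<le> C * l2_norm x)"

definition l2_is_adjoint :: "l2op \<Rightarrow> l2op \<Rightarrow> bool" where
  "l2_is_adjoint T S \<longleftrightarrow>
     l2_bounded_op S \<and> (\<forall>x\<in>l2. \<forall>y\<in>l2. l2_inner (T x) y = l2_inner x (S y))"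

definition l2_normal :: "l2op \<Rightarrow> bool" where
  "l2_normal T \<longleftrightarrow> l2_bounded_op T \<and>
     (\<exists>S. l2_is_adjoint T S \<and> (\<forall>x\<in>l2. T (S x) = S (T x)))"

text \<open>spectrum of a bounded operator: lambda such that T - lambda is not bijective on l2
  (a bounded bijection has bounded inverse by the open mapping theorem)\<close>
definition l2_spectrum :: "l2op \<Rightarrow> complex set" where
  "l2_spectrum T = {c. \<not> bij_betw (\<lambda>x n. T x n - c * x n) l2 l2}"

definition Ar_unitary :: "real \<Rightarrow> l2op \<Rightarrow> bool" where
  "Ar_unitary r U \<longleftrightarrow> l2_normal U \<and> l2_spectrum U \<subseteq> annulus_boundary r"

definition mpoly_op :: "nat \<Rightarrow> ((nat \<Rightarrow> nat) \<Rightarrow> complex) \<Rightarrow> (nat \<Rightarrow> l2op) \<Rightarrow> l2op" where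
  "mpoly_op m c U = (\<lambda>x n. \<Sum>\<alpha>\<in>{\<alpha>. c \<alpha> \<noteq> 0}.
      c \<alpha> * foldr (\<lambda>i V. (U i ^^ \<alpha> i) \<circ> V) [0..<m] id x n)"

definition mrat_op :: "nat \<Rightarrow> ((nat \<Rightarrow> nat) \<Rightarrow> complex) \<Rightarrow> ((nat \<Rightarrow> nat) \<Rightarrow> complex)
    \<Rightarrow> (nat \<Rightarrow> l2op) \<Rightarrow> l2op" where
  "mrat_op m p q U = mpoly_op m p U \<circ> inv_into l2 (mpoly_op m q U)"

text \<open>isometric embedding of H = C^2 into K = l2\<close>
definition cinner2 :: "complex^2 \<Rightarrow> complex^2 \<Rightarrow> complex" where
  "cinner2 x y = (\<Sum>i\<in>UNIV. cnj (x $ i) * y $ i)"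

definition isometric_embedding :: "(complex^2 \<Rightarrow> (nat \<Rightarrow> complex)) \<Rightarrow> bool" where
  "isometric_embedding V \<longleftrightarrow>
     (\<forall>x. V x \<in> l2) \<and>
     (\<forall>x y a b. V (a *s x + b *s y) = (\<lambda>n. a * V x n + b * V y n)) \<and>
     (\<forall>x y. l2_inner (V x) (V y) = cinner2 x y)"

end

theory Submission
  imports Defs "HOL-Complex_Analysis.Complex_Analysis"
begin

text \<open>
  Doubly commuting \<open>2 \<times> 2\<close> matrices leave little room: in a suitable orthonormal basis either all
  \<open>B\<^sub>i\<close> are diagonal, or one of them is lower triangular and all others are scalar. Everything therefore
  reduces to one variable and a tensor product of weighted bilateral shifts.

  For a scalar \<open>c\<close> in the open annulus, Sarason's Hardy spaces \<open>H\<^sub>t\<close> (the Laurent series with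
  \<open>\<parallel>z\<^sup>n\<parallel>\<^sup>2 = 1 + t r\<^sup>2\<^sup>n\<close>, a subspace of \<open>L\<^sup>2\<close> of the two circles) supply the dilation, because the
  reproducing kernel at \<open>c\<close> is an eigenvector of the adjoint of multiplication by \<open>z\<close>. For a triangular
  matrix with eigenvalues \<open>a\<close>, \<open>b\<close> the compression to the span of the kernels at \<open>a\<close> and \<open>b\<close> has the same
  eigenvalues, and it dilates every triangular matrix whose off-diagonal entry is not larger. With
  \<open>t = r / (\<bar>a\<bar> \<bar>b\<bar>)\<close> that entry is the largest one which the spectral set condition permits: if \<open>\<xi>\<close> spans the
  orthogonal complement of the kernel \<open>k\<^sub>b\<close> in the span, then \<open>\<xi> / k\<^sub>a\<close> has constant modulus on the boundary.
  Indeed \<open>\<bar>\<xi>\<bar>\<^sup>2\<close> and \<open>\<bar>k\<^sub>a\<bar>\<^sup>2\<close> are, up to scaling, representing measures of \<open>a\<close>; these form a one-parameter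
  family, and the symmetry of the Jacobi theta function identifies the parameters for this \<open>t\<close>.

  Rational functions are reached from Laurent monomials through the absolutely convergent Laurent expansion
  of \<open>1 / q\<close> on the polyannulus.
\<close>

text \<open>Why the estimate is sharp: put \<open>c = NN / Kaa\<close> and take
  \<open>lsum ee\<close> for \<xi>. The quotient \<open>f = \<xi> / k\<^sub>a\<close> vanishes at
  \<open>b\<close>, its divided difference at \<open>a\<close>, \<open>b\<close> is
  \<open>c\<close>, and its modulus on both circles is \<open>sqrt c\<close>. The second row of
  \<open>f(T)\<close> therefore yields \<open>(\<bar>\<gamma>\<bar>\<^sup>2 + \<bar>a -
  b\<bar>\<^sup>2) * c\<^sup>2 \<le> c\<close>, and Pythagoras in the span of the two kernels shows
  that the compression attains equality. Why this \<open>t\<close>: the share of a kernel's mass on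
  the outer circle is a constant plus the logarithmic derivative of theta at
  \<open>- t * \<bar>a\<bar>\<^sup>2\<close>. The reflection
  \<open>x \<mapsto> r\<^sup>2 / x\<close> reverses the sign of that derivative; exactly for this
  \<open>t\<close> it exchanges \<open>- t * \<bar>a\<bar>\<^sup>2\<close> with
  \<open>- t * \<bar>b\<bar>\<^sup>2\<close> and conjugates \<open>- t * a * cnj b\<close>. Why
  tensoring works: Gram matrices of tensor products multiply entrywise. A scalar coordinate
  \<open>z\<close> uses one vector for both basis vectors of \<open>\<complex>\<^sup>2\<close>, so
  it multiplies every entry, the off-diagonal one included, by a power of \<open>z\<close>.\<close>

no_notation fps_nth (infixl "$" 75)

section \<open>Series indexed by the integers\<close>


lemma summable_on_norm_comparison:
  fixes f :: "'a \<Rightarrow> complex"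
  assumes "g summable_on A" "\<And>x. x \<in> A \<Longrightarrow> cmod (f x) \<le> g x"
  shows "f summable_on A"
  using Infinite_Sum.abs_summable_on_comparison_test'[OF assms] Infinite_Sum.abs_summable_summable
  by blast

lemma summable_on_times:
  fixes f g :: "_ \<Rightarrow> complex"
  assumes "f summable_on A" "g summable_on B"
  shows "(\<lambda>(x, y). f x * g y) summable_on A \<times> B"
proof -
  have f: "(\<lambda>x. cmod (f x)) summable_on A" and g: "(\<lambda>x. cmod (g x)) summable_on B"
    using assms summable_on_iff_abs_summable_on_complex by blast+
  have "(\<lambda>z. norm (case z of (x, y) \<Rightarrow> f x * g y)) summable_on A \<times> B"
    unfolding Infinite_Sum.abs_summable_on_Sigma_iff
  proof (intro conjI ballI)
    fix x assume "x \<in> A"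
    show "(\<lambda>y. norm (case (x, y) of (x, y) \<Rightarrow> f x * g y)) summable_on B"
      using g by (simp add: norm_mult summable_on_cmult_right)
  next
    show "(\<lambda>x. norm (infsum (\<lambda>y. norm (case (x, y) of (x, y) \<Rightarrow> f x * g y)) B)) summable_on A"
      using f by (simp add: norm_mult infsum_cmult_right' summable_on_cmult_left abs_mult infsum_nonneg)
  qed
  then show ?thesis by (rule Infinite_Sum.abs_summable_summable)
qed

lemma infsum_times:
  fixes f g :: "_ \<Rightarrow> complex"
  shows "infsum f A * infsum g B = infsum (\<lambda>x. infsum (\<lambda>y. f x * g y) B) A"
  by (simp add: infsum_cmult_right' infsum_cmult_left')

text \<open>Fubini after the change of indices \<open>(n, j) \<mapsto> (n - j, j)\<close>. It
  multiplies Laurent series: theta with the Kronecker series, and later a kernel with its own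
  conjugate.\<close>

lemma bilateral_Cauchy_product:
  fixes f g :: "int \<Rightarrow> complex"
  assumes "f summable_on UNIV" "g summable_on UNIV"
  shows "((\<lambda>n. infsum (\<lambda>j. f (n - j) * g j) UNIV) has_sum (infsum f UNIV * infsum g UNIV)) UNIV"
proof -
  have S: "(\<lambda>(x, y). f x * g y) summable_on UNIV \<times> UNIV"
    using assms by (rule summable_on_times)
  have bij: "bij_betw (\<lambda>(n, j). (n - j, j)) (UNIV \<times> UNIV :: (int \<times> int) set) (UNIV \<times> UNIV)"
    by (rule bij_betw_byWitness[where f' = "\<lambda>(n, j). (n + j, j)"]) auto
  have S': "(\<lambda>(n, j). f (n - j) * g j) summable_on UNIV \<times> UNIV"
    using summable_on_reindex_bij_betw[OF bij, of "\<lambda>(x, y). f x * g y"] S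
    by (simp add: case_prod_unfold)
  have "infsum f UNIV * infsum g UNIV = infsum (\<lambda>x. infsum (\<lambda>y. f x * g y) UNIV) UNIV"
    by (rule infsum_times)
  also have "\<dots> = infsum (\<lambda>(x, y). f x * g y) (UNIV \<times> UNIV)"
    using infsum_Sigma'_banach[of "\<lambda>x y. f x * g y"] S by simp
  also have "\<dots> = infsum (\<lambda>(n, j). f (n - j) * g j) (UNIV \<times> UNIV)"
    using infsum_reindex_bij_betw[OF bij, of "\<lambda>(x, y). f x * g y"] by (simp add: case_prod_unfold)
  also have "\<dots> = infsum (\<lambda>n. infsum (\<lambda>j. f (n - j) * g j) UNIV) UNIV"
    using infsum_Sigma'_banach[of "\<lambda>n j. f (n - j) * g j"] S' by simp
  finally have eq: "infsum f UNIV * infsum g UNIV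
    = infsum (\<lambda>n. infsum (\<lambda>j. f (n - j) * g j) UNIV) UNIV" .
  have "(\<lambda>n. infsum (\<lambda>j. f (n - j) * g j) UNIV) summable_on UNIV"
    using summable_on_Sigma_banach[of "\<lambda>n j. f (n - j) * g j"] S' by simp
  then show ?thesis
    unfolding eq by (rule has_sum_infsum)
qed

lemma infsum_shift_int: "infsum (\<lambda>n::int. f (n + k)) UNIV = infsum f UNIV"
  by (rule infsum_reindex_bij_betw) (rule bij_betw_byWitness[where f' = "\<lambda>n. n - k"], auto)

lemma infsum_uminus_int: "infsum (\<lambda>n::int. f (- n)) UNIV = infsum f UNIV"
  by (rule infsum_reindex_bij_betw) (rule bij_betw_byWitness[where f' = uminus], auto)

lemma infsum_diff_int: "infsum (\<lambda>n::int. f (k - n)) UNIV = infsum f UNIV"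
  by (rule infsum_reindex_bij_betw) (rule bij_betw_byWitness[where f' = "\<lambda>n. k - n"], auto)

lemma summable_on_shift_int:
  "(\<lambda>n::int. f (n + k)) summable_on UNIV \<longleftrightarrow> f summable_on UNIV"
  by (rule summable_on_reindex_bij_betw) (rule bij_betw_byWitness[where f' = "\<lambda>n. n - k"], auto)

lemma infsum_int_odd_eq_0:
  fixes f :: "int \<Rightarrow> complex"
  assumes "\<And>n. f (k - n) = - f n"
  shows "infsum f UNIV = 0"
proof -
  have "infsum f UNIV = infsum (\<lambda>n. f (k - n)) UNIV" by (simp add: infsum_diff_int)
  also have "\<dots> = - infsum f UNIV" by (simp add: assms infsum_uminus)
  finally show ?thesis by simp
qed

text \<open>Tannery's theorem along an enumeration of the integers. It carries the mass identity
  from distinct points over to \<open>a = b\<close>.\<close>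

lemma dominated_convergence_infsum_int:
  fixes f :: "nat \<Rightarrow> int \<Rightarrow> complex"
  assumes lim: "\<And>n. (\<lambda>k. f k n) \<longlonglongrightarrow> g n"
    and bound: "\<And>k n. cmod (f k n) \<le> H n" and H: "H summable_on UNIV"
  shows "(\<lambda>k. infsum (f k) UNIV) \<longlonglongrightarrow> infsum g UNIV"
proof -
  define \<phi> where "\<phi> = (from_nat_into (UNIV :: int set))"
  have bij: "bij_betw \<phi> UNIV UNIV"
    unfolding \<phi>_def by (rule bij_betw_from_nat_into) (auto simp: infinite_UNIV_int)
  have H': "summable (\<lambda>i. H (\<phi> i))"
    using summable_on_reindex_bij_betw[OF bij, of H] H summable_on_imp_summable by blast
  have g: "cmod (g n) \<le> H n" for n
    by (rule Lim_bounded[OF tendsto_norm[OF lim]]) (use bound in auto)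
  have conv: "infsum u UNIV = (\<Sum>i. u (\<phi> i))" if "\<And>n. cmod (u n) \<le> H n" for u :: "int \<Rightarrow> complex"
  proof -
    have "u summable_on UNIV" by (rule summable_on_norm_comparison[OF H]) (use that in auto)
    then have "((\<lambda>i. u (\<phi> i)) has_sum infsum u UNIV) UNIV"
      using has_sum_reindex_bij_betw[OF bij, of u] has_sum_infsum by blast
    then show ?thesis using has_sum_imp_sums sums_unique by metis
  qed
  have "(\<lambda>k. \<Sum>i. f k (\<phi> i)) \<longlonglongrightarrow> (\<Sum>i. g (\<phi> i))"
    using tannerys_theorem[of "\<lambda>i k. f k (\<phi> i)" "\<lambda>i. g (\<phi> i)" sequentially "\<lambda>i. H (\<phi> i)"]
      lim bound H' by (auto intro: always_eventually)
  then show ?thesis using conv bound g by simp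
qed

section \<open>Bilateral sequences of geometric decay\<close>

definition geo_decay :: "(int \<Rightarrow> complex) \<Rightarrow> bool" where
  "geo_decay x \<longleftrightarrow> (\<exists>C \<sigma>. 0 < \<sigma> \<and> \<sigma> < 1 \<and> (\<forall>n. cmod (x n) \<le> C * \<sigma> ^ nat \<bar>n\<bar>))"

lemma summable_on_geometric_int:
  fixes \<sigma> :: real
  assumes "0 < \<sigma>" "\<sigma> < 1"
  shows "(\<lambda>n::int. \<sigma> ^ nat \<bar>n\<bar>) summable_on UNIV"
proof -
  have s: "(\<lambda>k::nat. \<sigma> ^ k) summable_on UNIV"
    using assms by (intro norm_summable_imp_summable_on) (simp add: norm_power)
  have "(\<lambda>n::int. \<sigma> ^ nat \<bar>n\<bar>) summable_on (range int)"
    using summable_on_reindex[of int UNIV "\<lambda>n::int. \<sigma> ^ nat \<bar>n\<bar>"] s by (simp add: o_def)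
  moreover have "(\<lambda>n::int. \<sigma> ^ nat \<bar>n\<bar>) summable_on (range (\<lambda>k. - int k))"
    using summable_on_reindex[of "\<lambda>k. - int k" UNIV "\<lambda>n::int. \<sigma> ^ nat \<bar>n\<bar>"] s
    by (simp add: o_def inj_def)
  ultimately have "(\<lambda>n::int. \<sigma> ^ nat \<bar>n\<bar>) summable_on (range int \<union> range (\<lambda>k. - int k))"
    by (rule summable_on_union)
  moreover have "range int \<union> range (\<lambda>k. - int k) = UNIV"
    by (metis (mono_tags, lifting) Un_iff int_cases2 rangeI UNIV_eq_I)
  ultimately show ?thesis by simp
qed

lemma geo_decay_summable: "geo_decay x \<Longrightarrow> x summable_on UNIV"
  unfolding geo_decay_def
  by (elim exE conjE, rule summable_on_norm_comparison[of "\<lambda>n. _ * _ ^ nat \<bar>n\<bar>"])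
     (auto intro: summable_on_cmult_right summable_on_geometric_int)

text \<open>Half of the decay pays for the polynomial: with \<open>\<tau> = sqrt \<sigma>\<close>,
  one factor \<open>\<tau> ^ k\<close> absorbs it and the other one survives. Degree two is enough,
  since a divided difference on the diagonal contributes a factor \<open>n\<close> and its square
  \<open>n\<^sup>2\<close>.\<close>

lemma geo_decay_poly_bound:
  assumes "geo_decay x" "\<And>n. cmod (y n) \<le> K * (1 + real_of_int \<bar>n\<bar>)\<^sup>2 * cmod (x n)" "0 \<le> K"
  shows "geo_decay y"
proof -
  obtain C \<sigma> where C: "0 < \<sigma>" "\<sigma> < 1" "\<And>n. cmod (x n) \<le> C * \<sigma> ^ nat \<bar>n\<bar>"
    using assms unfolding geo_decay_def by blast
  have C0: "0 \<le> C" using C(3)[of 0] by (simp) (meson norm_ge_zero order_trans)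
  define \<tau> where "\<tau> = sqrt \<sigma>"
  have \<tau>: "0 < \<tau>" "\<tau> < 1" "\<tau> * \<tau> = \<sigma>" using C by (auto simp: \<tau>_def)
  have "(\<lambda>k. (1 + real k)\<^sup>2 * \<tau> ^ k) \<longlonglongrightarrow> 0"
  proof -
    \<comment> \<open>A second square root exhibits \<open>(1 + k)\<^sup>2 * \<tau> ^ k\<close> as
      the square of \<open>(1 + k) * \<rho> ^ k\<close>, which reduces the claim to the limit of
      \<open>k * \<rho> ^ k\<close>.\<close>
    define \<rho> where "\<rho> = sqrt \<tau>"
    have \<rho>: "0 < \<rho>" "\<rho> < 1" "\<rho> * \<rho> = \<tau>" using \<tau> by (auto simp: \<rho>_def)
    have "(\<lambda>k. real k * \<rho> ^ k + \<rho> ^ k) \<longlonglongrightarrow> 0 + 0"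
      using powser_times_n_limit_0[of \<rho>] \<rho> by (intro tendsto_add LIMSEQ_realpow_zero) auto
    then have "(\<lambda>k. (real k * \<rho> ^ k + \<rho> ^ k)\<^sup>2) \<longlonglongrightarrow> 0\<^sup>2"
      by (intro tendsto_power) simp
    moreover have "(real k * \<rho> ^ k + \<rho> ^ k)\<^sup>2 = (1 + real k)\<^sup>2 * \<tau> ^ k" for k
      unfolding \<rho>(3)[symmetric] by (simp add: power_mult_distrib power2_eq_square algebra_simps)
    ultimately show ?thesis by simp
  qed
  then have "Bseq (\<lambda>k. (1 + real k)\<^sup>2 * \<tau> ^ k)"
    using convergent_imp_Bseq convergent_def by blast
  then obtain D where D: "D > 0" "\<And>k. \<bar>(1 + real k)\<^sup>2 * \<tau> ^ k\<bar> \<le> D"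
    unfolding Bseq_def by auto
  have "cmod (y n) \<le> (K * C * D) * \<tau> ^ nat \<bar>n\<bar>" for n
  proof -
    let ?k = "nat \<bar>n\<bar>"
    have "cmod (y n) \<le> K * (1 + real ?k)\<^sup>2 * (C * \<sigma> ^ ?k)"
      using order_trans[OF assms(2)[of n] mult_left_mono[OF C(3)[of n], of "K * (1 + real_of_int \<bar>n\<bar>)\<^sup>2"]]
        assms(3) by simp
    also have "\<dots> = K * C * ((1 + real ?k)\<^sup>2 * \<tau> ^ ?k) * \<tau> ^ ?k"
      unfolding \<tau>(3)[symmetric] by (simp add: power_mult_distrib)
    also have "\<dots> \<le> K * C * D * \<tau> ^ ?k"
      using D(2)[of ?k] C0 assms(3) \<tau> by (intro mult_right_mono mult_left_mono) auto
    finally show ?thesis .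
  qed
  then show ?thesis using \<tau> unfolding geo_decay_def by blast
qed

lemma geo_decay_bound:
  assumes "geo_decay x" "\<And>n. cmod (y n) \<le> K * cmod (x n)"
  shows "geo_decay y"
proof (rule geo_decay_poly_bound[OF assms(1)])
  fix n
  have "cmod (y n) \<le> max K 0 * 1 * cmod (x n)"
    using assms(2)[of n] by (smt (verit) mult_right_mono norm_ge_zero)
  also have "\<dots> \<le> max K 0 * (1 + real_of_int \<bar>n\<bar>)\<^sup>2 * cmod (x n)"
    by (intro mult_right_mono mult_left_mono) auto
  finally show "cmod (y n) \<le> max K 0 * (1 + real_of_int \<bar>n\<bar>)\<^sup>2 * cmod (x n)" .
qed simp

lemma geo_decay_cmult: "geo_decay x \<Longrightarrow> geo_decay (\<lambda>n. c * x n)"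
  by (erule geo_decay_bound[where K = "cmod c"]) (simp add: norm_mult)

lemma geo_decay_of_int_mult: "geo_decay x \<Longrightarrow> geo_decay (\<lambda>n. of_int n * x n)"
proof (erule geo_decay_poly_bound[where K = 1])
  fix n
  have "real_of_int \<bar>n\<bar> \<le> (1 + real_of_int \<bar>n\<bar>)\<^sup>2" by (simp add: power2_eq_square algebra_simps)
  then show "cmod (of_int n * x n) \<le> 1 * (1 + real_of_int \<bar>n\<bar>)\<^sup>2 * cmod (x n)"
    by (simp add: norm_mult mult_right_mono)
qed simp

lemma geo_decay_add:
  assumes "geo_decay x" "geo_decay y"
  shows "geo_decay (\<lambda>n. x n + y n)"
proof -
  obtain C \<sigma> where C: "0 < \<sigma>" "\<sigma> < 1" "\<And>n. cmod (x n) \<le> C * \<sigma> ^ nat \<bar>n\<bar>"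
    using assms unfolding geo_decay_def by blast
  obtain D \<tau> where D: "0 < \<tau>" "\<tau> < 1" "\<And>n. cmod (y n) \<le> D * \<tau> ^ nat \<bar>n\<bar>"
    using assms unfolding geo_decay_def by blast
  have C0: "0 \<le> C" using C(3)[of 0] by (simp) (meson norm_ge_zero order_trans)
  have D0: "0 \<le> D" using D(3)[of 0] by (simp) (meson norm_ge_zero order_trans)
  have "cmod (x n + y n) \<le> (C + D) * max \<sigma> \<tau> ^ nat \<bar>n\<bar>" for n
  proof -
    have "cmod (x n + y n) \<le> C * \<sigma> ^ nat \<bar>n\<bar> + D * \<tau> ^ nat \<bar>n\<bar>"
      using C(3)[of n] D(3)[of n] norm_triangle_ineq[of "x n" "y n"] by linarith
    also have "\<dots> \<le> C * max \<sigma> \<tau> ^ nat \<bar>n\<bar> + D * max \<sigma> \<tau> ^ nat \<bar>n\<bar>"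
      using C D C0 D0 by (intro add_mono mult_left_mono power_mono) auto
    finally show ?thesis by (simp add: algebra_simps)
  qed
  moreover have "0 < max \<sigma> \<tau>" "max \<sigma> \<tau> < 1" using C D by auto
  ultimately show ?thesis unfolding geo_decay_def by blast
qed

lemma geo_decay_diff: "geo_decay x \<Longrightarrow> geo_decay y \<Longrightarrow> geo_decay (\<lambda>n. x n - y n)"
  using geo_decay_add[OF _ geo_decay_cmult[of y "-1"]] by simp

lemma geo_decay_cnj: "geo_decay x \<Longrightarrow> geo_decay (\<lambda>n. cnj (x n))"
  unfolding geo_decay_def by simp

lemma geo_decayI:
  assumes "0 < \<sigma>" "\<sigma> < 1" "0 < \<tau>" "\<tau> < 1"
    and "\<And>n. n \<ge> 0 \<Longrightarrow> cmod (x n) \<le> C * \<sigma> ^ nat n"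
    and "\<And>n. n < 0 \<Longrightarrow> cmod (x n) \<le> D * \<tau> ^ nat (- n)"
  shows "geo_decay x"
proof -
  have "cmod (x n) \<le> (\<bar>C\<bar> + \<bar>D\<bar>) * max \<sigma> \<tau> ^ nat \<bar>n\<bar>" for n
  proof (cases "n \<ge> 0")
    case True
    have "C * \<sigma> ^ nat n \<le> (\<bar>C\<bar> + \<bar>D\<bar>) * max \<sigma> \<tau> ^ nat n"
      using assms by (intro mult_mono power_mono) auto
    then show ?thesis using assms(5)[of n] True by simp
  next
    case False
    have "D * \<tau> ^ nat (-n) \<le> (\<bar>C\<bar> + \<bar>D\<bar>) * max \<sigma> \<tau> ^ nat (-n)"
      using assms by (intro mult_mono power_mono) auto
    then show ?thesis using assms(6)[of n] False by simp
  qed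
  moreover have "0 < max \<sigma> \<tau>" "max \<sigma> \<tau> < 1" using assms by auto
  ultimately show ?thesis unfolding geo_decay_def by blast
qed

section \<open>Theta functions and the Kronecker series\<close>


definition theta_coeff :: "real \<Rightarrow> int \<Rightarrow> complex" where
  "theta_coeff q n = (-1) powi n * of_real (q powi (n * (n - 1) div 2))"

text \<open>The Jacobi theta function, normalised by the exponent \<open>n * (n - 1) / 2\<close> so
  that it has a zero at \<open>x = 1\<close>. By the triple product it vanishes precisely at the
  integer powers of \<open>q\<close>.\<close>

definition theta :: "real \<Rightarrow> complex \<Rightarrow> complex" where
  "theta q x = (\<Sum>\<^sub>\<infinity>n. theta_coeff q n * x powi n)"

text \<open>The Euler derivative, \<open>x\<close> times the derivative of \<open>theta q\<close>.
  Its quotient by \<open>theta q\<close> is the logarithmic derivative that the reflection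
  \<open>x \<mapsto> q / x\<close> merely negates.\<close>

definition theta_deriv :: "real \<Rightarrow> complex \<Rightarrow> complex" where
  "theta_deriv q x = (\<Sum>\<^sub>\<infinity>n. of_int n * theta_coeff q n * x powi n)"

lemma int_shift_invariant:
  assumes "\<And>n::int. f (n + 1) = f n"
  shows "f n = f 0"
proof (induction n rule: int_induct[where k = 0])
  case (step2 i)
  then show ?case using assms[of "i - 1"] by simp
qed (simp_all add: assms)

text \<open>The ratio of consecutive terms tends to 0, so it drops below \<open>1 / 2\<close> from
  some \<open>N\<close> on; the finitely many earlier terms go into the constant.\<close>

lemma geo_decay_superexponential:
  fixes u :: "nat \<Rightarrow> real"
  assumes "0 < q" "q < 1" "0 \<le> c" "\<And>n. 0 \<le> u n" "\<And>n. u (Suc n) = q ^ n * c * u n"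
  shows "\<exists>C. \<forall>n. u n \<le> C * (1/2) ^ n"
proof -
  have "(\<lambda>n. q ^ n * c) \<longlonglongrightarrow> 0 * c"
    using assms by (intro tendsto_mult LIMSEQ_realpow_zero tendsto_const) auto
  then have "eventually (\<lambda>n. q ^ n * c < 1/2) sequentially"
    by (intro order_tendstoD(2)[of _ 0]) auto
  then obtain N where N: "\<And>n. n \<ge> N \<Longrightarrow> q ^ n * c < 1/2"
    unfolding eventually_sequentially by blast
  have late: "u (N + k) * 2 ^ (N + k) \<le> u N * 2 ^ N" for k
  proof (induction k)
    case (Suc k)
    have "u (N + Suc k) * 2 ^ (N + Suc k) = (q ^ (N + k) * c * 2) * (u (N + k) * 2 ^ (N + k))"
      using assms(5)[of "N + k"] by simp
    also have "\<dots> \<le> 1 * (u (N + k) * 2 ^ (N + k))"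
      using N[of "N + k"] assms(4) by (intro mult_right_mono) auto
    finally show ?case using Suc by linarith
  qed simp
  define C where "C = (\<Sum>i\<le>N. u i * 2 ^ i)"
  have "u n * 2 ^ n \<le> C" for n
  proof (cases "n \<le> N")
    case True
    then show ?thesis unfolding C_def using assms(4) by (intro member_le_sum) auto
  next
    case False
    then have "u n * 2 ^ n \<le> u N * 2 ^ N" using late[of "n - N"] by simp
    also have "\<dots> \<le> C" unfolding C_def using assms(4) by (intro member_le_sum) auto
    finally show ?thesis .
  qed
  then show ?thesis by (intro exI[of _ C]) (simp add: field_simps power_divide)
qed

context
  fixes q :: real
  assumes q: "0 < q" "q < 1"
begin

lemma theta_coeff_nz: "theta_coeff q n \<noteq> 0"
  using q by (simp add: theta_coeff_def)

lemma theta_coeff_Suc: "theta_coeff q (n + 1) = - of_real (q powi n) * theta_coeff q n"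
proof -
  have "(n + 1) * (n + 1 - 1) div 2 = n * (n - 1) div 2 + n"
    using div_mult_self1[of "2::int" "n * (n - 1)" n] by (simp add: algebra_simps)
  then show ?thesis
    using q by (simp add: theta_coeff_def power_int_add)
qed

lemma theta_coeff_uminus: "theta_coeff q (- n) = theta_coeff q n * of_real (q powi n)"
proof -
  have "(- n) * (- n - 1) div 2 = n * (n - 1) div 2 + n"
    using div_mult_self1[of "2::int" "n * (n - 1)" n] by (simp add: algebra_simps)
  moreover have "(-1 :: complex) powi (- n) = (-1) powi n"
    by (simp add: power_int_minus_one_minus)
  ultimately show ?thesis
    using q by (simp add: theta_coeff_def power_int_add)
qed

lemma theta_coeff_refl: "theta_coeff q (1 - n) = - theta_coeff q n"
proof -
  have "(1 - n) * (1 - n - 1) div 2 = n * (n - 1) div 2"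
    by (simp add: algebra_simps)
  moreover have "(-1 :: complex) powi (1 - n) = - ((-1) powi n)"
    using power_int_add[of "-1 :: complex" 1 "- n"] by (simp add: power_int_minus_one_minus)
  ultimately show ?thesis
    by (simp add: theta_coeff_def)
qed

lemma theta_coeff_geo:
  assumes "x \<noteq> 0"
  shows "geo_decay (\<lambda>n. theta_coeff q n * x powi n)"
proof -
  have *: "\<exists>C. \<forall>n. cmod (theta_coeff q (int n) * x powi int n) \<le> C * (1/2) ^ n" if "x \<noteq> 0" for x
  proof (rule geo_decay_superexponential[OF q, of "cmod x"])
    show "cmod (theta_coeff q (int (Suc n)) * x powi int (Suc n)) =
         q ^ n * cmod x * cmod (theta_coeff q (int n) * x powi int n)" for n
      using theta_coeff_Suc[of "int n"] that q
      by (simp add: norm_mult power_int_add norm_power add.commute)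
  qed auto
  obtain C where C: "\<And>n. cmod (theta_coeff q (int n) * x powi int n) \<le> C * (1/2) ^ n"
    using *[OF assms] by blast
  \<comment> \<open>By \<open>theta_coeff_uminus\<close> the negative half of the series at
    \<open>x\<close> is the positive half at \<open>q / x\<close>.\<close>
  have "of_real q / x \<noteq> 0" using assms q by simp
  then obtain D where D: "\<And>n. cmod (theta_coeff q (int n) * (of_real q / x) powi int n) \<le> D * (1/2) ^ n"
    using * by blast
  show ?thesis
  proof (rule geo_decayI[of "1/2" "1/2"])
    fix n :: int assume "n \<ge> 0"
    then show "cmod (theta_coeff q n * x powi n) \<le> C * (1/2) ^ nat n"
      using C[of "nat n"] by simp
  next
    fix n :: int assume n: "n < 0"
    have "theta_coeff q n * x powi n = theta_coeff q (-n) * (of_real q / x) powi (-n)"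
      using theta_coeff_uminus[of "-n"] assms q
      by (simp add: power_int_divide_distrib power_int_minus field_simps)
    then show "cmod (theta_coeff q n * x powi n) \<le> D * (1/2) ^ nat (- n)"
      using D[of "nat (- n)"] n by simp
  qed auto
qed

text \<open>The involution \<open>n \<mapsto> 1 - n\<close> preserves the exponent
  \<open>n * (n - 1) / 2\<close> and reverses the sign, so the terms cancel in pairs.\<close>

lemma theta_one: "theta q 1 = 0"
  unfolding theta_def by (rule infsum_int_odd_eq_0[of _ 1]) (simp add: theta_coeff_refl)

text \<open>Reversing the summation index costs a factor \<open>q powi n\<close>, which turns
  \<open>x\<close> into \<open>q / x\<close>. On the circle of radius \<open>sqrt q\<close> this
  reflection is complex conjugation.\<close>

lemma theta_refl:
  assumes "x \<noteq> 0"
  shows "theta q (of_real q / x) = theta q x" "theta_deriv q (of_real q / x) = - theta_deriv q x"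
proof -
  have "theta_coeff q n * (of_real q / x) powi n = theta_coeff q (- n) * x powi (- n)" for n
    using theta_coeff_uminus[of n] assms
    by (simp add: power_int_divide_distrib power_int_minus field_simps)
  then show "theta q (of_real q / x) = theta q x"
    unfolding theta_def using infsum_uminus_int[of "\<lambda>n. theta_coeff q n * x powi n"] by simp
  have "of_int n * theta_coeff q n * (of_real q / x) powi n
      = - (of_int (- n) * theta_coeff q (- n) * x powi (- n))" for n
    using theta_coeff_uminus[of n] assms
    by (simp add: power_int_divide_distrib power_int_minus field_simps)
  then show "theta_deriv q (of_real q / x) = - theta_deriv q x"
    unfolding theta_deriv_def
    using infsum_uminus_int[of "\<lambda>n. of_int n * theta_coeff q n * x powi n"]
    by (simp only: infsum_uminus)
qed

lemma theta_q: "theta q (of_real q) = 0"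
  using theta_refl(1)[of 1] theta_one by simp

lemma cnj_theta_coeff: "cnj (theta_coeff q n) = theta_coeff q n"
  by (simp add: theta_coeff_def)

lemma cnj_theta:
  "cnj (theta q x) = theta q (cnj x)" "cnj (theta_deriv q x) = theta_deriv q (cnj x)"
  by (simp_all add: theta_def theta_deriv_def cnj_theta_coeff flip: infsum_cnj)

lemma theta_negative_nz:
  assumes "0 < u"
  shows "theta q (- of_real u) \<noteq> 0"
proof -
  let ?f = "\<lambda>n::int. q powi (n * (n - 1) div 2) * u powi n"
  have eq: "theta_coeff q n * (- of_real u) powi n = of_real (?f n)" for n
  proof -
    have "(- of_real u :: complex) powi n = (-1) powi n * of_real u powi n"
      using power_int_mult_distrib[of "-1 :: complex" "of_real u" n] by simp
    moreover have "(-1 :: complex) powi n * (-1) powi n = 1"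
      by (simp flip: power_int_mult_distrib)
    ultimately show ?thesis by (simp add: theta_coeff_def)
  qed
  have "(\<lambda>n. theta_coeff q n * (- of_real u) powi n) summable_on UNIV"
    using assms by (intro geo_decay_summable theta_coeff_geo) auto
  then have s: "?f summable_on UNIV"
    unfolding eq using summable_on_Re[of "\<lambda>n. complex_of_real (?f n)" UNIV]
    by (simp only: Re_complex_of_real)
  have "sum ?f {0} \<le> infsum ?f UNIV"
    using assms q by (intro finite_sum_le_infsum s) auto
  then have "infsum ?f UNIV \<noteq> 0" by simp
  moreover have "theta q (- of_real u) = of_real (infsum ?f UNIV)"
    unfolding theta_def eq using has_sum_infsum[OF s] by (intro infsumI) (simp only: has_sum_of_real_iff)
  ultimately show ?thesis by simp
qed

section \<open>The Kronecker series and its square analogue\<close>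

definition kron :: "complex \<Rightarrow> int \<Rightarrow> complex" where
  "kron y n = 1 / (1 - y * of_real (q powi n))"

text \<open>The coefficient of \<open>x powi n\<close> in the product of \<open>theta q x\<close>
  with the Laurent series whose coefficients are \<open>kron y n ^ k\<close>. The case
  \<open>k = 1\<close> will give inner products of kernels, \<open>k = 2\<close> the part of them on
  the outer circle.\<close>

definition kron_const :: "complex \<Rightarrow> nat \<Rightarrow> int \<Rightarrow> complex" where
  "kron_const y k n = (\<Sum>\<^sub>\<infinity>j. theta_coeff q j * kron y (n - j) ^ k)"

context
  fixes y :: complex
  assumes y: "y \<noteq> 0" "\<And>n. y * of_real (q powi n) \<noteq> 1"
begin

text \<open>As \<open>n\<close> grows, \<open>kron y n\<close> tends to 1; as \<open>n\<close>
  decreases, it behaves like \<open>- q powi (- n) / y\<close>. Hence the series in \<open>x\<close>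
  converges for \<open>q < cmod x < 1\<close>.\<close>

lemma kron_bound:
  "\<exists>K\<ge>0. (\<forall>n. cmod (kron y n) \<le> K) \<and> (\<forall>n\<le>0. cmod (kron y n) \<le> K * q powi (- n))"
proof -
  have 1: "(\<lambda>k. 1 / (1 - y * of_real (q ^ k))) \<longlonglongrightarrow> 1 / (1 - y * of_real 0)"
    using q by (intro tendsto_intros LIMSEQ_realpow_zero) auto
  then have "Bseq (\<lambda>k. 1 / (1 - y * of_real (q ^ k)))"
    using convergent_imp_Bseq convergent_def by blast
  then obtain K1 where K1: "K1 > 0" "\<And>k. cmod (1 / (1 - y * of_real (q ^ k))) \<le> K1"
    unfolding Bseq_def by blast
  have 2: "(\<lambda>k. 1 / (of_real (q ^ k) - y)) \<longlonglongrightarrow> 1 / (of_real 0 - y)"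
    using q y by (intro tendsto_intros LIMSEQ_realpow_zero) auto
  then have "Bseq (\<lambda>k. 1 / (of_real (q ^ k) - y))"
    using convergent_imp_Bseq convergent_def by blast
  then obtain K2 where K2: "K2 > 0" "\<And>k. cmod (1 / (of_real (q ^ k) - y)) \<le> K2"
    unfolding Bseq_def by blast
  define K where "K = max K1 K2"
  have pos: "cmod (kron y n) \<le> K" if "n \<ge> 0" for n
    using K1(2)[of "nat n"] that by (simp add: kron_def K_def power_int_def)
  have neg: "cmod (kron y n) \<le> K * q powi (- n)" if "n \<le> 0" for n
  proof -
    have "y * of_real (q powi n) \<noteq> 1" by (rule y)
    then have nz: "of_real (q ^ nat (- n)) - y \<noteq> 0"
      using that q by (cases "n = 0") (auto simp: power_int_def field_simps)
    have "kron y n = of_real (q ^ nat (- n)) * (1 / (of_real (q ^ nat (- n)) - y))"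
      using that q nz y(2)[of n]
      by (cases "n = 0") (auto simp: kron_def power_int_def field_simps)
    then have "cmod (kron y n) = q ^ nat (- n) * cmod (1 / (of_real (q ^ nat (- n)) - y))"
      using q by (simp add: norm_mult norm_divide norm_power)
    also have "\<dots> \<le> q ^ nat (- n) * K"
      using K2(2)[of "nat (- n)"] q by (intro mult_left_mono) (auto simp: K_def)
    finally show ?thesis using that by (simp add: power_int_def mult.commute)
  qed
  have "cmod (kron y n) \<le> K" for n
  proof (cases "n \<ge> 0")
    case False
    then have "q powi (- n) \<le> 1" using q by (simp add: power_int_def power_le_one)
    then have "K * q powi (- n) \<le> K * 1" using K1 by (intro mult_left_mono) (auto simp: K_def)
    then show ?thesis using neg[of n] False by simp
  qed (use pos in auto)
  moreover have "K \<ge> 0" using K1 by (simp add: K_def)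
  ultimately show ?thesis using neg by blast
qed

lemma kron_geo:
  assumes "q < cmod x" "cmod x < 1"
  shows "geo_decay (\<lambda>n. kron y n * x powi n)" "geo_decay (\<lambda>n. kron y n ^ 2 * x powi n)"
proof -
  obtain K where K: "K \<ge> 0" "\<And>n. cmod (kron y n) \<le> K" "\<And>n. n \<le> 0 \<Longrightarrow> cmod (kron y n) \<le> K * q powi (- n)"
    using kron_bound by blast
  have x: "x \<noteq> 0" using assms q by auto
  show 1: "geo_decay (\<lambda>n. kron y n * x powi n)"
  proof (rule geo_decayI[of "cmod x" "q / cmod x"])
    fix n :: int assume "n \<ge> 0"
    then show "cmod (kron y n * x powi n) \<le> K * cmod x ^ nat n"
      using K(2)[of n] by (auto simp: norm_mult norm_power_int power_int_def norm_power intro!: mult_right_mono)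
  next
    fix n :: int assume n: "n < 0"
    have "cmod (kron y n * x powi n) \<le> (K * q powi (- n)) * cmod x powi n"
      using K(3)[of n] n by (auto simp: norm_mult norm_power_int intro!: mult_right_mono)
    also have "\<dots> = K * (q / cmod x) ^ nat (- n)"
      using n x by (simp add: power_int_def power_divide field_simps)
    finally show "cmod (kron y n * x powi n) \<le> K * (q / cmod x) ^ nat (- n)" .
  qed (use assms q x in auto)
  show "geo_decay (\<lambda>n. kron y n ^ 2 * x powi n)"
    by (rule geo_decay_bound[OF 1, of _ K])
       (use K in \<open>auto simp: norm_mult power2_eq_square mult.assoc intro!: mult_right_mono\<close>)
qed

lemma theta_kron_summable: "(\<lambda>j. theta_coeff q j * kron y (n - j) ^ k) summable_on UNIV"
proof -
  obtain K where K: "K \<ge> 0" "\<And>n. cmod (kron y n) \<le> K" using kron_bound by blast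
  have "geo_decay (\<lambda>j. theta_coeff q j)" using theta_coeff_geo[of 1] by simp
  then have "geo_decay (\<lambda>j. theta_coeff q j * kron y (n - j) ^ k)"
    by (rule geo_decay_bound[of _ _ "K ^ k"])
       (use K in \<open>auto simp: norm_mult norm_power mult.commute[of "K ^ k"] intro!: mult_left_mono power_mono\<close>)
  then show ?thesis by (rule geo_decay_summable)
qed

text \<open>Division with remainder gives \<open>q\<^sup>i / (1 - y * q\<^sup>(n-i)) = q\<^sup>i + y
  * q\<^sup>n / (1 - y * q\<^sup>(n-i))\<close>. Summed against \<open>theta_coeff\<close>, the
  first term on the right contributes \<open>theta q q\<close>, which is 0.\<close>

lemma kron_const_Suc:
  "kron_const y 1 (n + 1) = - y * of_real (q powi n) * kron_const y 1 n"
  "kron_const y 2 (n + 1) = - y * of_real (q powi n) * (kron_const y 1 n + kron_const y 2 n)"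
proof -
  let ?Q = "\<lambda>n. of_real (q powi n) :: complex"
  have S: "(\<lambda>j. theta_coeff q j * ?Q j) summable_on UNIV"
    using geo_decay_summable[OF theta_coeff_geo[of "of_real q"]] q by simp
  have th: "infsum (\<lambda>j. theta_coeff q j * ?Q j) UNIV = 0"
    using theta_q by (simp add: theta_def)
  have shift: "kron_const y k (n + 1) = - infsum (\<lambda>i. theta_coeff q i * ?Q i * kron y (n - i) ^ k) UNIV" for k
  proof -
    have "kron_const y k (n + 1) = infsum (\<lambda>i. theta_coeff q (i + 1) * kron y (n + 1 - (i + 1)) ^ k) UNIV"
      unfolding kron_const_def
      using infsum_shift_int[of "\<lambda>j. theta_coeff q j * kron y (n + 1 - j) ^ k" 1] by simp
    also have "\<dots> = infsum (\<lambda>i. - (theta_coeff q i * ?Q i * kron y (n - i) ^ k)) UNIV"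
      by (intro infsum_cong) (simp add: theta_coeff_Suc)
    finally show ?thesis by (simp only: infsum_uminus)
  qed
  have nz: "1 - y * ?Q k \<noteq> 0" for k using y(2)[of k] by simp
  have key1: "?Q i * kron y (n - i) = ?Q i + y * ?Q n * kron y (n - i)" for i
  proof -
    have "?Q n = ?Q i * ?Q (n - i)" using q by (simp flip: power_int_add of_real_mult)
    then show ?thesis using nz[of "n - i"] by (simp add: kron_def field_simps)
  qed
  have key2: "?Q i * kron y (n - i) ^ 2
      = ?Q i + y * ?Q n * kron y (n - i) + y * ?Q n * kron y (n - i) ^ 2" for i
  proof -
    have "?Q i * kron y (n - i) ^ 2 = (?Q i + y * ?Q n * kron y (n - i)) * kron y (n - i)"
      using key1[of i] by (simp add: power2_eq_square)
    also have "\<dots> = ?Q i * kron y (n - i) + y * ?Q n * kron y (n - i) ^ 2"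
      by (simp add: algebra_simps power2_eq_square)
    finally show ?thesis unfolding key1 .
  qed
  have S1: "(\<lambda>j. theta_coeff q j * kron y (n - j)) summable_on UNIV"
    using theta_kron_summable[of n 1] by simp
  show "kron_const y 1 (n + 1) = - y * ?Q n * kron_const y 1 n"
  proof -
    have "theta_coeff q i * ?Q i * kron y (n - i) ^ 1
        = theta_coeff q i * ?Q i + y * ?Q n * (theta_coeff q i * kron y (n - i))" for i
      using key1[of i] by (simp add: algebra_simps)
    then have "kron_const y 1 (n + 1)
      = - infsum (\<lambda>i. theta_coeff q i * ?Q i + y * ?Q n * (theta_coeff q i * kron y (n - i))) UNIV"
      by (simp only: shift)
    also have "\<dots> = - (y * ?Q n * kron_const y 1 n)"
      using S S1 th by (subst infsum_add)
        (auto simp: infsum_cmult_right' kron_const_def intro: summable_on_cmult_right)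
    finally show ?thesis by simp
  qed
  show "kron_const y 2 (n + 1) = - y * ?Q n * (kron_const y 1 n + kron_const y 2 n)"
  proof -
    have "theta_coeff q i * ?Q i * kron y (n - i) ^ 2
        = theta_coeff q i * ?Q i + (y * ?Q n * (theta_coeff q i * kron y (n - i))
          + y * ?Q n * (theta_coeff q i * kron y (n - i) ^ 2))" for i
      using key2[of i] by (simp add: algebra_simps)
    then have "kron_const y 2 (n + 1)
      = - infsum (\<lambda>i. theta_coeff q i * ?Q i + (y * ?Q n * (theta_coeff q i * kron y (n - i))
          + y * ?Q n * (theta_coeff q i * kron y (n - i) ^ 2))) UNIV"
      by (simp only: shift)
    also have "\<dots> = - (y * ?Q n * kron_const y 1 n + y * ?Q n * kron_const y 2 n)"
      using S S1 th theta_kron_summable[of n 2]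
      by (simp add: infsum_add infsum_cmult_right' kron_const_def summable_on_cmult_right summable_on_add
          del: of_real_power_int)
    finally show ?thesis by (simp add: algebra_simps)
  qed
qed

text \<open>\<open>theta_coeff q n * y powi n\<close> solves the recurrence for
  \<open>k = 1\<close>, so the quotient by it is constant; for \<open>k = 2\<close> the quotient
  grows by the constant \<open>kron_const y 1 0\<close> at each step.\<close>

lemma kron_const_closed:
  "kron_const y 1 n = kron_const y 1 0 * (theta_coeff q n * y powi n)"
  "kron_const y 2 n = (kron_const y 2 0 + of_int n * kron_const y 1 0) * (theta_coeff q n * y powi n)"
proof -
  let ?T = "\<lambda>n. theta_coeff q n * y powi n"
  have nz: "?T n \<noteq> 0" for n using theta_coeff_nz y by simp
  have T: "?T (n + 1) = - y * of_real (q powi n) * ?T n" for n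
    using y by (simp add: theta_coeff_Suc power_int_add)
  have nz': "- y * of_real (q powi n) \<noteq> (0::complex)" for n using y q by simp
  have T0: "theta_coeff q 0 = 1" by (simp add: theta_coeff_def)
  then have T0': "?T 0 = 1" by simp
  have 1: "kron_const y 1 n / ?T n = kron_const y 1 0 / ?T 0" for n
  proof (rule int_shift_invariant[of "\<lambda>n. kron_const y 1 n / ?T n"])
    show "kron_const y 1 (n + 1) / ?T (n + 1) = kron_const y 1 n / ?T n" for n
      unfolding T kron_const_Suc by (rule mult_divide_mult_cancel_left[OF nz'])
  qed
  then have A: "kron_const y 1 n = kron_const y 1 0 * ?T n" for n
    using nz[of n] 1[of n] unfolding T0' div_by_1 by (metis nonzero_divide_eq_eq)
  then show "kron_const y 1 n = kron_const y 1 0 * ?T n" .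
  have "kron_const y 2 n / ?T n - of_int n * kron_const y 1 0 = kron_const y 2 0 / ?T 0 - of_int 0 * kron_const y 1 0" for n
  proof (rule int_shift_invariant[of "\<lambda>n. kron_const y 2 n / ?T n - of_int n * kron_const y 1 0"])
    fix n
    have "kron_const y 2 (n + 1) / ?T (n + 1) = (kron_const y 1 n + kron_const y 2 n) / ?T n"
      unfolding T kron_const_Suc by (rule mult_divide_mult_cancel_left[OF nz'])
    also have "\<dots> = kron_const y 1 0 + kron_const y 2 n / ?T n"
      using nz[of n] A[of n] by (simp add: add_divide_distrib)
    finally show "kron_const y 2 (n + 1) / ?T (n + 1) - of_int (n + 1) * kron_const y 1 0
        = kron_const y 2 n / ?T n - of_int n * kron_const y 1 0"
      by (simp add: algebra_simps)
  qed
  from this[of n] have "kron_const y 2 n / ?T n = kron_const y 2 0 + of_int n * kron_const y 1 0"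
    by (simp add: T0 algebra_simps)
  then show "kron_const y 2 n = (kron_const y 2 0 + of_int n * kron_const y 1 0) * ?T n"
    using nz[of n] by (metis nonzero_divide_eq_eq)
qed

text \<open>Resummation of the closed coefficients. The first identity is Kronecker's classical
  formula; in the second one the term linear in \<open>n\<close> becomes the Euler
  derivative.\<close>

lemma kronecker_identity:
  assumes "q < cmod x" "cmod x < 1"
  shows "infsum (\<lambda>n. kron y n * x powi n) UNIV * theta q x = kron_const y 1 0 * theta q (y * x)"
    and "infsum (\<lambda>n. kron y n ^ 2 * x powi n) UNIV * theta q x
       = kron_const y 2 0 * theta q (y * x) + kron_const y 1 0 * theta_deriv q (y * x)"
proof -
  have x: "x \<noteq> 0" using assms q by auto
  have prod: "infsum (\<lambda>n. kron y n ^ k * x powi n) UNIV * theta q x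
      = infsum (\<lambda>n. kron_const y k n * x powi n) UNIV"
    if "geo_decay (\<lambda>n. kron y n ^ k * x powi n)" for k
  proof -
    have "infsum (\<lambda>j. kron y (n - j) ^ k * x powi (n - j) * (theta_coeff q j * x powi j)) UNIV
        = kron_const y k n * x powi n" for n
    proof -
      have "kron y (n - j) ^ k * x powi (n - j) * (theta_coeff q j * x powi j)
          = (theta_coeff q j * kron y (n - j) ^ k) * x powi n" for j
        using x by (simp add: power_int_diff)
      then show ?thesis unfolding kron_const_def by (simp only: infsum_cmult_left')
    qed
    then show ?thesis
      unfolding theta_def
      using infsumI[OF bilateral_Cauchy_product[OF geo_decay_summable[OF that]
            geo_decay_summable[OF theta_coeff_geo[OF x]]]] by simp
  qed
  have yx: "y * x \<noteq> 0" using y x by simp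
  have g: "geo_decay (\<lambda>n. theta_coeff q n * (y * x) powi n)" by (rule theta_coeff_geo[OF yx])
  have g': "geo_decay (\<lambda>n. of_int n * theta_coeff q n * (y * x) powi n)"
    using geo_decay_of_int_mult[OF g] by (simp add: mult.assoc)
  have "kron_const y 1 n * x powi n = kron_const y 1 0 * (theta_coeff q n * (y * x) powi n)" for n
    using kron_const_closed(1)[of n] by (simp add: power_int_mult_distrib)
  then show "infsum (\<lambda>n. kron y n * x powi n) UNIV * theta q x = kron_const y 1 0 * theta q (y * x)"
    using prod[of 1] kron_geo[OF assms] by (simp add: theta_def infsum_cmult_right')
  have "kron_const y 2 n * x powi n = kron_const y 2 0 * (theta_coeff q n * (y * x) powi n)
      + kron_const y 1 0 * (of_int n * theta_coeff q n * (y * x) powi n)" for n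
    using kron_const_closed(2)[of n] by (simp add: power_int_mult_distrib algebra_simps)
  then show "infsum (\<lambda>n. kron y n ^ 2 * x powi n) UNIV * theta q x
       = kron_const y 2 0 * theta q (y * x) + kron_const y 1 0 * theta_deriv q (y * x)"
    using prod[of 2] kron_geo[OF assms] geo_decay_summable[OF g] geo_decay_summable[OF g']
    by (simp add: theta_def theta_deriv_def infsum_cmult_right' infsum_add summable_on_cmult_right)
qed

end

text \<open>The term \<open>j = 0\<close> equals \<open>1 / (1 - y)\<close> and blows up at
  \<open>y = 1\<close>, while all others together stay below \<open>K\<close>, because
  \<open>1 - y * q powi k\<close> has modulus at least \<open>1 - q\<close> for
  \<open>k \<noteq> 0\<close> on the unit circle.\<close>

lemma kron_const_nz_near_1:
  "\<exists>\<delta>>0. \<forall>y. cmod y = 1 \<longrightarrow> y \<noteq> 1 \<longrightarrow> cmod (1 - y) < \<delta> \<longrightarrow> kron_const y 1 0 \<noteq> 0"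
proof -
  have gth: "geo_decay (theta_coeff q)" using theta_coeff_geo[of 1] by simp
  have S: "(\<lambda>j. cmod (theta_coeff q j)) summable_on UNIV"
    using geo_decay_summable[OF gth] summable_on_iff_abs_summable_on_complex by blast
  define K where "K = infsum (\<lambda>j. cmod (theta_coeff q j)) UNIV / (1 - q)"
  have K0: "K \<ge> 0" unfolding K_def using q by (intro divide_nonneg_pos infsum_nonneg) auto
  have "kron_const y 1 0 \<noteq> 0" if y: "cmod y = 1" "y \<noteq> 1" "cmod (1 - y) < 1 / (K + 1)" for y
  proof
    assume zero: "kron_const y 1 0 = 0"
    have far: "cmod (1 - y * of_real (q powi k)) \<ge> 1 - q" if "k \<noteq> 0" for k
    proof (cases "k > 0")
      case True
      then obtain m where m: "k = int (Suc m)" using gr0_conv_Suc zero_less_imp_eq_int by metis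
      have "q powi k \<le> q" using m power_decreasing[of 1 "Suc m" q] q by (simp only: power_int_of_nat) simp
      then have "cmod (y * of_real (q powi k)) \<le> q"
        using y q unfolding norm_mult norm_of_real by simp
      then show ?thesis using norm_triangle_ineq2[of 1 "y * of_real (q powi k)"] by simp
    next
      case False
      then have "k < 0" using that by simp
      then obtain m where m: "k = - int (Suc m)" using negD by blast
      have "q powi k = inverse (q ^ Suc m)" unfolding m by (simp add: power_int_minus del: of_nat_Suc power_Suc)
      moreover have "q ^ Suc m \<le> q" using power_decreasing[of 1 "Suc m" q] q by simp
      moreover have "q ^ Suc m > 0" using q by simp
      ultimately have "q powi k \<ge> inverse q" using q le_imp_inverse_le by metis
      moreover have "inverse q \<ge> 2 - q"
      proof -
        have "0 \<le> (1 - q)\<^sup>2" by simp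
        then show ?thesis using q by (simp add: field_simps power2_eq_square)
      qed
      ultimately have "cmod (y * of_real (q powi k)) \<ge> 2 - q"
        using y q unfolding norm_mult norm_of_real by simp
      then show ?thesis using norm_triangle_ineq3[of 1 "y * of_real (q powi k)"] by simp
    qed
    have nz: "y * of_real (q powi k) \<noteq> 1" for k
      using far[of k] q y by (cases "k = 0") auto
    have y0: "y \<noteq> 0" using y by auto
    have S1: "(\<lambda>j. theta_coeff q j * kron y (0 - j)) summable_on UNIV"
      using theta_kron_summable[OF y0 nz, of 0 1] by simp
    define f where "f j = theta_coeff q j * kron y (0 - j)" for j
    have S2: "f summable_on - {0}" using S1 unfolding f_def by (rule summable_on_subset_banach) auto
    have "infsum f ({0} \<union> (- {0})) = infsum f {0} + infsum f (- {0})"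
      by (rule infsum_Un_disjoint) (use S2 in auto)
    moreover have "{0} \<union> - {0} = (UNIV :: int set)" by auto
    moreover have "infsum f UNIV = 0" using zero unfolding kron_const_def f_def by simp
    ultimately have "0 = f 0 + infsum f (- {0})" by simp
    moreover have "f 0 = 1 / (1 - y)" by (simp add: f_def theta_coeff_def kron_def)
    ultimately have "infsum f (- {0}) = - (1 / (1 - y))" by (metis add_eq_0_iff)
    moreover have "cmod (infsum f (- {0})) \<le> K"
    proof -
      have b: "cmod (f j) \<le> cmod (theta_coeff q j) / (1 - q)" if "j \<in> - {0}" for j
        using far[of "- j"] that q
        by (auto simp: f_def kron_def norm_mult norm_divide divide_simps mult_left_mono)
      have Sq: "(\<lambda>j. cmod (theta_coeff q j) / (1 - q)) summable_on UNIV"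
        using summable_on_cmult_left[OF S, of "1 / (1 - q)"] by simp
      have Sq': "(\<lambda>j. cmod (theta_coeff q j) / (1 - q)) summable_on - {0}"
        using Sq by (rule summable_on_subset_banach) auto
      have "cmod (infsum f (- {0})) \<le> infsum (\<lambda>j. cmod (f j)) (- {0})"
        using S2 by (intro norm_infsum_bound) (simp add: summable_on_iff_abs_summable_on_complex)
      also have "\<dots> \<le> infsum (\<lambda>j. cmod (theta_coeff q j) / (1 - q)) (- {0})"
        using S2 b Sq' by (intro infsum_mono) (auto simp: summable_on_iff_abs_summable_on_complex)
      also have "\<dots> \<le> infsum (\<lambda>j. cmod (theta_coeff q j) / (1 - q)) UNIV"
        using Sq Sq' q by (intro infsum_mono_neutral) auto
      also have "\<dots> = K"
        using infsum_cmult_left'[of "\<lambda>j. cmod (theta_coeff q j)" "1 / (1 - q)" UNIV] by (simp add: K_def)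
      finally show ?thesis .
    qed
    ultimately have "1 / cmod (1 - y) \<le> K" by (simp add: norm_divide)
    moreover have "cmod (1 - y) > 0" using y by simp
    ultimately have "1 \<le> K * cmod (1 - y)" by (simp only: divide_le_eq if_True)
    moreover have "cmod (1 - y) * (K + 1) < 1"
      using y(3) K0 by (simp add: less_divide_eq)
    ultimately show False using \<open>cmod (1 - y) > 0\<close> by (simp only: distrib_left mult.commute[of K])
  qed
  moreover have "1 / (K + 1) > 0" using K0 by simp
  ultimately show ?thesis by blast
qed

text \<open>If \<open>theta\<close> vanishes at \<open>w\<close>, the Kronecker identity with \<open>y\<close> on the unit circle near \<open>1\<close> (where
  \<open>kron_const y 1 0\<close> has a pole, hence no zero) moves the zero to \<open>y * w\<close>; after finitely many rotations it
  reaches the negative axis, where all terms of the series are positive.\<close>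

lemma theta_nz:
  assumes w: "q < cmod w" "cmod w < 1"
  shows "theta q w \<noteq> 0"
proof
  assume zero: "theta q w = 0"
  obtain \<delta> where \<delta>: "\<delta> > 0"
    "\<And>y. cmod y = 1 \<Longrightarrow> y \<noteq> 1 \<Longrightarrow> cmod (1 - y) < \<delta> \<Longrightarrow> kron_const y 1 0 \<noteq> 0"
    using kron_const_nz_near_1 by blast
  \<comment> \<open>The rotation by \<phi> takes \<open>w\<close> to \<open>- cmod w\<close>; it is
    performed in \<open>Suc N\<close> equal steps \<open>y\<close>, each within \<delta> of
    1.\<close>
  define \<phi> where "\<phi> = Arg (- inverse w)"
  have w0: "w \<noteq> 0" using w q by auto
  have "(\<lambda>N. 1 - exp (\<i> * of_real (\<phi> / real (Suc N)))) \<longlonglongrightarrow> 1 - exp (\<i> * of_real 0)"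
    by (intro tendsto_intros LIMSEQ_Suc[OF lim_const_over_n])
  then have "eventually (\<lambda>N. dist (1 - exp (\<i> * of_real (\<phi> / real (Suc N)))) (1 - exp (\<i> * of_real 0)) < \<delta>) sequentially"
    using \<delta>(1) by (rule tendstoD)
  then obtain N where N: "cmod (1 - exp (\<i> * of_real (\<phi> / real (Suc N)))) < \<delta>"
    by (auto simp: eventually_sequentially)
  define y where "y = exp (\<i> * of_real (\<phi> / real (Suc N)))"
  have cy: "cmod y = 1" by (simp add: y_def)
  have yN: "y ^ Suc N = exp (\<i> * of_real \<phi>)"
    unfolding y_def exp_of_nat_mult[symmetric] by (simp del: of_nat_Suc)
  have wy: "w * exp (\<i> * of_real \<phi>) = - of_real (cmod w)"
  proof -
    have "- inverse w = of_real (cmod (inverse w)) * exp (\<i> * of_real \<phi>)"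
      using Arg_eq[of "- inverse w"] w0 by (simp add: \<phi>_def norm_inverse)
    then have "w * (of_real (cmod (inverse w)) * exp (\<i> * of_real \<phi>)) = w * (- inverse w)" by simp
    then have "of_real (cmod w) * (of_real (cmod (inverse w)) * (w * exp (\<i> * of_real \<phi>))) = of_real (cmod w) * (- 1)"
      using w0 by (simp add: ac_simps)
    moreover have "of_real (cmod w) * of_real (cmod (inverse w)) = (1 :: complex)"
      using w0 by (simp flip: of_real_mult norm_mult)
    ultimately show ?thesis by (simp add: mult.assoc[symmetric])
  qed
  show False
  proof (cases "y = 1")
    case True
    then have "theta q (- of_real (cmod w)) = 0" using wy yN zero by simp
    then show False using theta_negative_nz[of "cmod w"] w0 by simp
  next
    case False
    have y0: "y \<noteq> 0" using cy by auto
    have nz: "y * of_real (q powi k) \<noteq> 1" for k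
    proof
      assume h: "y * of_real (q powi k) = 1"
      then have "cmod (y * of_real (q powi k)) = 1" by simp
      then have "q powi k = 1" using cy q unfolding norm_mult norm_of_real by simp
      then show False using h False by simp
    qed
    have c: "kron_const y 1 0 \<noteq> 0" using \<delta>(2)[OF cy False] N unfolding y_def by blast
    have "theta q (w * y ^ k) = 0" for k
    proof (induction k)
      case (Suc k)
      have "cmod (w * y ^ k) = cmod w" using cy by (simp add: norm_mult norm_power)
      then have "kron_const y 1 0 * theta q (y * (w * y ^ k)) = 0"
        using kronecker_identity(1)[OF y0 nz, of "w * y ^ k"] Suc w by (metis mult_zero_right)
      moreover have "y * (w * y ^ k) = w * y ^ Suc k" by simp
      ultimately show ?case using c by (metis mult_eq_0_iff)
    qed (use zero in simp)
    from this[of "Suc N"] show False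
      unfolding yN wy using theta_negative_nz[of "cmod w"] w0 by simp
  qed
qed

end

section \<open>Sarason kernels of a pair of points\<close>


text \<open>The divided difference of \<open>z powi n\<close> at \<open>a\<close> and \<open>b\<close>, with the derivative as its value on the diagonal.\<close>

definition dpow :: "complex \<Rightarrow> complex \<Rightarrow> int \<Rightarrow> complex" where
  "dpow a b n = (if a = b then of_int n * a powi (n - 1) else (a powi n - b powi n) / (a - b))"

lemma dpow_0 [simp]: "dpow a b 0 = 0"
  by (simp add: dpow_def)

lemma dpow_1 [simp]: "dpow a b 1 = 1"
  by (simp add: dpow_def)

lemma dpow_mult_diff: "(a - b) * dpow a b n = a powi n - b powi n"
  by (simp add: dpow_def)

text \<open>The Leibniz rule for the divided difference of \<open>z powi m * z powi n\<close>. It is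
  also the multiplicativity of the off-diagonal entries of powers of a triangular matrix.\<close>

lemma dpow_add:
  assumes "a \<noteq> 0" "b \<noteq> 0"
  shows "dpow a b (m + n) = a powi n * dpow a b m + b powi m * dpow a b n"
proof (cases "a = b")
  case True
  have "of_int (m + n) * a powi (m + n - 1)
     = a powi n * (of_int m * a powi (m - 1)) + a powi m * (of_int n * a powi (n - 1))"
    using assms by (simp add: power_int_add power_int_diff field_simps)
  then show ?thesis using True by (simp add: dpow_def)
next
  case False
  then show ?thesis using assms
    by (simp add: dpow_def power_int_add divide_simps) (simp add: algebra_simps)
qed

lemma dpow_Suc: "a \<noteq> 0 \<Longrightarrow> b \<noteq> 0 \<Longrightarrow> dpow a b (n + 1) = a * dpow a b n + b powi n"
  using dpow_add[of a b n 1] by simp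

text \<open>For positive \<open>n\<close> the divided difference is a sum of \<open>n\<close>
  products of powers of \<open>a\<close> and \<open>b\<close> of total degree \<open>n - 1\<close>,
  all of the same modulus. The bound does not depend on \<open>b\<close>, as the limit
  \<open>b \<longlonglongrightarrow> a\<close> requires.\<close>

lemma dpow_norm_le:
  assumes "a \<noteq> 0" "cmod b = cmod a"
  shows "cmod (dpow a b n) \<le> real_of_int \<bar>n\<bar> * cmod a powi (n - 1)"
proof (induction n rule: int_induct[where k = 0])
  case base
  then show ?case by simp
next
  case (step1 i)
  have b: "b \<noteq> 0" using assms by auto
  have "cmod (dpow a b (i + 1)) \<le> cmod a * cmod (dpow a b i) + cmod a powi i"
    unfolding dpow_Suc[OF assms(1) b]
    by (rule order_trans[OF norm_triangle_ineq]) (simp add: norm_mult norm_power_int assms)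
  also have "\<dots> \<le> cmod a * (real_of_int \<bar>i\<bar> * cmod a powi (i - 1)) + cmod a powi i"
    using step1 by (intro add_right_mono mult_left_mono) auto
  also have "\<dots> = real_of_int \<bar>i + 1\<bar> * cmod a powi (i + 1 - 1)"
    using assms step1 by (simp add: power_int_diff field_simps)
  finally show ?case .
next
  case (step2 i)
  have b: "b \<noteq> 0" using assms by auto
  have eq: "dpow a b (i - 1) = (dpow a b i - b powi (i - 1)) / a"
    using dpow_Suc[OF assms(1) b, of "i - 1"] assms by (simp add: field_simps)
  have "cmod (dpow a b (i - 1)) \<le> (cmod (dpow a b i) + cmod a powi (i - 1)) / cmod a"
    unfolding eq norm_divide
    by (intro divide_right_mono order_trans[OF norm_triangle_ineq4]) (simp_all add: norm_power_int assms)
  also have "\<dots> \<le> (real_of_int \<bar>i\<bar> * cmod a powi (i - 1) + cmod a powi (i - 1)) / cmod a"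
    using step2 by (intro divide_right_mono add_right_mono) auto
  also have "\<dots> = real_of_int \<bar>i - 1\<bar> * cmod a powi (i - 1 - 1)"
  proof -
    have "cmod a powi (i - 1) = cmod a * cmod a powi (i - 1 - 1)"
      using power_int_add[of "cmod a" 1 "i - 1 - 1"] assms by simp
    moreover have "cmod a \<noteq> 0" using assms by simp
    ultimately show ?thesis using step2 by (simp add: field_simps)
  qed
  finally show ?case .
qed

lemma dpow_tendsto:
  assumes "a \<noteq> 0" "\<And>k. b k \<noteq> 0" "b \<longlonglongrightarrow> a"
  shows "(\<lambda>k. dpow a (b k) n) \<longlonglongrightarrow> dpow a a n"
proof (induction n rule: int_induct[where k = 0])
  case base
  then show ?case by simp
next
  case (step1 i)
  then show ?case unfolding dpow_Suc[OF assms(1,2)] dpow_Suc[OF assms(1,1)]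
    by (intro tendsto_intros assms)
next
  case (step2 i)
  have "dpow a c (i - 1) = (dpow a c i - c powi (i - 1)) / a" if "c \<noteq> 0" for c
    using dpow_Suc[OF assms(1) that, of "i - 1"] assms by (simp add: field_simps)
  then have "dpow a (b k) (i - 1) = (dpow a (b k) i - b k powi (i - 1)) / a"
    "dpow a a (i - 1) = (dpow a a i - a powi (i - 1)) / a" for k using assms by auto
  then show ?case
    by (simp only:) (intro tendsto_intros assms step2)
qed

lemma geo_decay_dpow:
  assumes "geo_decay (\<lambda>n. u n * a powi n)" "geo_decay (\<lambda>n. u n * b powi n)" "a \<noteq> 0"
  shows "geo_decay (\<lambda>n. u n * dpow a b n)"
proof (cases "a = b")
  case True
  have "geo_decay (\<lambda>n. (1 / a) * (of_int n * (u n * a powi n)))"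
    by (intro geo_decay_cmult geo_decay_of_int_mult assms)
  moreover have "(1 / a) * (of_int n * (u n * a powi n)) = u n * dpow a b n" for n
    using True assms by (simp add: dpow_def power_int_diff field_simps)
  ultimately show ?thesis by simp
next
  case False
  have "geo_decay (\<lambda>n. (1 / (a - b)) * (u n * a powi n - u n * b powi n))"
    by (intro geo_decay_cmult geo_decay_diff assms)
  moreover have "(1 / (a - b)) * (u n * a powi n - u n * b powi n) = u n * dpow a b n" for n
    using False by (simp add: dpow_def field_simps)
  ultimately show ?thesis by simp
qed

lemma infsum_complex_of_real:
  assumes "(\<lambda>n. complex_of_real (f n)) summable_on A"
  shows "f summable_on A" "infsum (\<lambda>n. complex_of_real (f n)) A = of_real (infsum f A)"
proof -
  show s: "f summable_on A"
    using summable_on_Re[OF assms] by (simp only: Re_complex_of_real)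
  show "infsum (\<lambda>n. complex_of_real (f n)) A = of_real (infsum f A)"
    using has_sum_infsum[OF s] by (intro infsumI) (simp only: has_sum_of_real_iff)
qed

text \<open>Sarason's Hardy space with weights \<open>1 + t * r ^ (2 * n)\<close>; \<open>wt\<close> is the reciprocal weight.\<close>

locale annulus_pair =
  fixes r :: real and a b :: complex
  assumes r: "0 < r" "r < 1" and a: "r < cmod a" "cmod a < 1" and b: "r < cmod b" "cmod b < 1"
begin

definition t :: real where "t = r / (cmod a * cmod b)"

definition wt :: "int \<Rightarrow> real" where "wt n = 1 / (1 + t * (r\<^sup>2) powi n)"

text \<open>A sequence \<open>u\<close> stands for the Laurent series with coefficients
  \<open>wt n * cnj (u n)\<close>, so that powers of \<open>a\<close> become the reproducing kernel
  at \<open>a\<close>. Then \<open>form 1\<close> is the inner product of the weighted space and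
  \<open>form 2\<close> the part of it that the outer circle carries.\<close>

definition form :: "nat \<Rightarrow> (int \<Rightarrow> complex) \<Rightarrow> (int \<Rightarrow> complex) \<Rightarrow> complex" where
  "form k u v = (\<Sum>\<^sub>\<infinity>n. of_real (wt n) ^ k * (u n * cnj (v n)))"

lemma r2_range: "0 < r\<^sup>2" "r\<^sup>2 < 1"
  using r by (auto simp: power_less_one_iff)

lemma nz: "a \<noteq> 0" "b \<noteq> 0" "cmod a > 0" "cmod b > 0"
  using a b r by auto

lemma t_pos: "t > 0"
  unfolding t_def using r nz by simp

lemma wt_pos: "wt n > 0"
  unfolding wt_def using t_pos r2_range by (simp add: add_pos_pos)

lemma wt_le_1: "wt n \<le> 1"
  unfolding wt_def using t_pos r2_range by (simp add: divide_le_eq add_pos_pos)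

lemma kron_eq_wt: "kron (r\<^sup>2) (- of_real t) n = of_real (wt n)"
  by (simp add: kron_def[OF r2_range] wt_def)

lemma t_param: "- complex_of_real t \<noteq> 0" "- complex_of_real t * of_real ((r\<^sup>2) powi n) \<noteq> 1"
proof -
  show "- complex_of_real t \<noteq> 0" using t_pos by simp
  have "- t * (r\<^sup>2) powi n \<noteq> 1" using t_pos r2_range(1) by (smt (verit) mult_minus_left mult_pos_pos zero_less_power_int)
  then show "- complex_of_real t * of_real ((r\<^sup>2) powi n) \<noteq> 1"
    by (metis of_real_1 of_real_eq_iff of_real_minus of_real_mult)
qed

lemma wt_geo:
  assumes "r\<^sup>2 < cmod x" "cmod x < 1" "1 \<le> k"
  shows "geo_decay (\<lambda>n. of_real (wt n) ^ k * x powi n)"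
proof (rule geo_decay_bound[OF kron_geo(1)[OF r2_range t_param assms(1,2)], of _ 1])
  fix n
  have "\<bar>wt n\<bar> ^ k \<le> \<bar>wt n\<bar> ^ 1"
    using wt_pos[of n] wt_le_1[of n] assms by (intro power_decreasing) auto
  then show "cmod (of_real (wt n) ^ k * x powi n) \<le> 1 * cmod (kron (r\<^sup>2) (- of_real t) n * x powi n)"
    unfolding kron_eq_wt by (auto simp: norm_mult norm_power intro!: mult_right_mono)
qed

lemma between:
  assumes "r < cmod c" "cmod c < 1" "r \<le> cmod d" "cmod d \<le> 1"
  shows "r\<^sup>2 < cmod (c * d)" "cmod (c * d) < 1" "r\<^sup>2 < cmod (d * c)" "cmod (d * c) < 1"
    "r\<^sup>2 < cmod (c * cnj d)" "cmod (c * cnj d) < 1" "r\<^sup>2 < cmod (cnj c * d)" "cmod (cnj c * d) < 1"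
proof -
  have "r * r < cmod c * cmod d" using assms r by (intro mult_less_le_imp_less) auto
  moreover have "cmod c * cmod d < 1 * 1" using assms r 
    by (intro mult_less_le_imp_less) auto
  ultimately show "r\<^sup>2 < cmod (c * d)" "cmod (c * d) < 1" "r\<^sup>2 < cmod (d * c)" "cmod (d * c) < 1"
    "r\<^sup>2 < cmod (c * cnj d)" "cmod (c * cnj d) < 1" "r\<^sup>2 < cmod (cnj c * d)" "cmod (cnj c * d) < 1"
    by (simp_all add: norm_mult power2_eq_square mult.commute)
qed

lemma geo_pow_pow:
  assumes "c \<in> {a, b}" "r \<le> cmod z" "cmod z \<le> 1" "1 \<le> k"
  shows "geo_decay (\<lambda>n. of_real (wt n) ^ k * (c powi n * z powi n))"
    and "geo_decay (\<lambda>n. of_real (wt n) ^ k * (c powi n * cnj (z powi n)))"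
    and "geo_decay (\<lambda>n. of_real (wt n) ^ k * (cnj (c powi n) * z powi n))"
proof -
  have "r < cmod c" "cmod c < 1" using assms a b by auto
  from between[OF this assms(2,3)] show
    "geo_decay (\<lambda>n. of_real (wt n) ^ k * (c powi n * z powi n))"
    "geo_decay (\<lambda>n. of_real (wt n) ^ k * (c powi n * cnj (z powi n)))"
    "geo_decay (\<lambda>n. of_real (wt n) ^ k * (cnj (c powi n) * z powi n))"
    using wt_geo[OF _ _ assms(4), of "c * z"] wt_geo[OF _ _ assms(4), of "c * cnj z"]
     wt_geo[OF _ _ assms(4), of "cnj c * z"]
    by (simp_all add: power_int_mult_distrib)
qed

lemma geo_dpow_pow:
  assumes "r \<le> cmod z" "cmod z \<le> 1" "1 \<le> k"
  shows "geo_decay (\<lambda>n. of_real (wt n) ^ k * (dpow a b n * z powi n))"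
    and "geo_decay (\<lambda>n. of_real (wt n) ^ k * (dpow a b n * cnj (z powi n)))"
    and "geo_decay (\<lambda>n. of_real (wt n) ^ k * (cnj (dpow a b n) * z powi n))"
proof -
  have *: "geo_decay (\<lambda>n. (of_real (wt n) ^ k * z powi n) * dpow a b n)" if "r \<le> cmod z" "cmod z \<le> 1" for z
    using geo_pow_pow(1)[of a z k] geo_pow_pow(1)[of b z k] that assms(3) nz
    by (intro geo_decay_dpow) (simp_all add: mult.assoc mult.commute[of "z powi _"])
  show "geo_decay (\<lambda>n. of_real (wt n) ^ k * (dpow a b n * z powi n))"
    using *[OF assms(1,2)] by (simp add: mult.assoc mult.commute[of "z powi _"])
  show 2: "geo_decay (\<lambda>n. of_real (wt n) ^ k * (dpow a b n * cnj (z powi n)))"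
    using *[of "cnj z"] assms by (simp add: mult.assoc mult.commute[of "cnj z powi _"])
  show "geo_decay (\<lambda>n. of_real (wt n) ^ k * (cnj (dpow a b n) * z powi n))"
    using geo_decay_cnj[OF 2] by simp
qed

lemma geo_dpow_dpow:
  assumes "1 \<le> k"
  shows "geo_decay (\<lambda>n. of_real (wt n) ^ k * (dpow a b n * cnj (dpow a b n)))"
proof -
  have "geo_decay (\<lambda>n. (of_real (wt n) ^ k * cnj (dpow a b n)) * dpow a b n)"
    using geo_dpow_pow(3)[of a k] geo_dpow_pow(3)[of b k] a b assms nz
    by (intro geo_decay_dpow) (simp_all add: mult.assoc)
  then show ?thesis by (simp add: mult.assoc mult.commute[of "cnj _"])
qed

abbreviation "pa \<equiv> (\<lambda>n::int. a powi n)"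
abbreviation "pb \<equiv> (\<lambda>n::int. b powi n)"
abbreviation "hh \<equiv> dpow a b"

lemma form_summable:
  assumes "u \<in> {pa, pb, hh}" "v \<in> {pa, pb, hh}" "1 \<le> k"
  shows "(\<lambda>n. of_real (wt n) ^ k * (u n * cnj (v n))) summable_on UNIV"
  using assms a b geo_pow_pow(2)[of a a k] geo_pow_pow(2)[of b a k] geo_pow_pow(2)[of a b k] geo_pow_pow(2)[of b b k]
    geo_dpow_pow(2)[of a k] geo_dpow_pow(2)[of b k]
    geo_decay_cnj[OF geo_dpow_pow(2)[of a k]] geo_decay_cnj[OF geo_dpow_pow(2)[of b k]] geo_dpow_dpow[of k]
  by (auto intro!: geo_decay_summable simp: mult.commute)

lemma form_cnj: "cnj (form k u v) = form k v u"
  unfolding form_def by (simp flip: infsum_cnj add: mult.commute)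

lemma form_lin:
  assumes "u \<in> {pa, pb, hh}" "u' \<in> {pa, pb, hh}" "v \<in> {pa, pb, hh}" "1 \<le> k"
  shows "form k (\<lambda>n. x * u n + y * u' n) v = x * form k u v + y * form k u' v"
    "(\<lambda>n. of_real (wt n) ^ k * ((x * u n + y * u' n) * cnj (v n))) summable_on UNIV"
proof -
  have eq: "of_real (wt n) ^ k * ((x * u n + y * u' n) * cnj (v n))
    = x * (of_real (wt n) ^ k * (u n * cnj (v n))) + y * (of_real (wt n) ^ k * (u' n * cnj (v n)))" for n
    by (simp add: algebra_simps)
  note S = form_summable[OF assms(1,3,4)] form_summable[OF assms(2,3,4)]
  show "form k (\<lambda>n. x * u n + y * u' n) v = x * form k u v + y * form k u' v"
    unfolding form_def eq using S by (simp add: infsum_add summable_on_cmult_right infsum_cmult_right')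
  show "(\<lambda>n. of_real (wt n) ^ k * ((x * u n + y * u' n) * cnj (v n))) summable_on UNIV"
    unfolding eq using S by (intro summable_on_add summable_on_cmult_right)
qed

lemma form_self_real:
  assumes "(\<lambda>n. of_real (wt n) ^ k * (u n * cnj (u n))) summable_on UNIV"
  shows "form k u u = of_real (Re (form k u u))" "0 \<le> Re (form k u u)"
    "u n \<noteq> 0 \<Longrightarrow> 0 < Re (form k u u)"
proof -
  let ?f = "\<lambda>n. wt n ^ k * (cmod (u n))\<^sup>2"
  have eq: "of_real (wt n) ^ k * (u n * cnj (u n)) = of_real (?f n)" for n
    by (simp add: complex_norm_square[symmetric])
  note S = infsum_complex_of_real[OF assms[unfolded eq]]
  have F: "form k u u = of_real (infsum ?f UNIV)"
    unfolding form_def eq by (rule S)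
  have nn: "0 \<le> ?f n" for n using wt_pos[of n] by simp
  show "form k u u = of_real (Re (form k u u))" "0 \<le> Re (form k u u)"
    unfolding F using nn by (auto intro: infsum_nonneg)
  assume "u n \<noteq> 0"
  then have "0 < ?f n" using wt_pos[of n] by simp
  also have "?f n = sum ?f {n}" by simp
  also have "\<dots> \<le> infsum ?f UNIV" by (intro finite_sum_le_infsum S(1)) (use nn in auto)
  finally show "0 < Re (form k u u)" unfolding F by simp
qed

lemma form_pp:
  "form 1 (\<lambda>n. c powi n) (\<lambda>n. d powi n) = infsum (\<lambda>n. kron (r\<^sup>2) (- of_real t) n * (c * cnj d) powi n) UNIV"
  "form 2 (\<lambda>n. c powi n) (\<lambda>n. d powi n) = infsum (\<lambda>n. kron (r\<^sup>2) (- of_real t) n ^ 2 * (c * cnj d) powi n) UNIV"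
  unfolding form_def kron_eq_wt by (simp_all add: power_int_mult_distrib)

lemma form_aa_pos: "Re (form 1 pa pa) > 0" "Re (form 1 pb pb) > 0"
  using form_self_real(3)[OF form_summable[of pa pa 1], of 0] form_self_real(3)[OF form_summable[of pb pb 1], of 0]
  by simp_all

text \<open>Kronecker's formula at \<open>x = a * cnj a\<close> read backwards: its left side is the
  positive squared norm of the kernel at \<open>a\<close> times a nonzero value of theta.\<close>

lemma kron_const_nz: "kron_const (r\<^sup>2) (- of_real t) 1 0 \<noteq> 0"
proof -
  have ab: "r\<^sup>2 < cmod (a * cnj a)" "cmod (a * cnj a) < 1" using between[of a a] a by auto
  have "form 1 pa pa * theta (r\<^sup>2) (a * cnj a) \<noteq> 0"
    using theta_nz[OF r2_range ab] form_aa_pos by auto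
  then show ?thesis using kronecker_identity(1)[OF r2_range t_param ab] unfolding form_pp by auto
qed

text \<open>By Kronecker's formula the kernel is a nonzero multiple of theta at
  \<open>- t * cnj a * z\<close> over theta at \<open>cnj a * z\<close>. The choice of
  \<open>t\<close> gives the former argument the modulus \<open>r * cmod z / cmod b\<close>, which
  stays strictly between \<open>r\<^sup>2\<close> and 1 on the closed annulus. So the kernel at
  \<open>a\<close> may serve as a denominator.\<close>

lemma kernel_nz:
  assumes "r \<le> cmod z" "cmod z \<le> 1"
  shows "(\<Sum>\<^sub>\<infinity>n. of_real (wt n) * (cnj a powi n * z powi n)) \<noteq> 0"
proof -
  let ?x = "cnj a * z"
  have x: "r\<^sup>2 < cmod ?x" "cmod ?x < 1" using between[OF a assms] by auto
  have "cmod (- complex_of_real t * ?x) = r * cmod z / cmod b"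
    using nz r t_pos by (simp add: norm_mult) (simp add: t_def field_simps)
  moreover have "r * r < r * cmod z / cmod b" 
  proof -
    have "r * cmod b < cmod z" using assms b r mult_strict_left_mono[of "cmod b" 1 r] by linarith
    then have "r * (r * cmod b) < r * cmod z" using r by simp
    then show ?thesis using nz by (simp add: less_divide_eq mult.assoc)
  qed
  moreover have "r * cmod z / cmod b < 1"
  proof -
    have "r * cmod z \<le> r * 1" using assms r by (intro mult_left_mono) auto
    then show ?thesis using nz b by (simp add: divide_less_eq)
  qed
  ultimately have "theta (r\<^sup>2) (- complex_of_real t * ?x) \<noteq> 0"
    by (intro theta_nz r2_range) (simp_all add: power2_eq_square)
  then have "infsum (\<lambda>n. kron (r\<^sup>2) (- of_real t) n * ?x powi n) UNIV \<noteq> 0"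
    using kronecker_identity(1)[OF r2_range t_param x] kron_const_nz by auto
  then show ?thesis unfolding kron_eq_wt by (simp add: power_int_mult_distrib)
qed

text \<open>Quotient of the two Kronecker identities: the outer share of an inner product of kernels
  is a constant independent of the points plus the logarithmic derivative of theta.\<close>

lemma mass_ratio:
  assumes "r\<^sup>2 < cmod (c * cnj d)" "cmod (c * cnj d) < 1" "theta (r\<^sup>2) (- of_real t * (c * cnj d)) \<noteq> 0"
  shows "form 2 (\<lambda>n. c powi n) (\<lambda>n. d powi n) = form 1 (\<lambda>n. c powi n) (\<lambda>n. d powi n) *
    (kron_const (r\<^sup>2) (- of_real t) 2 0 / kron_const (r\<^sup>2) (- of_real t) 1 0 +
     theta_deriv (r\<^sup>2) (- of_real t * (c * cnj d)) / theta (r\<^sup>2) (- of_real t * (c * cnj d)))"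
proof -
  let ?x = "c * cnj d" and ?y = "- complex_of_real t"
  note K = kronecker_identity[OF r2_range t_param assms(1,2)]
  have th: "theta (r\<^sup>2) ?x \<noteq> 0" by (rule theta_nz[OF r2_range assms(1,2)])
  have c: "kron_const (r\<^sup>2) ?y 1 0 \<noteq> 0" by (rule kron_const_nz)
  have 1: "form 1 (\<lambda>n. c powi n) (\<lambda>n. d powi n) = kron_const (r\<^sup>2) ?y 1 0 * theta (r\<^sup>2) (?y * ?x) / theta (r\<^sup>2) ?x"
    unfolding form_pp K(1)[symmetric] using th by simp
  have 2: "form 2 (\<lambda>n. c powi n) (\<lambda>n. d powi n) = (kron_const (r\<^sup>2) ?y 2 0 * theta (r\<^sup>2) (?y * ?x)
      + kron_const (r\<^sup>2) ?y 1 0 * theta_deriv (r\<^sup>2) (?y * ?x)) / theta (r\<^sup>2) ?x"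
    unfolding form_pp K(2)[symmetric] using th by simp
  show ?thesis unfolding 1 2 using th c assms(3) by (simp add: field_simps)
qed

text \<open>With \<open>u\<close>, \<open>v\<close>, \<open>w\<close> for the theta arguments of the
  pairs \<open>(a, a)\<close>, \<open>(b, b)\<close>, \<open>(a, b)\<close>, the value of
  \<open>t\<close> gives \<open>u * v = r\<^sup>2\<close> and \<open>cmod w = r\<close>. By
  reflection the logarithmic derivatives at \<open>u\<close> and \<open>v\<close> are opposite, and
  the one at \<open>w\<close> is purely imaginary. So both sides equal twice the real constant
  \<delta>.\<close>

lemma mass_ratio_sum:
  obtains A B C where "form 2 pa pa = form 1 pa pa * A" "form 2 pb pb = form 1 pb pb * B"
    "form 2 pa pb = form 1 pa pb * C" "A + B = C + cnj C"
proof -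
  let ?Q = "r\<^sup>2" and ?y = "- complex_of_real t"
  let ?L = "\<lambda>x. theta_deriv ?Q x / theta ?Q x"
  define \<delta> where "\<delta> = kron_const ?Q ?y 2 0 / kron_const ?Q ?y 1 0"
  have cd: "cnj \<delta> = \<delta>"
    unfolding \<delta>_def kron_const_def[OF r2_range] kron_eq_wt
    by (simp add: cnj_theta_coeff[OF r2_range] flip: infsum_cnj)
  define u where "u = ?y * (a * cnj a)"
  define v where "v = ?y * (b * cnj b)"
  define w where "w = ?y * (a * cnj b)"
  have ua: "u = - of_real (r * cmod a / cmod b)"
    unfolding u_def complex_norm_square[symmetric] t_def using nz
    by (simp add: power2_eq_square field_simps)
  have vb: "v = - of_real (r * cmod b / cmod a)"
    unfolding v_def complex_norm_square[symmetric] t_def using nz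
    by (simp add: power2_eq_square field_simps)
  have uv: "v = of_real ?Q / u"
    unfolding ua vb using nz r by (simp add: power2_eq_square field_simps)
  have u0: "u \<noteq> 0" "w \<noteq> 0" unfolding u_def w_def using t_pos nz by auto
  have cw: "cmod w = r" unfolding w_def norm_mult norm_minus_cancel norm_of_real complex_mod_cnj t_def
    using r nz by (simp add: abs_mult)
  have ww: "cnj w = of_real ?Q / w"
    using u0 cw complex_norm_square[of w] by (simp add: field_simps)
  have thu: "theta ?Q u \<noteq> 0" unfolding ua using nz r by (intro theta_negative_nz r2_range) auto
  have thv: "theta ?Q v \<noteq> 0" unfolding vb using nz r by (intro theta_negative_nz r2_range) auto
  have thw: "theta ?Q w \<noteq> 0"
    using r cw by (intro theta_nz r2_range) (auto simp: power2_eq_square)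
  have Lv: "?L v = - ?L u" unfolding uv using theta_refl[OF r2_range u0(1)] by simp
  have Lw: "cnj (?L w) = - ?L w"
    using theta_refl[OF r2_range u0(2)] by (simp add: cnj_theta[OF r2_range] ww)
  have le: "r \<le> cmod a" "cmod a \<le> 1" "r \<le> cmod b" "cmod b \<le> 1" using a b by auto
  show ?thesis
  proof (rule that[of "\<delta> + ?L u" "\<delta> + ?L v" "\<delta> + ?L w"])
    show "form 2 pa pa = form 1 pa pa * (\<delta> + ?L u)"
      using mass_ratio[OF between(5,6)[OF a le(1,2)]] thu unfolding \<delta>_def u_def by blast
    show "form 2 pb pb = form 1 pb pb * (\<delta> + ?L v)"
      using mass_ratio[OF between(5,6)[OF b le(3,4)]] thv unfolding \<delta>_def v_def by blast
    show "form 2 pa pb = form 1 pa pb * (\<delta> + ?L w)"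
      using mass_ratio[OF between(5,6)[OF a le(3,4)]] thw unfolding \<delta>_def w_def by blast
    show "\<delta> + ?L u + (\<delta> + ?L v) = \<delta> + ?L w + cnj (\<delta> + ?L w)"
      using Lv Lw cd by simp
  qed
qed

section \<open>The orthogonal complement of the kernel at b\<close>

definition lam :: complex where "lam = form 1 hh pb / form 1 pb pb"

text \<open>Gram-Schmidt against \<open>pb\<close>, applied to the divided difference instead of
  \<open>pa\<close>: this keeps its meaning for \<open>a = b\<close>, where the span is that of the
  kernel and its derivative.\<close>

definition ee :: "int \<Rightarrow> complex" where "ee n = hh n - lam * pb n"

lemma ee_alt: "ee = (\<lambda>n. 1 * hh n + (- lam) * pb n)"
  by (simp add: ee_def fun_eq_iff)

lemma form_pb_nz: "form 1 pb pb \<noteq> 0" "form 1 pa pa \<noteq> 0"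
  using form_aa_pos by auto

lemma form_ee_pb: "form 1 ee pb = 0"
  unfolding ee_alt using form_lin(1)[of hh pb pb 1 1 "- lam"] form_pb_nz by (simp add: lam_def)

lemma ee_summable:
  assumes "u \<in> {pa, pb, hh, ee}" "v \<in> {pa, pb, hh, ee}" "1 \<le> k"
  shows "(\<lambda>n. of_real (wt n) ^ k * (u n * cnj (v n))) summable_on UNIV"
proof -
  have 1: "(\<lambda>n. of_real (wt n) ^ k * (ee n * cnj (v n))) summable_on UNIV" if "v \<in> {pa, pb, hh}" for v
    unfolding ee_alt using form_lin(2)[of hh pb v k 1 "- lam"] that assms by auto
  have 2: "(\<lambda>n. of_real (wt n) ^ k * (v n * cnj (ee n))) summable_on UNIV" if "v \<in> {pa, pb, hh}" for v
  proof -
    have "(\<lambda>n. cnj (of_real (wt n) ^ k * (ee n * cnj (v n)))) summable_on UNIV"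
      using 1[OF that] by (simp only: summable_on_cnj_iff)
    then show ?thesis by (simp add: mult.commute)
  qed
  have 3: "(\<lambda>n. of_real (wt n) ^ k * (ee n * cnj (ee n))) summable_on UNIV"
  proof -
    have "(\<lambda>n. 1 * (of_real (wt n) ^ k * (hh n * cnj (ee n))) + (- lam) * (of_real (wt n) ^ k * (pb n * cnj (ee n)))) summable_on UNIV"
      using 2[of hh] 2[of pb] by (intro summable_on_add summable_on_cmult_right) auto
    moreover have "1 * (of_real (wt n) ^ k * (hh n * cnj (ee n))) + (- lam) * (of_real (wt n) ^ k * (pb n * cnj (ee n)))
        = of_real (wt n) ^ k * (ee n * cnj (ee n))" for n
      by (simp add: ee_def[of n] algebra_simps)
    ultimately show ?thesis by simp
  qed
  show ?thesis using assms(1,2) form_summable[OF _ _ assms(3), of u v] 1[of v] 2[of u] 3 by auto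
qed

lemma form_add_left:
  assumes "u \<in> {pa, pb, hh, ee}" "u' \<in> {pa, pb, hh, ee}" "v \<in> {pa, pb, hh, ee}" "1 \<le> k"
  shows "form k (\<lambda>n. x * u n + y * u' n) v = x * form k u v + y * form k u' v"
proof -
  have eq: "of_real (wt n) ^ k * ((x * u n + y * u' n) * cnj (v n))
    = x * (of_real (wt n) ^ k * (u n * cnj (v n))) + y * (of_real (wt n) ^ k * (u' n * cnj (v n)))" for n
    by (simp add: algebra_simps)
  note S = ee_summable[OF assms(1,3,4)] ee_summable[OF assms(2,3,4)]
  show ?thesis
    unfolding form_def eq using S by (simp add: infsum_add summable_on_cmult_right infsum_cmult_right')
qed

definition NN :: real where "NN = Re (form 1 ee ee)"
definition Kaa :: real where "Kaa = Re (form 1 pa pa)"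
definition Kbb :: real where "Kbb = Re (form 1 pb pb)"

lemma NN_form: "form 1 ee ee = of_real NN"
  unfolding NN_def by (rule form_self_real(1)[OF ee_summable]) auto
lemma Kaa_form: "form 1 pa pa = of_real Kaa"
  unfolding Kaa_def by (rule form_self_real(1)[OF ee_summable]) auto
lemma Kbb_form: "form 1 pb pb = of_real Kbb"
  unfolding Kbb_def by (rule form_self_real(1)[OF ee_summable]) auto

lemma Kaa_pos: "Kaa > 0" and Kbb_pos: "Kbb > 0"
  unfolding Kaa_def Kbb_def by (rule form_aa_pos)+

lemma NN_pos: "NN > 0"
proof -
  \<comment> \<open>\<open>ee 0 = - lam\<close> and \<open>ee 1 = 1 - lam * b\<close> cannot both
    vanish.\<close>
  have "ee 0 \<noteq> 0 \<or> ee 1 \<noteq> 0" unfolding ee_def by auto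
  then show ?thesis unfolding NN_def using form_self_real(3)[OF ee_summable[of ee ee 1]] by auto
qed

lemma form_pb_ee: "form 1 pb ee = 0"
  using form_cnj[of 1 ee pb] form_ee_pb by simp

lemma form_hh_ee: "form 1 hh ee = of_real NN"
proof -
  have "hh = (\<lambda>n. 1 * ee n + lam * pb n)" by (simp add: ee_def fun_eq_iff)
  then show ?thesis using form_add_left[of ee pb ee 1 1 lam] by (simp add: NN_form form_pb_ee del: One_nat_def)
qed

lemma pa_eq: "pa = (\<lambda>n. (1 + lam * (a - b)) * pb n + (a - b) * ee n)"
proof
  fix n
  have "(1 + lam * (a - b)) * pb n + (a - b) * ee n = pb n + (a - b) * hh n"
    by (simp add: ee_def algebra_simps)
  then show "pa n = (1 + lam * (a - b)) * pb n + (a - b) * ee n" by (simp add: dpow_mult_diff)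
qed

lemma form_pa_ee: "form 1 pa ee = (a - b) * of_real NN"
  by (subst pa_eq, subst form_add_left) (auto simp: NN_form form_pb_ee simp del: One_nat_def)

text \<open>Pythagoras for the decomposition \<open>pa_eq\<close>. Divided by \<open>NN\<close>, it
  says that the squared off-diagonal entry of the compression is \<open>Kaa / NN\<close> minus the
  squared distance of \<open>a\<close> and \<open>b\<close>, the largest value that
  \<open>spectral_inequality\<close> allows.\<close>

lemma Kaa_eq: "Kaa = (cmod (1 + lam * (a - b)))\<^sup>2 * Kbb + (cmod (a - b))\<^sup>2 * NN"
proof -
  let ?s = "1 + lam * (a - b)"
  have "form 1 pa pb = ?s * of_real Kbb"
    by (subst pa_eq, subst form_add_left) (auto simp: Kbb_form form_ee_pb simp del: One_nat_def)
  then have 1: "form 1 pb pa = cnj ?s * of_real Kbb" using form_cnj[of 1 pa pb] by simp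
  have 2: "form 1 ee pa = cnj (a - b) * of_real NN" using form_cnj[of 1 pa ee] form_pa_ee by simp
  have "form 1 pa pa = ?s * (cnj ?s * of_real Kbb) + (a - b) * (cnj (a - b) * of_real NN)"
    using form_add_left[of pb ee pa 1 ?s "a - b"] unfolding pa_eq[symmetric] 1 2 by simp
  then have "complex_of_real Kaa = of_real ((cmod ?s)\<^sup>2 * Kbb + (cmod (a - b))\<^sup>2 * NN)"
    unfolding Kaa_form of_real_add of_real_mult complex_norm_square by (simp add: mult.assoc)
  then show ?thesis using of_real_eq_iff by blast
qed

text \<open>Expand \<open>form 2\<close> on \<open>d * ee = pa - s * pb\<close>. The terms with
  \<open>pb\<close> collect the factor \<open>C + cnj C - B\<close>, which is \<open>A\<close> by
  \<open>mass_ratio_sum\<close>; hence the outer share of \<open>ee\<close> is the same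
  \<open>A\<close> as that of \<open>pa\<close>.\<close>

lemma mass_identity_distinct:
  assumes "a \<noteq> b"
  shows "form 2 ee ee * form 1 pa pa = form 2 pa pa * form 1 ee ee"
proof -
  obtain A B C where ABC: "form 2 pa pa = form 1 pa pa * A" "form 2 pb pb = form 1 pb pb * B"
    "form 2 pa pb = form 1 pa pb * C" "A + B = C + cnj C"
    using mass_ratio_sum by blast
  define s where "s = 1 + lam * (a - b)"
  define d where "d = a - b"
  have d: "d \<noteq> 0" using assms by (simp add: d_def)
  have pa: "pa = (\<lambda>n. s * pb n + d * ee n)" using pa_eq unfolding s_def d_def .
  have ab1: "form 1 pa pb = s * form 1 pb pb"
    by (subst pa, subst form_add_left) (auto simp: form_ee_pb simp del: One_nat_def)
  have ba1: "form 1 pb pa = cnj s * form 1 pb pb"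
    using form_cnj[of 1 pa pb] ab1 Kbb_form by simp
  have ea1: "form 1 ee pa = cnj d * form 1 ee ee"
    using form_cnj[of 1 pa ee] form_pa_ee NN_form by (simp add: d_def)
  have aa1: "form 1 pa pa = s * cnj s * form 1 pb pb + d * cnj d * form 1 ee ee"
    using form_add_left[of pb ee pa 1 s d] unfolding pa[symmetric] ba1 ea1 by (simp add: mult.assoc)
  have eb2: "d * form 2 ee pb = form 2 pa pb - s * form 2 pb pb"
    using form_add_left[of pb ee pb 2 s d] unfolding pa[symmetric] by simp
  have be2: "cnj d * form 2 pb ee = form 2 pb pa - cnj s * form 2 pb pb"
    using arg_cong[OF eb2, of cnj] form_cnj[of 2 ee pb] form_cnj[of 2 pa pb] form_cnj[of 2 pb pb] by simp
  have ba2: "form 2 pb pa = cnj s * form 1 pb pb * cnj C"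
    using form_cnj[of 2 pa pb] form_cnj[of 1 pa pb] ABC(3) ba1 by simp
  have ae2: "cnj d * form 2 pa ee = form 2 pa pa - cnj s * form 2 pa pb"
  proof -
    have "form 2 pa pa = s * form 2 pb pa + d * form 2 ee pa"
      using form_add_left[of pb ee pa 2 s d] unfolding pa[symmetric] by simp
    from arg_cong[OF this, of cnj] show ?thesis
      using form_cnj[of 2 pa pa] form_cnj[of 2 pb pa] form_cnj[of 2 ee pa] by simp
  qed
  have "d * cnj d * form 2 ee ee = cnj d * (form 2 pa ee - s * form 2 pb ee)"
    using form_add_left[of pb ee ee 2 s d] unfolding pa[symmetric] by (simp add: algebra_simps)
  also have "\<dots> = cnj d * form 2 pa ee - s * (cnj d * form 2 pb ee)"
    by (simp add: algebra_simps)
  also have "\<dots> = form 2 pa pa - cnj s * form 2 pa pb - s * (form 2 pb pa - cnj s * form 2 pb pb)"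
    unfolding ae2 be2 ..
  also have "\<dots> = form 1 pa pa * A - s * cnj s * form 1 pb pb * (C + cnj C - B)"
    unfolding ABC(1,2,3) ab1 ba2 by (simp add: algebra_simps)
  also have "\<dots> = (form 1 pa pa - s * cnj s * form 1 pb pb) * A"
    unfolding ABC(4)[symmetric] by (simp add: algebra_simps)
  also have "\<dots> = d * cnj d * form 1 ee ee * A"
    unfolding aa1 by (simp add: algebra_simps)
  finally have "form 2 ee ee = form 1 ee ee * A" using d by simp
  then show ?thesis unfolding ABC(1) by simp
qed

text \<open>The common majorant for the passage to \<open>a = b\<close>: \<open>K\<close> bounds the
  coefficients \<open>lam\<close> along the sequence, and the square costs a polynomial factor of
  degree two.\<close>

lemma majorant_summable:
  assumes "0 \<le> K"
  shows "(\<lambda>n. wt n * (real_of_int \<bar>n\<bar> * cmod a powi (n - 1) + K * cmod a powi n)\<^sup>2) summable_on UNIV"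
    (is "?H summable_on _")
proof -
  have g: "geo_decay (\<lambda>n. of_real (wt n) ^ 1 * (a powi n * cnj (a powi n)))"
    using geo_pow_pow(2)[of a a 1] a by auto
  have "geo_decay (\<lambda>n. complex_of_real (?H n))"
  proof (rule geo_decay_poly_bound[OF g, of _ "(1 / cmod a + K)\<^sup>2"])
    fix n
    let ?m = "real_of_int \<bar>n\<bar>"
    have "?m * cmod a powi (n - 1) + K * cmod a powi n = (?m / cmod a + K) * cmod a powi n"
      using nz by (simp add: power_int_diff field_simps)
    then have "?H n = (?m / cmod a + K)\<^sup>2 * (wt n * (cmod a powi n)\<^sup>2)"
      by (simp add: power_mult_distrib)
    also have "\<dots> \<le> ((1 / cmod a + K) * (1 + ?m))\<^sup>2 * (wt n * (cmod a powi n)\<^sup>2)"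
    proof (intro mult_right_mono power_mono)
      have "?m / cmod a + K \<le> ?m / cmod a + K + 1 / cmod a + K * ?m" using assms nz by simp
      then show "?m / cmod a + K \<le> (1 / cmod a + K) * (1 + ?m)" by (simp add: algebra_simps)
    qed (use assms nz wt_pos[of n] in auto)
    finally have "?H n \<le> (1 / cmod a + K)\<^sup>2 * (1 + ?m)\<^sup>2 * (wt n * (cmod a powi n)\<^sup>2)"
      by (simp add: power_mult_distrib)
    moreover have "0 \<le> ?H n" using wt_pos[of n] by simp
    ultimately show "cmod (complex_of_real (?H n)) \<le> (1 / cmod a + K)\<^sup>2 * (1 + ?m)\<^sup>2
        * cmod (of_real (wt n) ^ 1 * (a powi n * cnj (a powi n)))"
      unfolding norm_of_real abs_of_nonneg[OF \<open>0 \<le> ?H n\<close>]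
      using wt_pos[of n] by (simp add: norm_mult norm_power_int power2_eq_square)
  qed simp
  then show ?thesis by (rule infsum_complex_of_real(1)[OF geo_decay_summable])
qed

text \<open>The case \<open>a = b\<close> is the limit of \<open>b = a * cis \<epsilon>\<close>, along which \<open>t\<close> does not change.\<close>

lemma mass_identity:
  "form 2 ee ee * form 1 pa pa = form 2 pa pa * form 1 ee ee"
proof (cases "a = b")
  case False
  then show ?thesis by (rule mass_identity_distinct)
next
  case True
  define c where "c k = a * cis (1 / real (Suc k))" for k
  have cc: "cmod (c k) = cmod a" for k by (simp add: c_def norm_mult)
  have c0: "c k \<noteq> 0" for k using cc[of k] nz by auto
  have ca: "c k \<noteq> a" for k
  proof -
    have "cis (1 / real (Suc k)) \<noteq> 1"
    proof
      assume "cis (1 / real (Suc k)) = 1"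
      then have "sin (1 / real (Suc k)) = 0" by (simp add: complex_eq_iff)
      moreover have "0 < 1 / real (Suc k)" "1 / real (Suc k) < pi"
        using pi_gt3 order_le_less_trans[of "1 / real (Suc k)" 1 pi] by auto
      ultimately show False using sin_gt_zero[of "1 / real (Suc k)"] by (simp del: of_nat_Suc)
    qed
    then show ?thesis using nz by (simp add: c_def)
  qed
  have clim: "c \<longlonglongrightarrow> a"
  proof -
    have "(\<lambda>k. a * cis (1 / real (Suc k))) \<longlonglongrightarrow> a * cis 0"
      by (intro tendsto_intros LIMSEQ_Suc[OF lim_const_over_n])
    then show ?thesis by (simp add: c_def[abs_def])
  qed
  have pair: "annulus_pair r a (c k)" for k
    using r a cc by unfold_locales auto
  have tk: "annulus_pair.t r a (c k) = t" for k
    unfolding annulus_pair.t_def[OF pair] t_def using True cc by simp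
  have wk: "annulus_pair.wt r a (c k) = wt" for k
    by (simp add: fun_eq_iff annulus_pair.wt_def[OF pair] wt_def tk)
  have fk: "annulus_pair.form r a (c k) = form" for k
    by (simp add: fun_eq_iff annulus_pair.form_def[OF pair] form_def wk)
  define lk where "lk k = annulus_pair.lam r a (c k)" for k
  define ek where "ek k n = dpow a (c k) n - lk k * c k powi n" for k n
  have ek: "annulus_pair.ee r a (c k) = ek k" for k
    by (simp add: fun_eq_iff ek_def lk_def annulus_pair.ee_def[OF pair])
  have lkf: "lk k = form 1 (dpow a (c k)) (\<lambda>n. c k powi n) / form 1 pb pb" for k
  proof -
    have "form 1 (\<lambda>n. c k powi n) (\<lambda>n. c k powi n) = form 1 pb pb"
      unfolding form_def
    proof (rule infsum_cong)
      fix n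
      have "c k powi n * cnj (c k powi n) = b powi n * cnj (b powi n)"
        unfolding complex_norm_square[symmetric] norm_power_int cc True ..
      then show "of_real (wt n) ^ 1 * (c k powi n * cnj (c k powi n)) = of_real (wt n) ^ 1 * (pb n * cnj (pb n))"
        by (simp only:)
    qed
    then show ?thesis unfolding lk_def annulus_pair.lam_def[OF pair] fk by simp
  qed
  have hb: "cmod (dpow a (c k) n) \<le> real_of_int \<bar>n\<bar> * cmod a powi (n - 1)" for k n
    by (rule dpow_norm_le) (use nz cc in auto)
  have pbd: "cmod (c k powi n) = cmod a powi n" for k n by (simp add: norm_power_int cc)
  have plim: "(\<lambda>k. c k powi n) \<longlonglongrightarrow> a powi n" for n
    using nz by (intro tendsto_intros clim) auto
  have hlim: "(\<lambda>k. dpow a (c k) n) \<longlonglongrightarrow> hh n" for n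
    using dpow_tendsto[OF nz(1) c0 clim] True by simp
  have wt1: "cmod (of_real (wt n) ^ j) \<le> wt n" if "1 \<le> j" for n j
    using power_decreasing[OF that, of "wt n"] wt_pos[of n] wt_le_1[of n] by (simp add: norm_power)
  have "(\<lambda>k. form 1 (dpow a (c k)) (\<lambda>n. c k powi n)) \<longlonglongrightarrow> form 1 hh pb"
    unfolding form_def
  proof (rule dominated_convergence_infsum_int[OF _ _ majorant_summable[of 1]])
    show "(\<lambda>k. of_real (wt n) ^ 1 * (dpow a (c k) n * cnj (c k powi n)))
      \<longlonglongrightarrow> of_real (wt n) ^ 1 * (hh n * cnj (pb n))" for n
      using plim[of n] hlim[of n] True by (intro tendsto_mult tendsto_const tendsto_cnj) auto
    show "cmod (of_real (wt n) ^ 1 * (dpow a (c k) n * cnj (c k powi n)))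
      \<le> wt n * (real_of_int \<bar>n\<bar> * cmod a powi (n - 1) + 1 * cmod a powi n)\<^sup>2" for k n
    proof -
      let ?x = "real_of_int \<bar>n\<bar> * cmod a powi (n - 1)" and ?y = "cmod a powi n"
      have xy: "0 \<le> ?x" "0 \<le> ?y" by auto
      have "cmod (dpow a (c k) n * cnj (c k powi n)) \<le> ?x * ?y"
        unfolding norm_mult complex_mod_cnj pbd by (intro mult_right_mono hb) auto
      also have "\<dots> \<le> (?x + 1 * ?y)\<^sup>2"
        using xy by (simp add: power2_eq_square algebra_simps mult_nonneg_nonneg)
      finally show ?thesis
        unfolding norm_mult[of "of_real (wt n) ^ 1"] using wt1[of 1 n] wt_pos[of n] by (intro mult_mono) auto
    qed
  qed simp
  then have llim: "lk \<longlonglongrightarrow> lam"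
    unfolding lkf[abs_def] lam_def by (intro tendsto_intros form_pb_nz)
  \<comment> \<open>Convergence of the Gram-Schmidt coefficients comes first, since their bound
    \<open>K\<close> enters the majorant for the vectors themselves.\<close>
  then have "Bseq lk" using convergent_imp_Bseq convergent_def by blast
  then obtain K where K: "K > 0" "\<And>k. cmod (lk k) \<le> K" unfolding Bseq_def by blast
  have elim: "(\<lambda>k. ek k n) \<longlonglongrightarrow> ee n" for n
    unfolding ek_def ee_def using hlim[of n] llim plim[of n] True by (intro tendsto_diff tendsto_mult) auto
  have eb: "cmod (ek k n) \<le> real_of_int \<bar>n\<bar> * cmod a powi (n - 1) + K * cmod a powi n" for k n
  proof -
    have "cmod (ek k n) \<le> cmod (dpow a (c k) n) + cmod (lk k) * cmod (c k powi n)"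
      unfolding ek_def by (rule order_trans[OF norm_triangle_ineq4]) (simp add: norm_mult)
    also have "\<dots> \<le> real_of_int \<bar>n\<bar> * cmod a powi (n - 1) + K * cmod a powi n"
      unfolding pbd using hb K by (intro add_mono mult_right_mono) auto
    finally show ?thesis .
  qed
  have flim: "(\<lambda>k. form j (ek k) (ek k)) \<longlonglongrightarrow> form j ee ee" if "1 \<le> j" for j
    unfolding form_def
  proof (rule dominated_convergence_infsum_int[OF _ _ majorant_summable[of K]])
    show "(\<lambda>k. of_real (wt n) ^ j * (ek k n * cnj (ek k n))) \<longlonglongrightarrow> of_real (wt n) ^ j * (ee n * cnj (ee n))" for n
      by (intro tendsto_intros elim)
    show "cmod (of_real (wt n) ^ j * (ek k n * cnj (ek k n)))
      \<le> wt n * (real_of_int \<bar>n\<bar> * cmod a powi (n - 1) + K * cmod a powi n)\<^sup>2" for k n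
    proof -
      have "cmod (ek k n * cnj (ek k n)) = (cmod (ek k n))\<^sup>2"
        by (simp add: norm_mult power2_eq_square)
      also have "\<dots> \<le> (real_of_int \<bar>n\<bar> * cmod a powi (n - 1) + K * cmod a powi n)\<^sup>2"
        by (intro power_mono eb) auto
      finally show ?thesis
        unfolding norm_mult[of "of_real (wt n) ^ j"] using wt1[OF that, of n] wt_pos[of n] by (intro mult_mono) auto
    qed
  qed (use K in auto)
  have eq: "form 2 (ek k) (ek k) * form 1 pa pa = form 2 pa pa * form 1 (ek k) (ek k)" for k
    using annulus_pair.mass_identity_distinct[OF pair] ca[of k] unfolding fk ek by metis
  have L1: "(\<lambda>k. form 2 (ek k) (ek k) * form 1 pa pa) \<longlonglongrightarrow> form 2 ee ee * form 1 pa pa"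
    by (intro tendsto_intros flim) auto
  have L2: "(\<lambda>k. form 2 pa pa * form 1 (ek k) (ek k)) \<longlonglongrightarrow> form 2 pa pa * form 1 ee ee"
    by (intro tendsto_intros flim) auto
  show ?thesis using L1 unfolding eq by (rule LIMSEQ_unique[OF _ L2])
qed

section \<open>Squared moduli on the two boundary circles\<close>

definition lsum :: "(int \<Rightarrow> complex) \<Rightarrow> complex \<Rightarrow> complex" where
  "lsum u z = (\<Sum>\<^sub>\<infinity>n. of_real (wt n) * (cnj (u n) * z powi n))"

text \<open>The coefficient of \<open>z powi n\<close> in the squared modulus of
  \<open>lsum u z\<close> on the circle where the squared radius is \<open>s\<close>, obtained by
  replacing \<open>cnj z\<close> with \<open>s / z\<close>.\<close>

definition corr :: "(int \<Rightarrow> complex) \<Rightarrow> real \<Rightarrow> int \<Rightarrow> complex" where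
  "corr u s n = (\<Sum>\<^sub>\<infinity>j. of_real (wt (n + j)) * cnj (u (n + j)) * (of_real (wt j) * u j) * of_real s powi j)"

lemma lsum_geo:
  assumes "u \<in> {pa, ee}" "r \<le> cmod z" "cmod z \<le> 1"
  shows "geo_decay (\<lambda>n. of_real (wt n) * (cnj (u n) * z powi n))"
proof (cases "u = pa")
  case True
  then show ?thesis using geo_pow_pow(3)[of a z 1] assms by simp
next
  case False
  have "geo_decay (\<lambda>n. of_real (wt n) ^ 1 * (cnj (hh n) * z powi n) - cnj lam * (of_real (wt n) ^ 1 * (cnj (pb n) * z powi n)))"
    using geo_dpow_pow(3)[of z 1] geo_pow_pow(3)[of b z 1] assms
    by (intro geo_decay_diff geo_decay_cmult) auto
  moreover have "of_real (wt n) ^ 1 * (cnj (hh n) * z powi n) - cnj lam * (of_real (wt n) ^ 1 * (cnj (pb n) * z powi n))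
     = of_real (wt n) * (cnj (ee n) * z powi n)" for n
    by (simp add: ee_def algebra_simps)
  ultimately show ?thesis using False assms by simp
qed

lemma abs_lsum_expansion:
  assumes "u \<in> {pa, ee}" "cmod z = 1 \<or> cmod z = r"
  shows "((\<lambda>n. corr u ((cmod z)\<^sup>2) n * z powi n) has_sum of_real ((cmod (lsum u z))\<^sup>2)) UNIV"
proof -
  have z: "r \<le> cmod z" "cmod z \<le> 1" and z0: "z \<noteq> 0" using assms r by auto
  let ?s = "(cmod z)\<^sup>2"
  let ?f = "\<lambda>n. of_real (wt n) * (cnj (u n) * z powi n)"
  note S = geo_decay_summable[OF lsum_geo[OF assms(1) z]]
  have S': "(\<lambda>n. cnj (?f (- n))) summable_on UNIV"
    using S summable_on_reindex_bij_betw[of uminus UNIV UNIV "\<lambda>n. cnj (?f n)"]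
    by (simp only: bij_uminus summable_on_cnj_iff)
  have e: "infsum (\<lambda>n. cnj (?f (- n))) UNIV = cnj (lsum u z)"
    unfolding lsum_def using infsum_uminus_int[of "\<lambda>n. cnj (?f n)"] by (simp only: infsum_cnj)
  have "infsum (\<lambda>j. ?f (n - j) * cnj (?f (- j))) UNIV = corr u ?s n * z powi n" for n
  proof -
    have zc: "cnj z = of_real ?s / z" using z0 complex_norm_square[of z] by (simp add: field_simps)
    have "infsum (\<lambda>j. ?f (n - j) * cnj (?f (- j))) UNIV = infsum (\<lambda>j. ?f (n + j) * cnj (?f j)) UNIV"
      using infsum_uminus_int[of "\<lambda>j. ?f (n + j) * cnj (?f j)"] by simp
    also have "\<dots> = infsum (\<lambda>j. of_real (wt (n + j)) * cnj (u (n + j)) * (of_real (wt j) * u j) * of_real ?s powi j * z powi n) UNIV"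
    proof (rule infsum_cong)
      fix j
      have "z powi (n + j) * cnj (z powi j) = of_real ?s powi j * z powi n"
        using z0 by (simp add: zc power_int_divide_distrib power_int_add)
      then have "(of_real (wt (n + j)) * cnj (u (n + j)) * (of_real (wt j) * u j)) * (z powi (n + j) * cnj (z powi j))
        = (of_real (wt (n + j)) * cnj (u (n + j)) * (of_real (wt j) * u j)) * (of_real ?s powi j * z powi n)"
        by (simp only:)
      then show "?f (n + j) * cnj (?f j) = of_real (wt (n + j)) * cnj (u (n + j)) * (of_real (wt j) * u j) * of_real ?s powi j * z powi n"
        by (simp add: ac_simps)
    qed
    finally show ?thesis unfolding corr_def by (simp only: infsum_cmult_left')
  qed
  moreover have "lsum u z * cnj (lsum u z) = of_real ((cmod (lsum u z))\<^sup>2)"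
    by (simp add: complex_norm_square[symmetric])
  ultimately show ?thesis
    using bilateral_Cauchy_product[OF S S'] unfolding e lsum_def[symmetric] by simp
qed

lemma corr_summable:
  assumes "u \<in> {pa, ee}" "s = 1 \<or> s = r\<^sup>2"
  shows "(\<lambda>j. of_real (wt (n + j)) * cnj (u (n + j)) * (of_real (wt j) * u j) * of_real s powi j) summable_on UNIV"
proof -
  define z :: complex where "z = of_real (sqrt s)"
  have z: "r \<le> cmod z" "cmod z \<le> 1" "z \<noteq> 0" "z * z = of_real s"
    using assms r by (auto simp: z_def real_sqrt_mult[symmetric] simp flip: of_real_mult)
  let ?f = "\<lambda>n. of_real (wt n) * (cnj (u n) * z powi n)"
  have g: "geo_decay ?f" by (rule lsum_geo) (use assms z in auto)
  obtain C \<sigma> where C: "0 < \<sigma>" "\<sigma> < 1" "\<And>n. cmod (?f n) \<le> C * \<sigma> ^ nat \<bar>n\<bar>"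
    using g unfolding geo_decay_def by blast
  have C0: "0 \<le> C" using order_trans[OF norm_ge_zero C(3)[of 0]] by simp
  have "cmod (?f n) \<le> C" for n
    using order_trans[OF C(3)[of n]] mult_left_mono[OF power_le_one[of \<sigma> "nat \<bar>n\<bar>"] C0] C by simp
  then have "geo_decay (\<lambda>j. (1 / z powi n) * (?f (n + j) * cnj (?f j)))"
    by (intro geo_decay_cmult geo_decay_bound[OF geo_decay_cnj[OF g], of _ C])
       (simp add: norm_mult[of "?f _"] mult_right_mono del: complex_cnj_mult)
  moreover have "(1 / z powi n) * (?f (n + j) * cnj (?f j))
    = of_real (wt (n + j)) * cnj (u (n + j)) * (of_real (wt j) * u j) * of_real s powi j" for j
  proof -
    have "cnj z = z" by (simp add: z_def)
    then have "z powi (n + j) * cnj (z powi j) = z powi n * of_real s powi j"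
      using z by (simp add: power_int_add power_int_mult_distrib flip: z(4))
    then have "z powi (n + j) * cnj (z powi j) / z powi n = of_real s powi j" using z(3) by simp
    then have "(of_real (wt (n + j)) * cnj (u (n + j)) * (of_real (wt j) * u j)) * (z powi (n + j) * cnj (z powi j) / z powi n)
      = (of_real (wt (n + j)) * cnj (u (n + j)) * (of_real (wt j) * u j)) * of_real s powi j" by (simp only:)
    then show ?thesis by (simp add: ac_simps)
  qed
  ultimately show ?thesis using geo_decay_summable by simp
qed

text \<open>The two circles carry the weights \<open>1\<close> and \<open>t\<close>, so \<open>\<bar>lsum u\<bar>\<^sup>2\<close> is \<open>form 1 u u\<close> times a
  representing measure of \<open>a\<close>; two such measures differ only by a constant on each circle, hence they
  coincide as soon as their masses on the outer circle agree.\<close>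

lemma corr_sum:
  assumes "u \<in> {pa, ee}"
  shows "corr u 1 n + of_real t * corr u (r\<^sup>2) n = a powi (- n) * form 1 u u"
proof -
  let ?g = "\<lambda>j. of_real (wt j) * u j :: complex"
  have "corr u 1 n + of_real t * corr u (r\<^sup>2) n
    = infsum (\<lambda>j. of_real (wt (n + j)) * cnj (u (n + j)) * ?g j * of_real 1 powi j
        + of_real t * (of_real (wt (n + j)) * cnj (u (n + j)) * ?g j * of_real (r\<^sup>2) powi j)) UNIV"
    unfolding corr_def infsum_cmult_right'[symmetric]
    by (rule infsum_add[symmetric]) (intro summable_on_cmult_right corr_summable[OF assms]; simp)+
  also have "\<dots> = infsum (\<lambda>j. of_real (wt (n + j)) * cnj (u (n + j)) * u j) UNIV"
  proof (rule infsum_cong)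
    fix j
    have "1 + t * (r\<^sup>2) powi j \<noteq> 0" using t_pos r2_range by (smt (verit) mult_pos_pos zero_less_power_int)
    then have "wt j * (1 + t * (r\<^sup>2) powi j) = 1" by (simp add: wt_def)
    then have "complex_of_real (wt j) * (1 + of_real t * of_real (r\<^sup>2) powi j) = 1"
      by (metis of_real_1 of_real_add of_real_mult of_real_power_int)
    then have "of_real (wt (n + j)) * cnj (u (n + j)) * u j * (complex_of_real (wt j) * (1 + of_real t * of_real (r\<^sup>2) powi j))
      = of_real (wt (n + j)) * cnj (u (n + j)) * u j" by (simp only: mult_1_right)
    then show "of_real (wt (n + j)) * cnj (u (n + j)) * ?g j * of_real 1 powi j
        + of_real t * (of_real (wt (n + j)) * cnj (u (n + j)) * ?g j * of_real (r\<^sup>2) powi j)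
      = of_real (wt (n + j)) * cnj (u (n + j)) * u j"
      by (simp add: algebra_simps)
  qed
  also have "\<dots> = infsum (\<lambda>j. of_real (wt j) * (u (j - n) * cnj (u j))) UNIV"
    using infsum_shift_int[of "\<lambda>j. of_real (wt j) * (u (j - n) * cnj (u j))" n]
    by (simp add: ac_simps)
  also have "\<dots> = a powi (- n) * form 1 u u"
  proof (cases "u = pa")
    case True
    have "of_real (wt j) * (u (j - n) * cnj (u j)) = a powi (- n) * (of_real (wt j) ^ 1 * (u j * cnj (u j)))" for j
      unfolding True using nz by (simp add: power_int_diff power_int_minus field_simps)
    then show ?thesis unfolding form_def by (simp only: infsum_cmult_right')
  next
    case False
    then have u: "u = ee" using assms by simp
    \<comment> \<open>Leibniz rule: a shift of \<open>ee\<close> stays in the span of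
      \<open>hh\<close> and \<open>pb\<close>, and only the \<open>hh\<close> part survives the
      pairing with \<open>ee\<close>.\<close>
    have "ee (j - n) = a powi (- n) * hh j + (hh (- n) - lam * b powi (- n)) * pb j" for j
      using dpow_add[OF nz(1,2), of j "- n"] power_int_add[of b j "- n"] nz
      by (simp add: ee_def algebra_simps)
    then have "infsum (\<lambda>j. of_real (wt j) * (u (j - n) * cnj (u j))) UNIV
      = form 1 (\<lambda>j. a powi (- n) * hh j + (hh (- n) - lam * b powi (- n)) * pb j) ee"
      unfolding form_def u by simp
    also have "\<dots> = a powi (- n) * form 1 hh ee + (hh (- n) - lam * b powi (- n)) * form 1 pb ee"
      by (rule form_add_left) auto
    finally show ?thesis unfolding u form_hh_ee NN_form form_pb_ee by simp
  qed
  finally show ?thesis .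
qed

text \<open>The squared modulus is real, and on the circle
  \<open>cnj (z powi n) = s powi n * z powi (- n)\<close>.\<close>

lemma corr_uminus:
  assumes "u \<in> {pa, ee}" "s > 0"
  shows "corr u s (- n) = of_real s powi n * cnj (corr u s n)"
proof -
  have "corr u s (- n) = infsum (\<lambda>j. of_real (wt j) * cnj (u j) * (of_real (wt (j + n)) * u (j + n)) * of_real s powi (j + n)) UNIV"
    unfolding corr_def
    using infsum_shift_int[of "\<lambda>j. of_real (wt (- n + j)) * cnj (u (- n + j)) * (of_real (wt j) * u j) * of_real s powi j" n]
    by simp
  also have "\<dots> = infsum (\<lambda>j. of_real s powi n * cnj (of_real (wt (n + j)) * cnj (u (n + j)) * (of_real (wt j) * u j) * of_real s powi j)) UNIV"
    using assms(2) by (intro infsum_cong) (simp add: power_int_add ac_simps)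
  finally show ?thesis unfolding corr_def by (simp only: infsum_cmult_right' infsum_cnj)
qed

lemma corr_0: "corr u 1 0 = form 2 u u"
  unfolding corr_def form_def by (simp add: power2_eq_square ac_simps)

text \<open>Let \<open>D n\<close>, \<open>E n\<close> be the defects on the two circles.
  \<open>corr_sum\<close> gives \<open>D n + t * E n = 0\<close>; the same at \<open>- n\<close>,
  conjugated, gives \<open>D n + t * r powi (2 * n) * E n = 0\<close>. For
  \<open>n \<noteq> 0\<close> the two equations are independent. For \<open>n = 0\<close> they
  coincide, and \<open>mass_identity\<close> supplies \<open>D 0 = 0\<close>.\<close>

lemma corr_eq:
  "of_real Kaa * corr ee 1 n = of_real NN * corr pa 1 n" (is ?P1)
  "of_real Kaa * corr ee (r\<^sup>2) n = of_real NN * corr pa (r\<^sup>2) n" (is ?P2)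
proof -
  define D where "D n = of_real Kaa * corr ee 1 n - of_real NN * corr pa 1 n" for n
  define E where "E n = of_real Kaa * corr ee (r\<^sup>2) n - of_real NN * corr pa (r\<^sup>2) n" for n
  have DE: "D n + of_real t * E n = 0" for n
  proof -
    have "D n + of_real t * E n = of_real Kaa * (corr ee 1 n + of_real t * corr ee (r\<^sup>2) n)
        - of_real NN * (corr pa 1 n + of_real t * corr pa (r\<^sup>2) n)"
      unfolding D_def E_def by (simp only: algebra_simps)
    also have "\<dots> = 0" using corr_sum[of ee n] corr_sum[of pa n] by (simp only: insertI1 insertI2 NN_form Kaa_form simp_thms) simp
    finally show ?thesis .
  qed
  have Dm: "D (- n) = cnj (D n)" for n
    unfolding D_def using corr_uminus[of ee 1 n] corr_uminus[of pa 1 n] by simp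
  have Em: "E (- n) = of_real ((r\<^sup>2) powi n) * cnj (E n)" for n
    unfolding E_def using corr_uminus[of ee "r\<^sup>2" n] corr_uminus[of pa "r\<^sup>2" n] r2_range
    by (simp add: algebra_simps)
  have D0: "D 0 = 0" unfolding D_def corr_0 using mass_identity
    unfolding NN_form Kaa_form by (simp only: mult.commute right_minus_eq)
  have DE2: "D n + of_real (t * (r\<^sup>2) powi n) * E n = 0"
    using arg_cong[OF DE[of "- n"], of cnj] unfolding Dm Em by (simp add: mult.assoc)
  have Dn: "D n = 0" and En: "E n = 0"
  proof -
    have "E n = 0"
    proof (cases "n = 0")
      case True
      then show ?thesis using DE[of 0] D0 t_pos by simp
    next
      case False
      have "(r\<^sup>2) powi n \<noteq> 1"
      proof (cases "n > 0")
        case True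
        then have "(r\<^sup>2) powi n < 1" using r2_range by (simp add: power_int_def power_less_one_iff)
        then show ?thesis by simp
      next
        case neg: False
        then have "(r\<^sup>2) powi (- n) < 1" using r2_range False by (simp add: power_int_def power_less_one_iff)
        then show ?thesis by (auto simp: power_int_minus)
      qed
      moreover have "of_real (t - t * (r\<^sup>2) powi n) * E n = 0"
        using DE[of n] DE2 unfolding of_real_diff left_diff_distrib by (metis add_left_cancel right_minus_eq)
      ultimately show ?thesis using t_pos by (auto simp del: of_real_diff of_real_mult)
    qed
    then show "D n = 0" "E n = 0" using DE[of n] by auto
  qed
  show ?P1 ?P2 using Dn En unfolding D_def E_def by auto
qed

lemma boundary_identity:
  assumes "cmod z = 1 \<or> cmod z = r"
  shows "Kaa * (cmod (lsum ee z))\<^sup>2 = NN * (cmod (lsum pa z))\<^sup>2"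
proof -
  note E1 = has_sum_cmult_right[OF abs_lsum_expansion[of ee z], of "of_real Kaa"]
  note E2 = has_sum_cmult_right[OF abs_lsum_expansion[of pa z], of "of_real NN"]
  have "of_real Kaa * (corr ee ((cmod z)\<^sup>2) n * z powi n) = of_real NN * (corr pa ((cmod z)\<^sup>2) n * z powi n)" for n
    using assms corr_eq[of n] unfolding mult.assoc[symmetric] by auto
  then have "complex_of_real Kaa * of_real ((cmod (lsum ee z))\<^sup>2) = of_real NN * of_real ((cmod (lsum pa z))\<^sup>2)"
    using E1 E2 assms has_sum_unique by (metis (no_types, lifting) ext insertI1 insertI2)
  then show ?thesis by (metis of_real_eq_iff of_real_mult)
qed

lemma lsum_pa_nz:
  assumes "r \<le> cmod z" "cmod z \<le> 1"
  shows "lsum pa z \<noteq> 0"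
  using kernel_nz[OF assms] unfolding lsum_def by simp

end

section \<open>The extremal inequality\<close>



definition m22 :: "complex \<Rightarrow> complex \<Rightarrow> complex \<Rightarrow> complex \<Rightarrow> cmat2" where
  "m22 p q u v = (\<chi> i j. if i = 1 then (if j = 1 then p else q) else (if j = 1 then u else v))"

lemma m22_nth [simp]: "m22 p q u v $ 1 $ 1 = p" "m22 p q u v $ 1 $ 2 = q"
  "m22 p q u v $ 2 $ 1 = u" "m22 p q u v $ 2 $ 2 = v"
  by (simp_all add: m22_def)

lemma m22_eq_iff: "A = B \<longleftrightarrow> A $ 1 $ 1 = B $ 1 $ 1 \<and> A $ 1 $ 2 = B $ 1 $ 2 \<and> A $ 2 $ 1 = B $ 2 $ 1 \<and> A $ 2 $ 2 = B $ 2 $ 2"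
  for A B :: cmat2
  by (simp add: vec_eq_iff forall_2)

lemma m22_surj: "A = m22 (A $ 1 $ 1) (A $ 1 $ 2) (A $ 2 $ 1) (A $ 2 $ 2)"
  by (simp add: m22_eq_iff)

lemma m22_mult: "m22 p q u v ** m22 p' q' u' v' = m22 (p * p' + q * u') (p * q' + q * v') (u * p' + v * u') (u * q' + v * v')"
  by (simp add: m22_eq_iff matrix_matrix_mult_def sum_2)

lemma mat_m22: "mat c = m22 c 0 0 c"
  by (simp add: m22_eq_iff mat_def)

lemma m22_diff: "m22 p q u v - m22 p' q' u' v' = m22 (p - p') (q - q') (u - u') (v - v')"
  by (simp add: m22_eq_iff)

lemma sum_m22: "(\<Sum>i\<in>I. m22 (p i) (q i) (u i) (v i)) = m22 (sum p I) (sum q I) (sum u I) (sum v I)"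
  by (simp add: m22_eq_iff)

lemma matrix_inv_eqI:
  fixes A B :: cmat2
  assumes "A ** B = mat 1"
  shows "matrix_inv A = B" "matrix_inv A ** A = mat 1" "A ** matrix_inv A = mat 1"
proof -
  have BA: "B ** A = mat 1" using assms matrix_left_right_inverse by blast
  then have "\<exists>X. A ** X = mat 1 \<and> X ** A = mat 1" using assms by blast
  then have *: "A ** matrix_inv A = mat 1 \<and> matrix_inv A ** A = mat 1"
    unfolding matrix_inv_def by (rule someI_ex)
  then show "matrix_inv A ** A = mat 1" "A ** matrix_inv A = mat 1" by auto
  have "matrix_inv A = matrix_inv A ** (A ** B)" using assms by simp
  also have "\<dots> = B" unfolding matrix_mul_assoc using * by simp
  finally show "matrix_inv A = B" .
qed

lemma matrix_inv_ltri:
  assumes "x \<noteq> 0" "z \<noteq> 0"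
  shows "matrix_inv (m22 x 0 y z) = m22 (1 / x) 0 (- y / (x * z)) (1 / z)"
  using assms by (intro matrix_inv_eqI) (simp add: m22_mult mat_m22 field_simps)

text \<open>The pattern behind the whole calculus on these matrices: the off-diagonal entry of a
  function of the matrix is \<open>g\<close> times the divided difference of the function at
  \<open>a\<close>, \<open>b\<close>.\<close>

lemma mat_pow_ltri:
  assumes "a \<noteq> 0" "b \<noteq> 0"
  shows "mat_pow (m22 b 0 g a) k = m22 (b ^ k) 0 (g * dpow a b (int k)) (a ^ k)"
proof (induction k)
  case 0
  then show ?case by (simp add: mat_pow_def mat_m22)
next
  case (Suc k)
  have "dpow a b (int (Suc k)) = a * dpow a b (int k) + b ^ k"
    using dpow_Suc[OF assms, of "int k"] by (simp add: add.commute)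
  then show ?case using Suc by (simp add: mat_pow_def m22_mult algebra_simps)
qed

lemma mat_poly_ltri:
  assumes "a \<noteq> 0" "b \<noteq> 0" "degree p \<le> M"
  shows "mat_poly p (m22 b 0 g a) = m22 (poly p b) 0 (g * (\<Sum>i\<le>M. coeff p i * dpow a b (int i))) (poly p a)"
proof -
  have "(\<Sum>i\<le>degree p. coeff p i * dpow a b (int i)) = (\<Sum>i\<le>M. coeff p i * dpow a b (int i))"
    using assms(3) by (intro sum.mono_neutral_left) (auto simp: coeff_eq_0)
  moreover have "mat_poly p (m22 b 0 g a) = (\<Sum>i\<le>degree p. m22 (coeff p i * b ^ i) 0 (g * (coeff p i * dpow a b (int i))) (coeff p i * a ^ i))"
    unfolding mat_poly_def mat_pow_ltri[OF assms(1,2)] by (simp add: mat_m22 m22_mult ac_simps)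
  ultimately show ?thesis by (simp add: sum_m22 poly_altdef flip: sum_distrib_left)
qed

lemma mat_norm_row:
  "(cmod (A $ i $ 1))\<^sup>2 + (cmod (A $ i $ 2))\<^sup>2 \<le> (mat_norm A)\<^sup>2"
proof -
  let ?S = "(cmod (A $ i $ 1))\<^sup>2 + (cmod (A $ i $ 2))\<^sup>2"
  define x :: "complex^2" where "x = (\<chi> j. cnj (A $ i $ j))"
  have bl: "bounded_linear (\<lambda>x. A *v x)"
    by (intro linear_conv_bounded_linear[THEN iffD1] linearI)
       (simp_all add: matrix_vector_mult_def vec_eq_iff sum.distrib algebra_simps sum_distrib_left scaleR_sum_right)
  have nx: "norm x = sqrt ?S" by (simp add: x_def norm_vec_def L2_set_def UNIV_2)
  have "(A *v x) $ i = of_real ?S"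
    by (simp add: matrix_vector_mult_def x_def sum_2 complex_norm_square[symmetric])
  then have "?S = norm ((A *v x) $ i)" by (simp add: norm_of_real del: of_real_add of_real_power)
  also have "\<dots> \<le> norm (A *v x)" by (rule Finite_Cartesian_Product.norm_nth_le)
  also have "\<dots> \<le> mat_norm A * norm x" unfolding mat_norm_def by (rule onorm[OF bl])
  finally have *: "?S \<le> mat_norm A * sqrt ?S" unfolding nx .
  show ?thesis
  proof (cases "?S = 0")
    case False
    then have pos: "?S > 0" using sum_power2_gt_zero_iff sum_power2_eq_zero_iff by metis
    then have "sqrt ?S * sqrt ?S \<le> mat_norm A * sqrt ?S" using * by simp
    then have "sqrt ?S \<le> mat_norm A" by (rule mult_right_le_imp_le) (use pos in simp)
    then have "(sqrt ?S)\<^sup>2 \<le> (mat_norm A)\<^sup>2" by (intro power_mono) (use pos in auto)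
    then show ?thesis using pos by simp
  next
    case True
    then show ?thesis by (metis zero_le_power2)
  qed
qed

lemma compact_closed_annulus: "compact (closed_annulus r)"
proof -
  have "closed_annulus r = cball 0 1 - ball 0 r" by (auto simp: closed_annulus_def)
  then show ?thesis by (simp add: compact_diff)
qed

lemma closed_annulus_max_modulus:
  assumes "0 < r" "r < 1" "f holomorphic_on UNIV" "g holomorphic_on UNIV"
    and g: "\<And>z. z \<in> closed_annulus r \<Longrightarrow> g z \<noteq> 0"
    and bd: "\<And>z. cmod z = 1 \<or> cmod z = r \<Longrightarrow> cmod (f z / g z) \<le> B" and z: "z \<in> closed_annulus r"
  shows "cmod (f z / g z) \<le> B"
proof (rule maximum_modulus_frontier[of "\<lambda>z. f z / g z" "closed_annulus r"])
  have hol: "(\<lambda>z. f z / g z) holomorphic_on closed_annulus r"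
    using assms(3,4) g by (intro holomorphic_on_divide) (auto intro: holomorphic_on_subset)
  show "(\<lambda>z. f z / g z) holomorphic_on interior (closed_annulus r)"
    by (rule holomorphic_on_subset[OF hol interior_subset])
  have cl: "closed (closed_annulus r)" using compact_closed_annulus compact_imp_closed by blast
  then show "continuous_on (closure (closed_annulus r)) (\<lambda>z. f z / g z)"
    using holomorphic_on_imp_continuous_on[OF hol] by simp
  show "bounded (closed_annulus r)" using compact_closed_annulus compact_imp_bounded by blast
  fix z assume z: "z \<in> frontier (closed_annulus r)"
  have op: "open {z::complex. r < cmod z \<and> cmod z < 1}"
    by (intro open_Collect_conj open_Collect_less continuous_intros)
  have "{z::complex. r < cmod z \<and> cmod z < 1} \<subseteq> interior (closed_annulus r)"
    by (intro interior_maximal op) (auto simp: closed_annulus_def)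
  then have "\<not> (r < cmod z \<and> cmod z < 1)" "z \<in> closed_annulus r"
    using z cl by (auto simp: frontier_def)
  then have "cmod z = 1 \<or> cmod z = r" by (auto simp: closed_annulus_def)
  then show "norm (f z / g z) \<le> B" by (rule bd)
qed (rule z)

lemma symmetric_sums_tendsto:
  fixes f :: "int \<Rightarrow> 'a::{banach}"
  assumes "f summable_on UNIV"
  shows "(\<lambda>N. \<Sum>n\<in>{- int N..int N}. f n) \<longlonglongrightarrow> infsum f UNIV"
proof -
  have "filterlim (\<lambda>N. {- int N..int N}) (finite_subsets_at_top UNIV) sequentially"
    unfolding filterlim_finite_subsets_at_top
  proof (intro allI impI)
    fix X :: "int set" assume X: "finite X \<and> X \<subseteq> UNIV"
    define M where "M = nat (\<Sum>x\<in>X. \<bar>x\<bar>)"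
    have "X \<subseteq> {- int N..int N}" if "N \<ge> M" for N
    proof
      fix x assume "x \<in> X"
      then have "\<bar>x\<bar> \<le> (\<Sum>x\<in>X. \<bar>x\<bar>)" using X by (intro member_le_sum) auto
      then show "x \<in> {- int N..int N}" using that unfolding M_def by auto
    qed
    then show "eventually (\<lambda>N. finite {- int N..int N} \<and> X \<subseteq> {- int N..int N} \<and> {- int N..int N} \<subseteq> UNIV) sequentially"
      unfolding eventually_sequentially by blast
  qed
  then show ?thesis
    using has_sum_infsum[OF assms] unfolding has_sum_def by (rule filterlim_compose[rotated])
qed

text \<open>A truncated Laurent series multiplied by \<open>z ^ N\<close>, so that it becomes a
  polynomial; the factor cancels in quotients with a common \<open>N\<close>.\<close>

definition laurent_poly :: "(int \<Rightarrow> complex) \<Rightarrow> nat \<Rightarrow> complex poly" where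
  "laurent_poly c N = (\<Sum>k\<le>2 * N. monom (c (int k - int N)) k)"

lemma coeff_laurent_poly: "coeff (laurent_poly c N) k = (if k \<le> 2 * N then c (int k - int N) else 0)"
  by (simp add: laurent_poly_def coeff_sum coeff_monom if_distrib sum.delta' cong: if_cong)

lemma degree_laurent_poly: "degree (laurent_poly c N) \<le> 2 * N"
  by (intro degree_le) (simp add: coeff_laurent_poly)

lemma sum_laurent_reindex:
  "(\<Sum>k\<le>2 * N. g (int k - int N)) = (\<Sum>n\<in>{- int N..int N}. g n)"
  by (rule sum.reindex_bij_witness[of _ "\<lambda>n. nat (n + int N)" "\<lambda>k. int k - int N"]) auto

lemma poly_laurent_poly:
  assumes "z \<noteq> 0"
  shows "poly (laurent_poly c N) z = z ^ N * (\<Sum>n\<in>{- int N..int N}. c n * z powi n)"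
proof -
  have "poly (laurent_poly c N) z = (\<Sum>k\<le>2 * N. c (int k - int N) * z ^ k)"
    by (simp add: laurent_poly_def poly_sum poly_monom)
  also have "\<dots> = (\<Sum>k\<le>2 * N. z ^ N * (c (int k - int N) * z powi (int k - int N)))"
    using assms by (intro sum.cong) (simp_all add: power_int_diff)
  also have "\<dots> = z ^ N * (\<Sum>k\<le>2 * N. c (int k - int N) * z powi (int k - int N))"
    by (simp add: sum_distrib_left)
  also have "(\<Sum>k\<le>2 * N. c (int k - int N) * z powi (int k - int N)) = (\<Sum>n\<in>{- int N..int N}. c n * z powi n)"
    by (rule sum_laurent_reindex)
  finally show ?thesis .
qed

lemma dpow_laurent_poly:
  assumes "a \<noteq> 0" "b \<noteq> 0"
  shows "(\<Sum>k\<le>2 * N. coeff (laurent_poly c N) k * dpow a b (int k))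
    = dpow a b (int N) * (\<Sum>n\<in>{- int N..int N}. c n * a powi n) + b ^ N * (\<Sum>n\<in>{- int N..int N}. c n * dpow a b n)"
proof -
  have "(\<Sum>k\<le>2 * N. coeff (laurent_poly c N) k * dpow a b (int k))
     = (\<Sum>k\<le>2 * N. c (int k - int N) * dpow a b (int N + (int k - int N)))"
    by (intro sum.cong) (simp_all add: coeff_laurent_poly)
  also have "\<dots> = (\<Sum>n\<in>{- int N..int N}. c n * dpow a b (int N + n))"
    by (rule sum_laurent_reindex)
  also have "\<dots> = (\<Sum>n\<in>{- int N..int N}. dpow a b (int N) * (c n * a powi n) + b ^ N * (c n * dpow a b n))"
  proof (rule sum.cong)
    show "c n * dpow a b (int N + n) = dpow a b (int N) * (c n * a powi n) + b ^ N * (c n * dpow a b n)" for n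
      using dpow_add[OF assms, of "int N" n] by (simp add: algebra_simps)
  qed simp
  finally show ?thesis by (simp add: sum.distrib sum_distrib_left)
qed

text \<open>The quotient rule for divided differences. The terms with
  \<open>dpow a b (int N)\<close>, caused by the factor \<open>z ^ N\<close>, cancel in the
  numerator.\<close>

lemma mat_rat_laurent_poly:
  assumes "a \<noteq> 0" "b \<noteq> 0" "SA \<noteq> 0" "SB \<noteq> 0"
    and "SA = (\<Sum>n\<in>{- int N..int N}. d n * a powi n)" "SB = (\<Sum>n\<in>{- int N..int N}. d n * b powi n)"
  shows "mat_rat (laurent_poly c N) (laurent_poly d N) (m22 b 0 g a) $ 2 $ 2 = (\<Sum>n\<in>{- int N..int N}. c n * a powi n) / SA"
    and "mat_rat (laurent_poly c N) (laurent_poly d N) (m22 b 0 g a) $ 2 $ 1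
      = g * ((\<Sum>n\<in>{- int N..int N}. c n * dpow a b n) * SA
             - (\<Sum>n\<in>{- int N..int N}. c n * a powi n) * (\<Sum>n\<in>{- int N..int N}. d n * dpow a b n)) / (SA * SB)"
  unfolding mat_rat_def mat_poly_ltri[OF assms(1,2) degree_laurent_poly] dpow_laurent_poly[OF assms(1,2)]
    poly_laurent_poly[OF assms(1)] poly_laurent_poly[OF assms(2)] assms(5,6)[symmetric]
  using assms(1-4) by (simp_all add: matrix_inv_ltri m22_mult) (simp add: divide_simps, simp add: algebra_simps)

context annulus_pair
begin


section \<open>Rational approximation of the extremal function\<close>

definition psum :: "(int \<Rightarrow> complex) \<Rightarrow> nat \<Rightarrow> complex \<Rightarrow> complex" where
  "psum u N z = (\<Sum>n\<in>{- int N..int N}. of_real (wt n) * cnj (u n) * z powi n)"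

text \<open>The Weierstrass test with the majorant \<open>m\<close>: the bound
  \<open>cmod z powi n \<le> 1 + r powi n\<close> covers both signs of \<open>n\<close> on the
  closed annulus.\<close>

lemma psum_uniform:
  assumes "u \<in> {pa, ee}" "\<epsilon> > 0"
  shows "eventually (\<lambda>N. \<forall>z\<in>closed_annulus r. cmod (lsum u z - psum u N z) < \<epsilon>) sequentially"
proof -
  define m where "m n = wt n * cmod (u n) * (1 + r powi n)" for n
  have m0: "0 \<le> m n" for n unfolding m_def using wt_pos[of n] r by (intro mult_nonneg_nonneg) auto
  have "(\<lambda>n. of_real (wt n) * (cnj (u n) * 1 powi n)) summable_on UNIV"
    "(\<lambda>n. of_real (wt n) * (cnj (u n) * of_real r powi n)) summable_on UNIV"
    by (rule geo_decay_summable[OF lsum_geo[OF assms(1)]], use r in auto)+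
  then have "(\<lambda>n. cmod (of_real (wt n) * (cnj (u n) * 1 powi n)) + cmod (of_real (wt n) * (cnj (u n) * of_real r powi n))) summable_on UNIV"
    unfolding summable_on_iff_abs_summable_on_complex by (rule summable_on_add)
  moreover have "cmod (of_real (wt n) * (cnj (u n) * 1 powi n)) + cmod (of_real (wt n) * (cnj (u n) * of_real r powi n)) = m n" for n
    using wt_pos[of n] r by (simp add: m_def norm_mult norm_power_int algebra_simps)
  ultimately have ms: "m summable_on UNIV" by simp
  have "(\<lambda>N. infsum m UNIV - (\<Sum>n\<in>{- int N..int N}. m n)) \<longlonglongrightarrow> infsum m UNIV - infsum m UNIV"
    by (intro tendsto_intros symmetric_sums_tendsto ms)
  then have "eventually (\<lambda>N. infsum m UNIV - (\<Sum>n\<in>{- int N..int N}. m n) < \<epsilon>) sequentially"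
    using assms(2) by (intro order_tendstoD(2)[of _ 0]) auto
  then show ?thesis
  proof (rule eventually_mono, intro ballI)
    fix N z assume N: "infsum m UNIV - (\<Sum>n\<in>{- int N..int N}. m n) < \<epsilon>" and z: "z \<in> closed_annulus r"
    let ?f = "\<lambda>n. of_real (wt n) * (cnj (u n) * z powi n)" and ?I = "{- int N..int N}"
    have z': "r \<le> cmod z" "cmod z \<le> 1" using z by (auto simp: closed_annulus_def)
    have zp: "cmod z powi n \<le> 1 + r powi n" for n
    proof (cases "n \<ge> 0")
      case True
      then have "cmod z powi n \<le> 1" using z' by (simp add: power_int_def power_le_one)
      then show ?thesis using r by (simp add: add_increasing2)
    next
      case False
      have "inverse (cmod z) ^ nat (- n) \<le> inverse r ^ nat (- n)"
        using z' r by (intro power_mono le_imp_inverse_le) auto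
      then have "cmod z powi n \<le> r powi n" using False by (simp add: power_int_def)
      then show ?thesis by simp
    qed
    have fm: "cmod (?f n) \<le> m n" for n
      using zp[of n] wt_pos[of n] by (simp add: m_def norm_mult norm_power_int mult.assoc mult_left_mono)
    have fs: "?f summable_on UNIV" by (rule geo_decay_summable[OF lsum_geo[OF assms(1) z']])
    have fs': "?f summable_on - ?I" and ms': "m summable_on - ?I"
      by (rule summable_on_subset_banach[OF fs], simp) (rule summable_on_subset_banach[OF ms], simp)
    have split: "infsum h UNIV = sum h ?I + infsum h (- ?I)" if "h summable_on - ?I" for h :: "int \<Rightarrow> 'b::banach"
    proof -
      have "infsum h (?I \<union> - ?I) = infsum h ?I + infsum h (- ?I)"
        by (rule infsum_Un_disjoint) (use that in auto)
      then show ?thesis by (simp add: Un_commute)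
    qed
    have "lsum u z - psum u N z = infsum ?f (- ?I)"
      unfolding lsum_def psum_def using split[OF fs'] by (simp add: mult.assoc)
    also have "cmod \<dots> \<le> infsum (\<lambda>n. cmod (?f n)) (- ?I)"
      using fs' by (intro norm_infsum_bound) (simp only: summable_on_iff_abs_summable_on_complex)
    also have "\<dots> \<le> infsum m (- ?I)"
      using fs' ms' fm by (intro infsum_mono) (simp_all only: summable_on_iff_abs_summable_on_complex)
    also have "\<dots> < \<epsilon>" using split[OF ms'] N by simp
    finally show "cmod (lsum u z - psum u N z) < \<epsilon>" .
  qed
qed

lemma lsum_pa_lower_bound:
  "\<exists>\<mu>>0. \<forall>z\<in>closed_annulus r. \<mu> \<le> cmod (lsum pa z)"
proof -
  have nz': "z \<noteq> 0" if "z \<in> closed_annulus r" for z using that r by (auto simp: closed_annulus_def)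
  have "continuous_on (closed_annulus r) (lsum pa)"
  proof (rule uniform_limit_theorem)
    show "uniform_limit (closed_annulus r) (psum pa) (lsum pa) sequentially"
      unfolding uniform_limit_iff
    proof (intro allI impI)
      fix e :: real assume "e > 0"
      then show "\<forall>\<^sub>F N in sequentially. \<forall>z\<in>closed_annulus r. dist (psum pa N z) (lsum pa z) < e"
        using psum_uniform[of pa e] by (simp add: dist_norm norm_minus_commute)
    qed
    show "\<forall>\<^sub>F N in sequentially. continuous_on (closed_annulus r) (psum pa N)"
      unfolding psum_def using nz' by (intro always_eventually allI continuous_intros) auto
  qed simp
  then have c: "continuous_on (closed_annulus r) (\<lambda>z. cmod (lsum pa z))" by (intro continuous_intros)
  have "a \<in> closed_annulus r" using a by (simp add: closed_annulus_def)
  then obtain z0 where z0: "z0 \<in> closed_annulus r" "\<And>z. z \<in> closed_annulus r \<Longrightarrow> cmod (lsum pa z0) \<le> cmod (lsum pa z)"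
    using continuous_attains_inf[OF compact_closed_annulus _ c] by blast
  moreover have "cmod (lsum pa z0) > 0" using z0(1) lsum_pa_nz by (simp add: closed_annulus_def)
  ultimately show ?thesis by blast
qed

text \<open>On the boundary the limit quotient has the constant modulus \<open>R\<close>, and
  uniform convergence carries this over to the truncations up to \<epsilon>; the maximum principle,
  applied to quotients of polynomials, then spreads the bound to the whole annulus.\<close>

lemma psum_ratio_bound:
  assumes "\<epsilon> > 0"
  shows "eventually (\<lambda>N. \<forall>z\<in>closed_annulus r. psum pa N z \<noteq> 0 \<and>
    cmod (psum ee N z / psum pa N z) \<le> sqrt (NN / Kaa) + \<epsilon>) sequentially"
proof -
  obtain \<mu> where \<mu>: "\<mu> > 0" "\<And>z. z \<in> closed_annulus r \<Longrightarrow> \<mu> \<le> cmod (lsum pa z)"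
    using lsum_pa_lower_bound by blast
  define R where "R = sqrt (NN / Kaa)"
  have R0: "R \<ge> 0" unfolding R_def using NN_pos Kaa_pos by simp
  \<comment> \<open>The first bound keeps the truncated denominator above \<open>\<mu> / 2\<close>;
    the second makes the error \<open>(R + 1) * \<delta>\<close> at most \<epsilon> times that
    denominator.\<close>
  define \<delta> where "\<delta> = min (\<mu> / 2) (\<epsilon> * \<mu> / (2 * (R + 1)))"
  have \<delta>: "\<delta> > 0" unfolding \<delta>_def using \<mu>(1) assms R0 by simp
  have \<delta>2: "\<delta> \<le> \<mu> / 2" "\<delta> \<le> \<epsilon> * \<mu> / (2 * (R + 1))"
    unfolding \<delta>_def by (rule min.cobounded1, rule min.cobounded2)
  have \<delta>': "(R + 1) * \<delta> \<le> \<epsilon> * (\<mu> / 2)" using \<delta>2(2) R0 by (simp add: field_simps)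
  have "eventually (\<lambda>N. (\<forall>z\<in>closed_annulus r. cmod (lsum pa z - psum pa N z) < \<delta>)
      \<and> (\<forall>z\<in>closed_annulus r. cmod (lsum ee z - psum ee N z) < \<delta>)) sequentially"
    by (intro eventually_conj psum_uniform \<delta>) auto
  then show ?thesis
  proof (rule eventually_mono)
    fix N assume N: "(\<forall>z\<in>closed_annulus r. cmod (lsum pa z - psum pa N z) < \<delta>)
      \<and> (\<forall>z\<in>closed_annulus r. cmod (lsum ee z - psum ee N z) < \<delta>)"
    have low: "\<mu> / 2 \<le> cmod (psum pa N z)" if "z \<in> closed_annulus r" for z
    proof -
      have "\<mu> \<le> cmod (lsum pa z)" "cmod (lsum pa z - psum pa N z) < \<delta>" using \<mu>(2) N that by auto
      then show ?thesis using \<delta>2(1) norm_triangle_ineq2[of "lsum pa z" "psum pa N z"] by linarith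
    qed
    then have nzN: "psum pa N z \<noteq> 0" if "z \<in> closed_annulus r" for z using that \<mu>(1) by fastforce
    have bd: "cmod (psum ee N z / psum pa N z) \<le> R + \<epsilon>" if z: "cmod z = 1 \<or> cmod z = r" for z
    proof -
      have zc: "z \<in> closed_annulus r" using z r by (auto simp: closed_annulus_def)
      have "Kaa * (cmod (lsum ee z))\<^sup>2 = NN * (cmod (lsum pa z))\<^sup>2" by (rule boundary_identity[OF z])
      then have "(cmod (lsum ee z))\<^sup>2 = NN / Kaa * (cmod (lsum pa z))\<^sup>2" using Kaa_pos by (simp add: field_simps)
      then have "cmod (lsum ee z) = sqrt (NN / Kaa * (cmod (lsum pa z))\<^sup>2)"
        by (metis norm_ge_zero real_sqrt_unique)
      also have "\<dots> = R * cmod (lsum pa z)" unfolding R_def real_sqrt_mult by simp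
      finally have "cmod (lsum ee z) = R * cmod (lsum pa z)" .
      moreover have "cmod (psum ee N z) \<le> cmod (lsum ee z) + \<delta>"
        using N zc norm_triangle_ineq2[of "psum ee N z" "lsum ee z"]
        by (smt (verit, best) norm_minus_commute)
      moreover have "cmod (lsum pa z) \<le> cmod (psum pa N z) + \<delta>"
        using N zc norm_triangle_ineq2[of "lsum pa z" "psum pa N z"] by (smt (verit, best))
      ultimately have "cmod (psum ee N z) \<le> R * (cmod (psum pa N z) + \<delta>) + \<delta>"
        using mult_left_mono[OF _ R0] by (smt (verit, best))
      also have "\<dots> = R * cmod (psum pa N z) + (R + 1) * \<delta>" by (simp add: algebra_simps)
      also have "\<dots> \<le> R * cmod (psum pa N z) + \<epsilon> * cmod (psum pa N z)"
        using order_trans[OF \<delta>' mult_left_mono[OF low[OF zc], of \<epsilon>]] assms by simp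
      finally show ?thesis using nzN[OF zc] by (simp add: norm_divide divide_le_eq algebra_simps)
    qed
    show "\<forall>z\<in>closed_annulus r. psum pa N z \<noteq> 0 \<and> cmod (psum ee N z / psum pa N z) \<le> sqrt (NN / Kaa) + \<epsilon>"
    proof (intro ballI conjI)
      fix z assume z: "z \<in> closed_annulus r"
      then show "psum pa N z \<noteq> 0" by (rule nzN)
      let ?p = "\<lambda>u z. poly (laurent_poly (\<lambda>n. of_real (wt n) * cnj (u n)) N) z"
      have p: "?p u z = z ^ N * psum u N z" if "z \<noteq> 0" for u z
        unfolding psum_def using poly_laurent_poly[OF that] by blast
      have pq: "?p ee z / ?p pa z = psum ee N z / psum pa N z" if "z \<noteq> 0" for z
        unfolding p[OF that] using that by simp
      have z0: "z \<noteq> 0" if "z \<in> closed_annulus r" for z using that r by (auto simp: closed_annulus_def)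
      have "cmod (?p ee z / ?p pa z) \<le> R + \<epsilon>"
      proof (rule closed_annulus_max_modulus[OF r _ _ _ _ z])
        show "?p ee holomorphic_on UNIV" "?p pa holomorphic_on UNIV"
          by (intro holomorphic_intros)+
        show "?p pa z \<noteq> 0" if "z \<in> closed_annulus r" for z
          using nzN[OF that] p[OF z0[OF that], of pa] z0[OF that] by simp
        show "cmod (?p ee z / ?p pa z) \<le> R + \<epsilon>" if "cmod z = 1 \<or> cmod z = r" for z
        proof -
          have z0': "z \<noteq> 0" using that r by auto
          show ?thesis unfolding pq[OF z0'] by (rule bd[OF that])
        qed
      qed
      then show "cmod (psum ee N z / psum pa N z) \<le> sqrt (NN / Kaa) + \<epsilon>"
        using pq[OF z0[OF z]] by (simp add: R_def)
    qed
  qed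
qed

text \<open>The condition is tested on truncations of \<open>lsum ee / lsum pa\<close>. In the limit
  the second row of the resulting matrix is \<open>\<gamma>\<close> and \<open>a - b\<close>, each
  times \<open>NN / Kaa\<close>, while the supremum tends to \<open>sqrt (NN / Kaa)\<close>.\<close>

lemma spectral_inequality:
  assumes "Ar_contraction_mat r (m22 b 0 \<gamma> a)"
  shows "(cmod \<gamma>)\<^sup>2 + (cmod (a - b))\<^sup>2 \<le> Kaa / NN"
proof -
  let ?c = "\<lambda>u n. of_real (wt n) * cnj (u n)"
  let ?p = "\<lambda>u N. laurent_poly (?c u) N"
  define R where "R = sqrt (NN / Kaa)"
  have R0: "R \<ge> 0" unfolding R_def using NN_pos Kaa_pos by simp
  have z0: "z \<noteq> 0" if "z \<in> closed_annulus r" for z using that r by (auto simp: closed_annulus_def)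
  have ac: "a \<in> closed_annulus r" and bc: "b \<in> closed_annulus r" using a b by (auto simp: closed_annulus_def)
  let ?dS = "\<lambda>u N. \<Sum>n\<in>{- int N..int N}. ?c u n * hh n"
  define X where "X N = psum ee N a / psum pa N a" for N
  define Y where "Y N = \<gamma> * (?dS ee N * psum pa N a - psum ee N a * ?dS pa N) / (psum pa N a * psum pa N b)" for N
  have lim_S: "(\<lambda>N. psum u N z) \<longlonglongrightarrow> lsum u z" if "u \<in> {pa, ee}" "z \<in> closed_annulus r" for u z
  proof -
    have "?c u n * z powi n = of_real (wt n) * (cnj (u n) * z powi n)" for n by (simp add: mult.assoc)
    then show ?thesis unfolding lsum_def psum_def
      using symmetric_sums_tendsto[OF geo_decay_summable[OF lsum_geo[OF that(1), of z]]] that(2)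
      by (simp add: closed_annulus_def mult.assoc)
  qed
  have lim_d: "(\<lambda>N. ?dS u N) \<longlonglongrightarrow> form 1 hh u" if "u \<in> {pa, ee}" for u
  proof -
    have eq: "?c u n * hh n = of_real (wt n) ^ 1 * (hh n * cnj (u n))" for n by simp
    show ?thesis unfolding form_def eq
      by (rule symmetric_sums_tendsto[OF ee_summable]) (use that in auto)
  qed
  have l_form: "lsum u a = form 1 pa u" "lsum u b = form 1 pb u" for u
    unfolding lsum_def form_def by (simp_all add: mult.commute)
  have pa_nz: "lsum pa a \<noteq> 0" "lsum pa b \<noteq> 0" using lsum_pa_nz a b by auto
  have limX: "X \<longlonglongrightarrow> (a - b) * of_real (NN / Kaa)"
  proof -
    have "X \<longlonglongrightarrow> lsum ee a / lsum pa a"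
      unfolding X_def by (intro tendsto_intros lim_S pa_nz ac) auto
    then show ?thesis unfolding l_form form_pa_ee Kaa_form by simp
  qed
  have limY: "Y \<longlonglongrightarrow> \<gamma> * of_real (NN / Kaa)"
  proof -
    have "Y \<longlonglongrightarrow> \<gamma> * (form 1 hh ee * lsum pa a - lsum ee a * form 1 hh pa) / (lsum pa a * lsum pa b)"
      unfolding Y_def by (intro tendsto_intros lim_S lim_d ac bc) (use pa_nz in auto)
    moreover have "\<gamma> * (form 1 hh ee * lsum pa a - lsum ee a * form 1 hh pa) / (lsum pa a * lsum pa b)
      = \<gamma> * of_real (NN / Kaa)"
    proof -
      \<comment> \<open>Since the quotient vanishes at \<open>b\<close>, its divided difference
        should be \<open>NN / Kaa\<close>. Writing \<open>pb\<close> through \<open>pa\<close> and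
        \<open>hh\<close> proves this without dividing by \<open>a - b\<close>.\<close>
      have "pb = (\<lambda>n. 1 * pa n + (- (a - b)) * hh n)"
        unfolding mult_minus_left dpow_mult_diff by simp
      then have "lsum pa b = form 1 (\<lambda>n. 1 * pa n + (- (a - b)) * hh n) pa" unfolding l_form by simp
      also have "\<dots> = 1 * form 1 pa pa + (- (a - b)) * form 1 hh pa" by (rule form_add_left) auto
      finally have B: "lsum pa b = of_real Kaa - (a - b) * form 1 hh pa" unfolding Kaa_form mult_minus_left by simp
      have "form 1 hh ee * lsum pa a - lsum ee a * form 1 hh pa = of_real NN * lsum pa b"
        unfolding B unfolding l_form form_hh_ee Kaa_form form_pa_ee by (simp add: algebra_simps)
      then show ?thesis using pa_nz Kaa_form l_form(1)[of pa] by (simp del: One_nat_def)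
    qed
    ultimately show ?thesis by simp
  qed
  have main: "(cmod \<gamma> * (NN / Kaa))\<^sup>2 + (cmod (a - b) * (NN / Kaa))\<^sup>2 \<le> (R + \<epsilon>)\<^sup>2" if "\<epsilon> > 0" for \<epsilon>
  proof -
    have "eventually (\<lambda>N. (cmod (Y N))\<^sup>2 + (cmod (X N))\<^sup>2 \<le> (R + \<epsilon>)\<^sup>2) sequentially"
      using psum_ratio_bound[OF that]
    proof (rule eventually_mono)
      fix N assume N: "\<forall>z\<in>closed_annulus r. psum pa N z \<noteq> 0 \<and> cmod (psum ee N z / psum pa N z) \<le> sqrt (NN / Kaa) + \<epsilon>"
      have p: "poly (?p u N) z = z ^ N * psum u N z" if "z \<in> closed_annulus r" for u z
        unfolding psum_def by (rule poly_laurent_poly[OF z0[OF that]])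
      have zf: "\<forall>z\<in>closed_annulus r. poly (?p pa N) z \<noteq> 0"
        using N z0 p[of _ pa] by (metis mult_eq_0_iff power_not_zero)
      let ?A = "mat_rat (?p ee N) (?p pa N) (m22 b 0 \<gamma> a)"
      have "mat_norm ?A \<le> (SUP z\<in>closed_annulus r. cmod (poly (?p ee N) z / poly (?p pa N) z))"
        using assms zf unfolding Ar_contraction_mat_def by blast
      also have "\<dots> \<le> R + \<epsilon>"
      proof (rule cSUP_least)
        show "closed_annulus r \<noteq> {}" using ac by blast
        fix z assume z: "z \<in> closed_annulus r"
        have "poly (?p ee N) z / poly (?p pa N) z = psum ee N z / psum pa N z"
          unfolding p[OF z] using z0[OF z] by simp
        then show "cmod (poly (?p ee N) z / poly (?p pa N) z) \<le> R + \<epsilon>" using N z unfolding R_def by simp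
      qed
      finally have "mat_norm ?A \<le> R + \<epsilon>" .
      moreover have "0 \<le> mat_norm ?A" unfolding mat_norm_def
        by (intro onorm_pos_le linear_conv_bounded_linear[THEN iffD1] linearI)
           (simp_all add: matrix_vector_mult_def vec_eq_iff sum.distrib algebra_simps scaleR_sum_right)
      ultimately have "(mat_norm ?A)\<^sup>2 \<le> (R + \<epsilon>)\<^sup>2" by (intro power_mono)
      moreover have "?A $ 2 $ 2 = X N" "?A $ 2 $ 1 = Y N"
        using mat_rat_laurent_poly[OF nz(1,2), where N = N and d = "?c pa" and c = "?c ee" and g = \<gamma>, OF _ _ refl refl] N ac bc
        unfolding X_def Y_def psum_def by blast+
      ultimately show "(cmod (Y N))\<^sup>2 + (cmod (X N))\<^sup>2 \<le> (R + \<epsilon>)\<^sup>2"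
        using mat_norm_row[of ?A 2] by simp
    qed
    moreover have "(\<lambda>N. (cmod (Y N))\<^sup>2 + (cmod (X N))\<^sup>2)
      \<longlonglongrightarrow> (cmod (\<gamma> * of_real (NN / Kaa)))\<^sup>2 + (cmod ((a - b) * of_real (NN / Kaa)))\<^sup>2"
      by (intro tendsto_intros limX limY)
    ultimately have "(cmod (\<gamma> * of_real (NN / Kaa)))\<^sup>2 + (cmod ((a - b) * of_real (NN / Kaa)))\<^sup>2 \<le> (R + \<epsilon>)\<^sup>2"
      by (intro tendsto_upperbound[of _ _ sequentially]) auto
    then show ?thesis using NN_pos Kaa_pos by (simp only: norm_mult norm_of_real) simp
  qed
  let ?T = "(cmod \<gamma> * (NN / Kaa))\<^sup>2 + (cmod (a - b) * (NN / Kaa))\<^sup>2"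
  have "sqrt ?T \<le> R"
  proof (rule field_le_epsilon)
    fix e :: real assume "e > 0"
    then show "sqrt ?T \<le> R + e" using main[of e] R0 by (intro real_le_lsqrt) auto
  qed
  then have "?T \<le> R\<^sup>2" by (rule sqrt_le_D)
  also have "R\<^sup>2 = NN / Kaa" unfolding R_def using NN_pos Kaa_pos by simp
  finally have "((cmod \<gamma>)\<^sup>2 + (cmod (a - b))\<^sup>2) * (NN / Kaa)\<^sup>2 \<le> NN / Kaa"
    unfolding power_mult_distrib distrib_right .
  then have "((cmod \<gamma>)\<^sup>2 + (cmod (a - b))\<^sup>2) * (NN / Kaa) * (NN / Kaa) \<le> 1 * (NN / Kaa)"
    unfolding power2_eq_square[of "NN / Kaa"] by (simp only: mult.assoc mult_1_left)
  then have "((cmod \<gamma>)\<^sup>2 + (cmod (a - b))\<^sup>2) * (NN / Kaa) \<le> 1"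
    by (rule mult_right_le_imp_le) (use NN_pos Kaa_pos in simp)
  then show ?thesis using NN_pos Kaa_pos by (simp add: field_simps)
qed

end

section \<open>Models in one variable\<close>


text \<open>Square summability over any index type, since the models live on labelled integers; the
  transfer to \<open>nat\<close> happens once, in \<open>tensor_model\<close>.\<close>

definition sqs :: "('x \<Rightarrow> complex) \<Rightarrow> bool" where
  "sqs v \<longleftrightarrow> (\<lambda>x. (cmod (v x))\<^sup>2) summable_on UNIV"

lemma sqs_mult_summable:
  assumes "sqs u" "sqs v"
  shows "(\<lambda>x. u x * v x) summable_on UNIV"
proof -
  have "(\<lambda>x. norm (u x * v x)) summable_on UNIV"
  proof (rule Infinite_Sum.abs_summable_product)
    show "(\<lambda>x. norm (u x * u x)) summable_on UNIV" "(\<lambda>x. norm (v x * v x)) summable_on UNIV"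
      using assms by (simp_all add: sqs_def norm_mult power2_eq_square)
  qed
  then show ?thesis by (rule Infinite_Sum.abs_summable_summable)
qed

lemma sqs_reindex: "bij f \<Longrightarrow> sqs (\<lambda>x. v (f x)) \<longleftrightarrow> sqs v"
  unfolding sqs_def by (rule summable_on_reindex_bij_betw) auto

lemma sqs_bounded_mult:
  assumes "sqs v" "\<And>x. cmod (s x) \<le> K"
  shows "sqs (\<lambda>x. s x * v x)"
  unfolding sqs_def
proof (rule summable_on_comparison_test)
  show "(\<lambda>x. K\<^sup>2 * (cmod (v x))\<^sup>2) summable_on UNIV"
    using assms(1) unfolding sqs_def by (rule summable_on_cmult_right)
  show "(cmod (s x * v x))\<^sup>2 \<le> K\<^sup>2 * (cmod (v x))\<^sup>2" for x
    using assms(2)[of x] unfolding norm_mult power_mult_distrib by (intro mult_right_mono power_mono) auto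
qed auto

lemma sqs_cnj: "sqs v \<Longrightarrow> sqs (\<lambda>x. cnj (v x))"
  by (simp add: sqs_def)

lemma summable_on_finite_labels:
  fixes f :: "int \<times> 'l::finite \<Rightarrow> 'b::banach"
  assumes "\<And>l. (\<lambda>n. norm (f (n, l))) summable_on UNIV"
  shows "f summable_on UNIV" "(\<lambda>x. norm (f x)) summable_on UNIV" "infsum f UNIV = (\<Sum>l\<in>UNIV. infsum (\<lambda>n. f (n, l)) UNIV)"
proof -
  have bij: "bij (prod.swap :: 'l \<times> int \<Rightarrow> _)" by (rule bij_swap)
  have "(\<lambda>x. norm ((\<lambda>x. f (prod.swap x)) x)) summable_on (UNIV :: 'l set) \<times> UNIV"
    unfolding Infinite_Sum.abs_summable_on_Sigma_iff using assms by (auto intro: summable_on_finite)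
  then have *: "(\<lambda>x. norm (f (prod.swap x))) summable_on (UNIV :: ('l \<times> int) set)" by simp
  then have s: "(\<lambda>x. f (prod.swap x)) summable_on (UNIV :: ('l \<times> int) set)"
    by (rule Infinite_Sum.abs_summable_summable)
  show "f summable_on UNIV" using s summable_on_reindex_bij_betw[OF bij, of f] by simp
  show "(\<lambda>x. norm (f x)) summable_on UNIV"
    using * summable_on_reindex_bij_betw[OF bij, of "\<lambda>x. norm (f x)"] by simp
  have "infsum f UNIV = infsum (\<lambda>x. f (prod.swap x)) (UNIV \<times> UNIV)"
    using infsum_reindex_bij_betw[OF bij, of f] by simp
  also have "\<dots> = infsum (\<lambda>l. infsum (\<lambda>n. f (prod.swap (l, n))) UNIV) UNIV"
    using infsum_Sigma_banach[of "\<lambda>x. f (prod.swap x)" UNIV "\<lambda>_. UNIV"] s by simp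
  finally show "infsum f UNIV = (\<Sum>l\<in>UNIV. infsum (\<lambda>n. f (n, l)) UNIV)" by simp
qed

definition lshift :: "('l \<Rightarrow> int) \<Rightarrow> int \<Rightarrow> int \<times> 'l \<Rightarrow> int \<times> 'l" where
  "lshift e k x = (fst x - k * e (snd x), snd x)"

text \<open>The inner product of \<open>S^k v\<close> with \<open>v'\<close>, linear in
  \<open>v\<close> unlike \<open>l2_inner\<close>, where \<open>S\<close> maps \<open>v\<close> to
  the function \<open>s l * v (n - e l, l)\<close> of \<open>(n, l)\<close>.\<close>

definition gram :: "('l \<Rightarrow> complex) \<Rightarrow> ('l \<Rightarrow> int) \<Rightarrow> (int \<times> 'l \<Rightarrow> complex) \<Rightarrow> (int \<times> 'l \<Rightarrow> complex) \<Rightarrow> int \<Rightarrow> complex" where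
  "gram s e v v' k = (\<Sum>\<^sub>\<infinity>x. s (snd x) powi k * v (lshift e k x) * cnj (v' x))"

lemma bij_lshift: "bij (lshift e k)"
  by (rule bij_betw_byWitness[where f' = "lshift e (- k)"]) (auto simp: lshift_def)

lemma gram_summable:
  fixes v v' :: "int \<times> 'l::finite \<Rightarrow> complex"
  assumes "sqs v" "sqs v'"
  shows "(\<lambda>x. s (snd x) powi k * v (lshift e k x) * cnj (v' x)) summable_on UNIV"
proof -
  have "cmod (s (snd x) powi k) \<le> (\<Sum>l\<in>UNIV. cmod (s l powi k))" for x :: "int \<times> 'l"
    by (intro member_le_sum) auto
  moreover have "sqs (\<lambda>x. v (lshift e k x))" using assms(1) sqs_reindex[OF bij_lshift] by blast
  ultimately have "sqs (\<lambda>x. s (snd x) powi k * v (lshift e k x))" by (intro sqs_bounded_mult)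
  then show ?thesis using assms(2) by (intro sqs_mult_summable sqs_cnj)
qed

lemma sqs_labels:
  fixes v :: "int \<times> 'l::finite \<Rightarrow> complex"
  shows "sqs v \<longleftrightarrow> (\<forall>l. sqs (\<lambda>n. v (n, l)))"
proof
  assume v: "sqs v"
  show "\<forall>l. sqs (\<lambda>n. v (n, l))"
  proof
    fix l
    have "(\<lambda>x. (cmod (v x))\<^sup>2) summable_on range (\<lambda>n. (n, l))"
      using v unfolding sqs_def by (rule summable_on_subset_banach) auto
    then show "sqs (\<lambda>n. v (n, l))"
      unfolding sqs_def using summable_on_reindex[of "\<lambda>n. (n, l)" UNIV "\<lambda>x. (cmod (v x))\<^sup>2"]
      by (simp add: inj_def o_def)
  qed
next
  assume "\<forall>l. sqs (\<lambda>n. v (n, l))"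
  then show "sqs v" unfolding sqs_def
    by (intro summable_on_finite_labels(1)) simp
qed

lemma gram_labels:
  fixes v v' :: "int \<times> 'l::finite \<Rightarrow> complex"
  assumes "sqs v" "sqs v'"
  shows "gram s e v v' k = (\<Sum>l\<in>UNIV. (\<Sum>\<^sub>\<infinity>n. s l powi k * v (n - k * e l, l) * cnj (v' (n, l))))"
proof -
  let ?f = "\<lambda>x. s (snd x) powi k * v (lshift e k x) * cnj (v' x)"
  have "?f summable_on UNIV" by (rule gram_summable[OF assms])
  then have n: "(\<lambda>x. norm (?f x)) summable_on UNIV"
    using summable_on_iff_abs_summable_on_complex[of ?f UNIV] by simp
  have "(\<lambda>n. norm (?f (n, l))) summable_on UNIV" for l
  proof -
    have "(\<lambda>x. norm (?f x)) summable_on range (\<lambda>n. (n, l))"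
      using n by (rule summable_on_subset_banach) auto
    then show ?thesis
      using summable_on_reindex[of "\<lambda>n. (n, l)" UNIV "\<lambda>x. norm (?f x)"] by (simp add: inj_def o_def)
  qed
  from summable_on_finite_labels(3)[of ?f, OF this] show ?thesis
    by (simp add: gram_def lshift_def)
qed

text \<open>In a label \<open>(l, \<mu>)\<close> the component \<open>l\<close> distinguishes the two boundary circles and \<open>\<mu>\<close> two copies of the
  model; \<open>e = 0\<close> in \<open>lshift\<close> serves points on the boundary, where the operator acts as a scalar. The index
  \<open>p\<close> of \<open>v p\<close> numbers the basis vectors of \<open>\<complex>\<^sup>2\<close>.\<close>

definition coord_model ::
  "real \<Rightarrow> (bool \<times> bool \<Rightarrow> complex) \<Rightarrow> (bool \<times> bool \<Rightarrow> int) \<Rightarrow> (bool \<Rightarrow> int \<times> bool \<times> bool \<Rightarrow> complex)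
    \<Rightarrow> (bool \<Rightarrow> bool \<Rightarrow> int \<Rightarrow> complex) \<Rightarrow> bool" where
  "coord_model r s e v G \<longleftrightarrow> (\<forall>l. cmod (s l) = 1 \<or> cmod (s l) = r) \<and> (\<forall>p. sqs (v p)) \<and>
     (\<forall>p p' k. gram s e (v p) (v p') k = G p p' k)"

lemma UNIV_bool_bool: "(UNIV :: (bool \<times> bool) set) = {(False, False), (False, True), (True, False), (True, True)}"
  by auto

context annulus_pair
begin

text \<open>The Fourier coefficients, on the two circles, of the Laurent series that
  \<open>u\<close> stands for. The label \<open>True\<close> is the inner circle: restriction to
  radius \<open>r\<close> brings the factor \<open>r powi n\<close>, its weight \<open>t\<close> the
  factor \<open>sqrt t\<close>. There multiplication by \<open>z\<close> becomes \<open>r\<close>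
  times the shift, which explains \<open>wts\<close>.\<close>

definition emb :: "(int \<Rightarrow> complex) \<Rightarrow> int \<times> bool \<Rightarrow> complex" where
  "emb u x = of_real (wt (fst x)) * cnj (u (fst x)) * (if snd x then of_real (sqrt t * r powi fst x) else 1)"

definition wts :: "bool \<Rightarrow> complex" where "wts l = (if l then of_real r else 1)"

lemma emb_sqs:
  assumes "u \<in> {pa, pb, hh, ee}"
  shows "sqs (emb u)"
  unfolding sqs_labels
proof
  fix l
  have S: "(\<lambda>n. of_real (wt n) ^ 1 * (u n * cnj (u n))) summable_on UNIV"
    by (rule ee_summable) (use assms in auto)
  have eq: "of_real (wt n) ^ 1 * (u n * cnj (u n)) = complex_of_real (wt n * (cmod (u n))\<^sup>2)" for n
    by (simp add: complex_norm_square[symmetric])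
  have S': "(\<lambda>n. wt n * (cmod (u n))\<^sup>2) summable_on UNIV"
    by (rule infsum_complex_of_real(1)) (use S in \<open>simp only: eq\<close>)
  show "sqs (\<lambda>n. emb u (n, l))"
    unfolding sqs_def
  proof (rule summable_on_comparison_test[OF S'])
    fix n
    have "wt n * (1 + t * (r\<^sup>2) powi n) = 1"
    proof -
      have "1 + t * (r\<^sup>2) powi n > 0" using t_pos r2_range by (simp add: add_pos_pos)
      then show ?thesis by (simp add: wt_def)
    qed
    moreover have "(cmod (emb u (n, l)))\<^sup>2 \<le> (wt n)\<^sup>2 * (cmod (u n))\<^sup>2 * (1 + t * (r\<^sup>2) powi n)"
    proof -
      have "(sqrt t * r powi n)\<^sup>2 = t * (r\<^sup>2) powi n"
        using t_pos by (simp add: power_mult_distrib power2_eq_square[of "r powi n"] power2_eq_square[of r] power_int_mult_distrib)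
      then have "(cmod (if l then complex_of_real (sqrt t * r powi n) else 1))\<^sup>2 \<le> 1 + t * (r\<^sup>2) powi n"
        using t_pos r2_range unfolding norm_of_real if_distrib[of cmod] by (auto simp: zero_less_power_int less_imp_le)
      then show ?thesis
        unfolding emb_def norm_mult power_mult_distrib using wt_pos[of n]
        by (intro mult_mono) auto
    qed
    moreover have "(wt n)\<^sup>2 * (cmod (u n))\<^sup>2 * (1 + t * (r\<^sup>2) powi n)
        = wt n * (cmod (u n))\<^sup>2 * (wt n * (1 + t * (r\<^sup>2) powi n))"
      by (simp only: power2_eq_square[of "wt n"] ac_simps)
    ultimately show "(cmod (emb u (n, l)))\<^sup>2 \<le> wt n * (cmod (u n))\<^sup>2" by simp
  qed auto
qed

text \<open>The weights of the two circles add up to \<open>1 / wt n\<close>, which cancels one of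
  the two factors \<open>wt\<close>. In terms of sequences the adjoint of multiplication by
  \<open>z\<close> is the shift of \<open>u'\<close>.\<close>

lemma gram_emb:
  assumes "u \<in> {pa, pb, hh, ee}" "u' \<in> {pa, pb, hh, ee}"
  shows "gram wts (\<lambda>_. 1) (emb u) (emb u') k = form 1 (\<lambda>n. u' (n + k)) u"
proof -
  let ?f = "\<lambda>l n. wts l powi k * emb u (n - k * 1, l) * cnj (emb u' (n, l))"
  have S: "(\<lambda>n. ?f l n) summable_on UNIV" for l
  proof -
    have "sqs (\<lambda>n. emb u (n, l))" "sqs (\<lambda>n. emb u' (n, l))"
      using emb_sqs[OF assms(1)] emb_sqs[OF assms(2)] sqs_labels by blast+
    moreover have "bij (\<lambda>n::int. n - k * 1)" by (rule bij_betw_byWitness[where f' = "\<lambda>n. n + k"]) auto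
    ultimately have "sqs (\<lambda>n. emb u (n - k * 1, l))"
      using sqs_reindex[of "\<lambda>n::int. n - k * 1" "\<lambda>n. emb u (n, l)"] by blast
    then have "sqs (\<lambda>n. wts l powi k * emb u (n - k * 1, l))" by (rule sqs_bounded_mult[OF _ order_refl])
    then show ?thesis using \<open>sqs (\<lambda>n. emb u' (n, l))\<close> by (intro sqs_mult_summable sqs_cnj)
  qed
  have "gram wts (\<lambda>_. 1) (emb u) (emb u') k = infsum (?f False) UNIV + infsum (?f True) UNIV"
    by (subst gram_labels[OF emb_sqs[OF assms(1)] emb_sqs[OF assms(2)]]) (simp add: UNIV_bool add.commute)
  also have "\<dots> = infsum (\<lambda>n. ?f False n + ?f True n) UNIV"
    using S[of False] S[of True] by (rule infsum_add[symmetric])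
  also have "\<dots> = infsum (\<lambda>n. of_real (wt (n - k)) * (u' n * cnj (u (n - k)))) UNIV"
  proof (rule infsum_cong)
    fix n
    have w: "wt n * (1 + t * (r\<^sup>2) powi n) = 1"
    proof -
      have "1 + t * (r\<^sup>2) powi n > 0" using t_pos r2_range by (simp add: add_pos_pos)
      then show ?thesis by (simp add: wt_def)
    qed
    have rk: "r powi k * r powi (n - k) * r powi n = (r\<^sup>2) powi n"
      using r by (simp add: power_int_diff power2_eq_square power_int_mult_distrib)
    have "?f True n = of_real (wt (n - k)) * (u' n * cnj (u (n - k))) * of_real (wt n * (sqrt t * sqrt t * (r powi k * r powi (n - k) * r powi n)))"
      by (simp add: emb_def wts_def del: real_sqrt_mult_self)
    also have "\<dots> = of_real (wt (n - k)) * (u' n * cnj (u (n - k))) * of_real (wt n * (t * (r\<^sup>2) powi n))"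
      unfolding rk using t_pos by simp
    finally have T: "?f True n = of_real (wt (n - k)) * (u' n * cnj (u (n - k))) * of_real (wt n * (t * (r\<^sup>2) powi n))" .
    have F: "?f False n = of_real (wt (n - k)) * (u' n * cnj (u (n - k))) * of_real (wt n)"
      by (simp add: emb_def wts_def)
    have "?f False n + ?f True n = of_real (wt (n - k)) * (u' n * cnj (u (n - k))) * of_real (wt n * (1 + t * (r\<^sup>2) powi n))"
      unfolding T F by (simp only: distrib_left of_real_add mult_1_right)
    then show "?f False n + ?f True n = of_real (wt (n - k)) * (u' n * cnj (u (n - k)))"
      unfolding w by simp
  qed
  also have "\<dots> = form 1 (\<lambda>n. u' (n + k)) u"
    unfolding form_def
    using infsum_shift_int[of "\<lambda>n. of_real (wt (n - k)) * (u' n * cnj (u (n - k)))" k] by simp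
  finally show ?thesis .
qed

text \<open>The shift multiplies \<open>pb\<close> by \<open>b\<close>, and by the Leibniz rule it
  maps \<open>ee\<close> into the span of \<open>hh\<close> and \<open>pb\<close>. So in the
  orthogonal basis \<open>pb\<close>, \<open>ee\<close> the compression is lower triangular with
  eigenvalues \<open>b\<close>, \<open>a\<close>.\<close>

lemma gram_emb_values:
  "gram wts (\<lambda>_. 1) (emb pb) (emb pb) k = b powi k * of_real Kbb"
  "gram wts (\<lambda>_. 1) (emb ee) (emb ee) k = a powi k * of_real NN"
  "gram wts (\<lambda>_. 1) (emb ee) (emb pb) k = 0"
  "gram wts (\<lambda>_. 1) (emb pb) (emb ee) k = hh k * ((1 + lam * (a - b)) * of_real Kbb)"
proof -
  have pbk: "(\<lambda>n. pb (n + k)) = (\<lambda>n. b powi k * pb n + 0 * pb n)"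
    using nz by (simp add: fun_eq_iff power_int_add)
  have eek: "(\<lambda>n. ee (n + k)) = (\<lambda>n. a powi k * hh n + (hh k - lam * b powi k) * pb n)"
    using nz by (simp add: fun_eq_iff ee_def dpow_add[OF nz(1,2)] power_int_add algebra_simps)
  have P: "gram wts (\<lambda>_. 1) (emb u) (emb pb) k = b powi k * form 1 pb u" if "u \<in> {pb, ee}" for u
  proof -
    have "gram wts (\<lambda>_. 1) (emb u) (emb pb) k = form 1 (\<lambda>n. pb (n + k)) u"
      by (rule gram_emb) (use that in auto)
    also have "\<dots> = b powi k * form 1 pb u + 0 * form 1 pb u"
      unfolding pbk by (rule form_add_left) (use that in auto)
    finally show ?thesis by simp
  qed
  have E: "gram wts (\<lambda>_. 1) (emb u) (emb ee) k = a powi k * form 1 hh u + (hh k - lam * b powi k) * form 1 pb u"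
    if "u \<in> {pb, ee}" for u
  proof -
    have "gram wts (\<lambda>_. 1) (emb u) (emb ee) k = form 1 (\<lambda>n. ee (n + k)) u"
      by (rule gram_emb) (use that in auto)
    also have "\<dots> = a powi k * form 1 hh u + (hh k - lam * b powi k) * form 1 pb u"
      unfolding eek by (rule form_add_left) (use that in auto)
    finally show ?thesis .
  qed
  show "gram wts (\<lambda>_. 1) (emb pb) (emb pb) k = b powi k * of_real Kbb"
    using P[of pb] unfolding Kbb_form by blast
  show "gram wts (\<lambda>_. 1) (emb ee) (emb pb) k = 0"
    using P[of ee] unfolding form_pb_ee by simp
  show "gram wts (\<lambda>_. 1) (emb ee) (emb ee) k = a powi k * of_real NN"
    using E[of ee] unfolding form_pb_ee form_hh_ee by simp
  have "form 1 hh pb = lam * of_real Kbb" unfolding lam_def Kbb_form using Kbb_pos by simp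
  then have "gram wts (\<lambda>_. 1) (emb pb) (emb ee) k = a powi k * (lam * of_real Kbb) + (hh k - lam * b powi k) * of_real Kbb"
    using E[of pb] unfolding Kbb_form by simp
  also have "\<dots> = (lam * (a powi k - b powi k) + hh k) * of_real Kbb" by (simp add: algebra_simps)
  also have "\<dots> = hh k * ((1 + lam * (a - b)) * of_real Kbb)"
    unfolding dpow_mult_diff[symmetric] by (simp add: algebra_simps)
  finally show "gram wts (\<lambda>_. 1) (emb pb) (emb ee) k = hh k * ((1 + lam * (a - b)) * of_real Kbb)" .
qed

end

lemma gram_split_copies:
  fixes v v' :: "bool \<Rightarrow> int \<times> bool \<Rightarrow> complex"
  assumes "\<And>\<mu>. sqs (v \<mu>)" "\<And>\<mu>. sqs (v' \<mu>)"
  shows "sqs (\<lambda>x. v (snd (snd x)) (fst x, fst (snd x)))"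
    and "gram (\<lambda>l. s (snd l) (fst l)) (\<lambda>l. e (snd l)) (\<lambda>x. v (snd (snd x)) (fst x, fst (snd x))) (\<lambda>x. v' (snd (snd x)) (fst x, fst (snd x))) k
      = gram (s False) (\<lambda>_. e False) (v False) (v' False) k + gram (s True) (\<lambda>_. e True) (v True) (v' True) k"
proof -
  have sv: "sqs (\<lambda>x :: int \<times> bool \<times> bool. w (snd (snd x)) (fst x, fst (snd x)))" if "\<And>\<mu>. sqs (w \<mu>)"
    for w :: "bool \<Rightarrow> int \<times> bool \<Rightarrow> complex"
    using that sqs_labels[of "w _"] unfolding sqs_labels[of "\<lambda>x. w (snd (snd x)) (fst x, fst (snd x))"] by simp
  show "sqs (\<lambda>x. v (snd (snd x)) (fst x, fst (snd x)))" by (rule sv[OF assms(1)])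
  show "gram (\<lambda>l. s (snd l) (fst l)) (\<lambda>l. e (snd l)) (\<lambda>x. v (snd (snd x)) (fst x, fst (snd x))) (\<lambda>x. v' (snd (snd x)) (fst x, fst (snd x))) k
      = gram (s False) (\<lambda>_. e False) (v False) (v' False) k + gram (s True) (\<lambda>_. e True) (v True) (v' True) k"
    unfolding gram_labels[OF assms(1) assms(2)]
    using gram_labels[OF sv[of v, OF assms(1)] sv[of v', OF assms(2)], of "\<lambda>l. s (snd l) (fst l)" "\<lambda>l. e (snd l)" k]
    by (simp add: UNIV_bool_bool UNIV_bool)
qed

lemma gram_scale: "gram s e (\<lambda>x. c * v x) (\<lambda>x. d * v' x) k = c * cnj d * gram s e v v' k"
proof -
  have "s (snd x) powi k * (c * v (lshift e k x)) * cnj (d * v' x) = c * cnj d * (s (snd x) powi k * v (lshift e k x) * cnj (v' x))" for x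
    by simp
  then show ?thesis unfolding gram_def by (simp only: infsum_cmult_right')
qed

lemma gram_0: "gram s e (\<lambda>x. 0) v k = 0" "gram s e v (\<lambda>x. 0) k = 0"
  by (simp_all add: gram_def)

lemma sqs_scale: "sqs v \<Longrightarrow> sqs (\<lambda>x. c * v x)"
  by (rule sqs_bounded_mult[OF _ order_refl])

lemma sqs_0: "sqs (\<lambda>x. 0)"
  by (simp add: sqs_def)

text \<open>For \<open>c\<close> inside the annulus, the normalised kernel of the pair with both
  points equal to \<open>c\<close>; for \<open>c\<close> on the boundary, a single basis vector on
  which the operator is the scalar \<open>c\<close>.\<close>

lemma scalar_model:
  assumes "0 < r" "r < 1" "c \<in> closed_annulus r"
  shows "\<exists>s e v. (\<forall>l. cmod (s l) = 1 \<or> cmod (s l) = r) \<and> sqs (v :: int \<times> bool \<Rightarrow> complex) \<and>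
    (\<forall>k. gram s (\<lambda>_. e) v v k = c powi k)"
proof (cases "cmod c = 1 \<or> cmod c = r")
  case True
  define v :: "int \<times> bool \<Rightarrow> complex" where "v x = (if x = (0, False) then 1 else 0)" for x
  have "sqs v" unfolding sqs_def
    by (rule summable_on_cong_neutral[where T = "{(0, False)}", THEN iffD2]) (auto simp: v_def)
  moreover have "gram (\<lambda>_. c) (\<lambda>_. 0) v v k = c powi k" for k
  proof -
    have "gram (\<lambda>_. c) (\<lambda>_. 0) v v k = infsum (\<lambda>x. c powi k * v x * cnj (v x)) UNIV"
      by (simp add: gram_def lshift_def)
    also have "\<dots> = infsum (\<lambda>x. c powi k * v x * cnj (v x)) {(0, False)}"
      by (rule infsum_cong_neutral) (auto simp: v_def)
    finally show ?thesis by (simp add: v_def)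
  qed
  ultimately show ?thesis using True by (intro exI[of _ "\<lambda>_. c"] exI[of _ "0::int"] exI[of _ v]) auto
next
  case False
  then interpret annulus_pair r c c using assms by unfold_locales (auto simp: closed_annulus_def)
  let ?v = "\<lambda>x. complex_of_real (1 / sqrt Kbb) * emb pb x"
  have "complex_of_real (1 / sqrt Kbb) * cnj (complex_of_real (1 / sqrt Kbb)) * (c powi k * of_real Kbb) = c powi k" for k
    using Kbb_pos by (simp add: field_simps flip: of_real_mult)
  then have "gram wts (\<lambda>_. 1) ?v ?v k = c powi k" for k
    unfolding gram_scale gram_emb_values .
  moreover have "sqs ?v" by (rule sqs_scale[OF emb_sqs]) simp
  moreover have "cmod (wts l) = 1 \<or> cmod (wts l) = r" for l using assms by (simp add: wts_def)
  ultimately show ?thesis by (intro exI[of _ wts] exI[of _ "1::int"] exI[of _ ?v]) blast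
qed

text \<open>Both basis vectors of C^2 get the same vector, so that the off-diagonal Gram entries are
  \<open>c powi k\<close> as well. Anything else would spoil the off-diagonal entry of a triangular
  coordinate in the tensor product.\<close>

lemma coord_model_scalar:
  assumes "0 < r" "r < 1" "c \<in> closed_annulus r"
  shows "\<exists>s e v. coord_model r s e v (\<lambda>p p' k. c powi k)"
proof -
  obtain s e v where s: "\<And>l. cmod (s l) = 1 \<or> cmod (s l) = r" and v: "sqs (v :: int \<times> bool \<Rightarrow> complex)"
    and g: "\<And>k. gram s (\<lambda>_. e) v v k = c powi k"
    using scalar_model[OF assms] by blast
  define w where "w \<mu> = (if \<mu> then (\<lambda>_. 0) else v)" for \<mu> :: bool
  have w: "sqs (w \<mu>)" for \<mu> using v by (simp add: w_def sqs_0)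
  note G = gram_split_copies[of w w, OF w w]
  have "coord_model r (\<lambda>l. s (fst l)) (\<lambda>l. e) (\<lambda>p x. w (snd (snd x)) (fst x, fst (snd x))) (\<lambda>p p' k. c powi k)"
    unfolding coord_model_def using s G(1) G(2)[of "\<lambda>_. s" "\<lambda>_. e"] by (simp add: w_def gram_0 g)
  then show ?thesis by blast
qed

text \<open>The models of the two points are placed in different copies, which makes the vectors
  orthogonal under all powers.\<close>

lemma coord_model_diag:
  assumes "0 < r" "r < 1" "a \<in> closed_annulus r" "b \<in> closed_annulus r"
  shows "\<exists>s e v. coord_model r s e v (\<lambda>p p' k. if p = p' then (if p then a powi k else b powi k) else 0)"
proof -
  have "\<exists>s e v. (\<forall>l. cmod (s l) = 1 \<or> cmod (s l) = r) \<and> sqs (v :: int \<times> bool \<Rightarrow> complex) \<and>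
    (\<forall>k. gram s (\<lambda>_. e) v v k = (if p then a else b) powi k)" for p
    by (rule scalar_model) (use assms in auto)
  then obtain s e v where s: "\<And>p l. cmod (s p l) = 1 \<or> cmod (s p l) = r" and v: "\<And>p. sqs (v p :: int \<times> bool \<Rightarrow> complex)"
    and g: "\<And>p k. gram (s p) (\<lambda>_. e p) (v p) (v p) k = (if p then a else b) powi k"
    by metis
  define w where "w p \<mu> = (if \<mu> = p then v p else (\<lambda>_. 0))" for p \<mu> :: bool
  have w: "sqs (w p \<mu>)" for p \<mu> using v by (simp add: w_def sqs_0)
  have G: "gram (\<lambda>l. s (snd l) (fst l)) (\<lambda>l. e (snd l)) (\<lambda>x. w p (snd (snd x)) (fst x, fst (snd x)))
      (\<lambda>x. w p' (snd (snd x)) (fst x, fst (snd x))) k = (if p = p' then (if p then a powi k else b powi k) else 0)" for p p' k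
    unfolding gram_split_copies(2)[of "w p" "w p'", OF w w] by (cases p; cases p') (simp_all add: w_def gram_0 g)
  have "coord_model r (\<lambda>l. s (snd l) (fst l)) (\<lambda>l. e (snd l)) (\<lambda>p x. w p (snd (snd x)) (fst x, fst (snd x)))
     (\<lambda>p p' k. if p = p' then (if p then a powi k else b powi k) else 0)"
    unfolding coord_model_def using s gram_split_copies(1)[OF w w] G by auto
  then show ?thesis by blast
qed

text \<open>An off-diagonal entry smaller than that of the compression is obtained by tensoring the two basis
  vectors with unit vectors whose inner product is the ratio \<open>g\<close> of the two entries.\<close>

lemma (in annulus_pair) coord_model_triangular:
  assumes "(cmod \<gamma>)\<^sup>2 + (cmod (a - b))\<^sup>2 \<le> Kaa / NN"
  shows "\<exists>s e v. coord_model r s e v (\<lambda>p p' k. if p then (if p' then a powi k else 0)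
    else (if p' then \<gamma> * dpow a b k else b powi k))"
proof -
  define \<sigma> where "\<sigma> = 1 + lam * (a - b)"
  \<comment> \<open>The off-diagonal entry of the compression in the normalised basis;
    \<open>Kaa_eq\<close> turns the hypothesis into
    \<open>cmod \<gamma> \<le> cmod \<gamma>t\<close>.\<close>
  define \<gamma>t where "\<gamma>t = \<sigma> * of_real (sqrt Kbb / sqrt NN)"
  have "(cmod \<gamma>t)\<^sup>2 = (cmod \<sigma>)\<^sup>2 * Kbb / NN"
    unfolding \<gamma>t_def norm_mult norm_of_real using NN_pos Kbb_pos by (simp add: power_mult_distrib power_divide)
  also have "\<dots> = Kaa / NN - (cmod (a - b))\<^sup>2"
    using Kaa_eq NN_pos by (simp add: \<sigma>_def field_simps)
  finally have le: "cmod \<gamma> \<le> cmod \<gamma>t" using assms by (intro power2_le_imp_le[of "cmod \<gamma>"]) auto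
  \<comment> \<open>If \<open>\<gamma>t\<close> vanishes, so does \<gamma>, and the quotient with
    value 0 still satisfies \<open>\<gamma>t * g = \<gamma>\<close>.\<close>
  define g where "g = \<gamma> / \<gamma>t"
  have g1: "cmod g \<le> 1" using le by (auto simp: g_def norm_divide divide_le_eq_1)
  have g2: "\<gamma>t * g = \<gamma>" using le by (auto simp: g_def)
  \<comment> \<open>The unit vector tensored to \<open>ee\<close>; \<open>pb\<close> is tensored
    with the first basis vector. The conjugate on \<open>g\<close> compensates that
    \<open>gram\<close> is antilinear in its second vector.\<close>
  define d where "d \<mu> = (if \<mu> then complex_of_real (sqrt (1 - (cmod g)\<^sup>2)) else cnj g)" for \<mu> :: bool
  have dd: "d False * cnj (d False) + d True * cnj (d True) = 1"
  proof -
    have "1 - (cmod g)\<^sup>2 \<ge> 0" using g1 by (simp add: power_le_one)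
    then have "d True * cnj (d True) = of_real (1 - (cmod g)\<^sup>2)"
      by (simp add: d_def flip: of_real_mult del: of_real_diff)
    moreover have "d False * cnj (d False) = of_real ((cmod g)\<^sup>2)"
      by (simp add: d_def complex_norm_square[symmetric] mult.commute[of "cnj g"])
    ultimately show ?thesis by simp
  qed
  let ?b = "complex_of_real (1 / sqrt Kbb)" and ?n = "complex_of_real (1 / sqrt NN)"
  define w where "w p \<mu> = (if p then (\<lambda>x. (d \<mu> * ?n) * emb ee x) else if \<mu> then (\<lambda>x. 0) else (\<lambda>x. ?b * emb pb x))" for p \<mu> :: bool
  have w: "sqs (w p \<mu>)" for p \<mu>
    using sqs_scale[OF emb_sqs[of ee], of "d \<mu> * ?n"] sqs_scale[OF emb_sqs[of pb], of ?b]
    by (simp add: w_def sqs_0)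
  have cb: "?b * cnj ?b * of_real Kbb = 1" using Kbb_pos by (simp add: field_simps flip: of_real_mult)
  have cn: "?n * cnj ?n * of_real NN = 1" using NN_pos by (simp add: field_simps flip: of_real_mult)
  have cbn: "?b * cnj ?n * (\<sigma> * of_real Kbb) = \<gamma>t"
  proof -
    have "1 / sqrt Kbb * (1 / sqrt NN) * Kbb = sqrt Kbb / sqrt NN"
      using Kbb_pos NN_pos by (simp add: field_simps)
    then have "?b * cnj ?n * of_real Kbb = of_real (sqrt Kbb / sqrt NN)"
      by (metis complex_cnj_complex_of_real of_real_mult)
    then have "\<sigma> * (?b * cnj ?n * of_real Kbb) = \<gamma>t" by (simp only: \<gamma>t_def)
    then show ?thesis by (simp only: ac_simps)
  qed
  note V = gram_emb_values[folded \<sigma>_def]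
  let ?G = "\<lambda>p p' k. if p then (if p' then a powi k else 0) else (if p' then \<gamma> * dpow a b k else b powi k)"
  have G: "gram (\<lambda>l. wts (fst l)) (\<lambda>l. 1) (\<lambda>x. w p (snd (snd x)) (fst x, fst (snd x)))
      (\<lambda>x. w p' (snd (snd x)) (fst x, fst (snd x))) k = ?G p p' k" for p p' k
  proof -
    note S = gram_split_copies(2)[of "w p" "w p'", OF w w, of "\<lambda>_. wts" "\<lambda>_. 1" k]
    consider "p" "p'" | "p" "\<not> p'" | "\<not> p" "p'" | "\<not> p" "\<not> p'" by blast
    then show ?thesis
    proof cases
      case 1
      have "gram wts (\<lambda>_. 1) (w p \<mu>) (w p' \<mu>) k = (d \<mu> * cnj (d \<mu>)) * (a powi k * (?n * cnj ?n * of_real NN))" for \<mu>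
        using 1 by (simp only: w_def if_True gram_scale V) (simp only: complex_cnj_mult ac_simps)
      then have "gram wts (\<lambda>_. 1) (w p \<mu>) (w p' \<mu>) k = (d \<mu> * cnj (d \<mu>)) * a powi k" for \<mu>
        unfolding cn by simp
      then show ?thesis unfolding S using 1 dd by (simp flip: distrib_right)
    next
      case 2
      then have "gram wts (\<lambda>_. 1) (w p \<mu>) (w p' \<mu>) k = 0" for \<mu>
        by (cases \<mu>) (simp_all only: w_def if_True if_False gram_scale gram_0 V mult_zero_right)
      then show ?thesis unfolding S using 2 by simp
    next
      case 3
      then have "gram wts (\<lambda>_. 1) (w p True) (w p' True) k = 0"
        by (simp only: w_def if_True if_False gram_0)
      moreover have "gram wts (\<lambda>_. 1) (w p False) (w p' False) k = cnj (d False) * (hh k * (?b * cnj ?n * (\<sigma> * of_real Kbb)))"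
        using 3 by (simp only: w_def if_True if_False gram_scale V) (simp only: complex_cnj_mult ac_simps)
      ultimately show ?thesis unfolding S cbn using 3 g2 by (simp add: d_def ac_simps)
    next
      case 4
      then have "gram wts (\<lambda>_. 1) (w p True) (w p' True) k = 0"
        by (simp only: w_def if_True if_False gram_0)
      moreover have "gram wts (\<lambda>_. 1) (w p False) (w p' False) k = b powi k * (?b * cnj ?b * of_real Kbb)"
        using 4 by (simp only: w_def if_True if_False gram_scale V) (simp only: ac_simps)
      ultimately show ?thesis unfolding S cb using 4 by simp
    qed
  qed
  have "coord_model r (\<lambda>l. wts (fst l)) (\<lambda>l. 1) (\<lambda>p x. w p (snd (snd x)) (fst x, fst (snd x))) ?G"
    unfolding coord_model_def using r gram_split_copies(1)[OF w w] G by (auto simp: wts_def)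
  then show ?thesis by blast
qed

section \<open>Laurent expansions on the polyannulus\<close>


text \<open>A finite set of functions lies in the box of its coordinate projections, and over a box
  the sum of products factorises.\<close>

lemma summable_on_prod_PiE:
  fixes f :: "'a \<Rightarrow> 'b \<Rightarrow> real"
  assumes "finite A" "\<And>x y. x \<in> A \<Longrightarrow> y \<in> B x \<Longrightarrow> 0 \<le> f x y" "\<And>x. x \<in> A \<Longrightarrow> f x summable_on B x"
  shows "(\<lambda>g. \<Prod>x\<in>A. f x (g x)) summable_on (PiE A B)"
proof (rule nonneg_bdd_above_summable_on)
  show "0 \<le> (\<Prod>x\<in>A. f x (g x))" if "g \<in> PiE A B" for g
    using that assms(2) by (intro prod_nonneg) auto
  show "bdd_above (sum (\<lambda>g. \<Prod>x\<in>A. f x (g x)) ` {F. F \<subseteq> PiE A B \<and> finite F})"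
  proof (rule bdd_aboveI2)
    fix F assume "F \<in> {F. F \<subseteq> PiE A B \<and> finite F}"
    then have F: "F \<subseteq> PiE A B" "finite F" by auto
    define C where "C x = (\<lambda>g. g x) ` F" for x
    have C: "finite (C x)" "x \<in> A \<Longrightarrow> C x \<subseteq> B x" for x using F by (auto simp: C_def)
    have "sum (\<lambda>g. \<Prod>x\<in>A. f x (g x)) F \<le> sum (\<lambda>g. \<Prod>x\<in>A. f x (g x)) (PiE A C)"
    proof (rule sum_mono2)
      show "finite (PiE A C)" using assms(1) C by (intro finite_PiE) auto
      show "F \<subseteq> PiE A C" using F(1) by (auto simp: C_def PiE_iff)
      show "0 \<le> (\<Prod>x\<in>A. f x (g x))" if "g \<in> PiE A C - F" for g
        using that assms(2) C(2) by (intro prod_nonneg) (auto simp: PiE_iff subset_iff)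
    qed
    also have "\<dots> = (\<Prod>x\<in>A. sum (f x) (C x))"
      using assms(1) C by (intro prod_sum_PiE[symmetric]) auto
    also have "\<dots> \<le> (\<Prod>x\<in>A. infsum (f x) (B x))"
    proof (intro prod_mono conjI sum_nonneg)
      show "0 \<le> f x y" if "x \<in> A" "y \<in> C x" for x y using assms(2) C(2) that by blast
      show "sum (f x) (C x) \<le> infsum (f x) (B x)" if "x \<in> A" for x
        using that assms(2,3) C by (intro finite_sum_le_infsum) auto
    qed
    finally show "sum (\<lambda>g. \<Prod>x\<in>A. f x (g x)) F \<le> (\<Prod>x\<in>A. infsum (f x) (B x))" .
  qed
qed

text \<open>Exponents of Laurent monomials in \<open>m\<close> variables. Zero beyond
  \<open>m\<close>, rather than \<open>undefined\<close>, lets them be added pointwise.\<close>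

definition zidx :: "nat \<Rightarrow> (nat \<Rightarrow> int) set" where
  "zidx m = {n. \<forall>i\<ge>m. n i = 0}"

lemma summable_on_zidx_geometric:
  fixes \<sigma> :: real
  assumes "0 < \<sigma>" "\<sigma> < 1"
  shows "(\<lambda>n. \<Prod>i<m. \<sigma> ^ nat \<bar>n i\<bar>) summable_on zidx m"
proof -
  have S: "(\<lambda>g. \<Prod>i<m. \<sigma> ^ nat \<bar>g i\<bar>) summable_on (PiE {..<m} (\<lambda>_. UNIV :: int set))"
    using assms by (intro summable_on_prod_PiE[of _ _ "\<lambda>_ k. \<sigma> ^ nat \<bar>k\<bar>"] summable_on_geometric_int) auto
  have bij: "bij_betw (\<lambda>n. restrict n {..<m}) (zidx m) (PiE {..<m} (\<lambda>_. UNIV))"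
  proof (rule bij_betw_byWitness[where f' = "\<lambda>g i. if i < m then g i else 0"])
    show "\<forall>n\<in>zidx m. (\<lambda>i. if i < m then restrict n {..<m} i else 0) = n"
      by (simp add: zidx_def fun_eq_iff)
    show "\<forall>g\<in>PiE {..<m} (\<lambda>_. UNIV). restrict (\<lambda>i. if i < m then g i else 0) {..<m} = g"
      by (simp add: PiE_iff extensional_def fun_eq_iff)
    show "(\<lambda>n. restrict n {..<m}) ` zidx m \<subseteq> PiE {..<m} (\<lambda>_. UNIV)"
      by (simp add: image_subset_iff)
    show "(\<lambda>g i. if i < m then g i else 0) ` PiE {..<m} (\<lambda>_. UNIV) \<subseteq> zidx m"
      by (simp add: image_subset_iff zidx_def)
  qed
  have "(\<Prod>i<m. \<sigma> ^ nat \<bar>restrict n {..<m} i\<bar>) = (\<Prod>i<m. \<sigma> ^ nat \<bar>n i\<bar>)" for n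
    by (rule prod.cong) auto
  then show ?thesis
    using summable_on_reindex_bij_betw[OF bij, of "\<lambda>g. \<Prod>i<m. \<sigma> ^ nat \<bar>g i\<bar>", THEN iffD2, OF S]
    by (simp only:)
qed

lemma finite_coordinates_convergent_subsequence:
  fixes z :: "nat \<Rightarrow> nat \<Rightarrow> complex"
  assumes "\<And>k i. i < m \<Longrightarrow> cmod (z k i) \<le> R"
  shows "\<exists>s. strict_mono s \<and> (\<forall>i<m. convergent (\<lambda>k. z (s k) i))"
  using assms
proof (induction m)
  case 0
  then show ?case by (intro exI[of _ id]) (auto simp: strict_mono_def)
next
  case (Suc m)
  then obtain s where s: "strict_mono s" "\<And>i. i < m \<Longrightarrow> convergent (\<lambda>k. z (s k) i)" by force
  have "bounded (range (\<lambda>k. z (s k) m))" using Suc.prems by (auto simp: bounded_iff)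
  then obtain l u where u: "strict_mono u" "((\<lambda>k. z (s k) m) \<circ> u) \<longlonglongrightarrow> l"
    using bounded_imp_convergent_subsequence by blast
  have "convergent (\<lambda>k. z ((s \<circ> u) k) i)" if "i < Suc m" for i
  proof (cases "i = m")
    case True
    then show ?thesis using u(2) by (auto simp: convergent_def o_def)
  next
    case False
    then show ?thesis using convergent_subseq_convergent[OF s(2) u(1), of i] that by (simp add: o_def)
  qed
  moreover have "strict_mono (s \<circ> u)" using s(1) u(1) by (rule strict_mono_o)
  ultimately show ?case by blast
qed

text \<open>Compactness: otherwise points of shrinking neighbourhoods with values of
  \<open>q\<close> tending to 0 would accumulate at a zero in the closed polyannulus.\<close>

lemma polyannulus_enlarge:
  assumes "0 < r" "r < 1"
    and zf: "\<And>z. (\<And>i. i < m \<Longrightarrow> z i \<in> closed_annulus r) \<Longrightarrow> mpoly_eval m q z \<noteq> 0"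
  shows "\<exists>\<epsilon> M. 0 < \<epsilon> \<and> \<epsilon> < r \<and> 0 < M \<and>
    (\<forall>z. (\<forall>i<m. r - \<epsilon> \<le> cmod (z i) \<and> cmod (z i) \<le> 1 + \<epsilon>) \<longrightarrow> mpoly_eval m q z \<noteq> 0 \<and> 1 / cmod (mpoly_eval m q z) \<le> M)"
proof (rule ccontr)
  assume neg: "\<not> ?thesis"
  have "\<exists>z. (\<forall>i<m. r - r / real (k + 2) \<le> cmod (z i) \<and> cmod (z i) \<le> 1 + r / real (k + 2))
     \<and> cmod (mpoly_eval m q z) \<le> 1 / real (k + 1)" for k
  proof -
    have "0 < r / real (k + 2)" "r / real (k + 2) < r" "0 < real (k + 1)"
      using assms by (auto simp: divide_less_eq)
    with neg obtain z where z: "\<forall>i<m. r - r / real (k + 2) \<le> cmod (z i) \<and> cmod (z i) \<le> 1 + r / real (k + 2)"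
      "mpoly_eval m q z = 0 \<or> \<not> 1 / cmod (mpoly_eval m q z) \<le> real (k + 1)"
      by meson
    have "cmod (mpoly_eval m q z) \<le> 1 / real (k + 1)"
    proof (cases "mpoly_eval m q z = 0")
      case False
      then have "real (k + 1) < 1 / cmod (mpoly_eval m q z)" using z(2) by auto
      then show ?thesis using False by (simp add: field_simps)
    qed simp
    then show ?thesis using z(1) by blast
  qed
  then obtain z where z: "\<And>k i. i < m \<Longrightarrow> r - r / real (k + 2) \<le> cmod (z k i)"
    "\<And>k i. i < m \<Longrightarrow> cmod (z k i) \<le> 1 + r / real (k + 2)"
    "\<And>k. cmod (mpoly_eval m q (z k)) \<le> 1 / real (k + 1)"
    by metis
  have "cmod (z k i) \<le> 2" if "i < m" for k i
  proof -
    have "r / real (k + 2) \<le> 1" using assms by (simp add: divide_le_eq)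
    then show ?thesis using z(2)[OF that, of k] by linarith
  qed
  then obtain s where s: "strict_mono s" "\<And>i. i < m \<Longrightarrow> convergent (\<lambda>k. z (s k) i)"
    using finite_coordinates_convergent_subsequence[of m z 2] by blast
  define w where "w i = lim (\<lambda>k. z (s k) i)" for i
  have w: "(\<lambda>k. z (s k) i) \<longlonglongrightarrow> w i" if "i < m" for i
    using s(2)[OF that] by (simp add: w_def convergent_LIMSEQ_iff)
  have n0: "(\<lambda>k. r / real (k + 2)) \<longlonglongrightarrow> 0"
    using LIMSEQ_ignore_initial_segment[OF lim_const_over_n[of r], of 2] by simp
  have rs: "(\<lambda>k. r / real (s k + 2)) \<longlonglongrightarrow> 0"
    using LIMSEQ_subseq_LIMSEQ[OF n0 s(1)] by (simp add: o_def)
  have "w i \<in> closed_annulus r" if "i < m" for i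
  proof -
    have "(\<lambda>k. r - r / real (s k + 2)) \<longlonglongrightarrow> r - 0" "(\<lambda>k. 1 + r / real (s k + 2)) \<longlonglongrightarrow> 1 + 0"
      by (intro tendsto_intros rs)+
    then show ?thesis
      using tendsto_le[OF sequentially_bot tendsto_norm[OF w[OF that]]] tendsto_le[OF sequentially_bot _ tendsto_norm[OF w[OF that]]] z(1,2)[OF that]
      unfolding closed_annulus_def by (auto intro: always_eventually)
  qed
  then have "mpoly_eval m q w \<noteq> 0" by (rule zf)
  moreover have "(\<lambda>k. mpoly_eval m q (z (s k))) \<longlonglongrightarrow> mpoly_eval m q w"
    unfolding mpoly_eval_def by (intro tendsto_intros w) auto
  moreover have "(\<lambda>k. mpoly_eval m q (z (s k))) \<longlonglongrightarrow> 0"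
  proof (rule Lim_null_comparison)
    show "\<forall>\<^sub>F k in sequentially. norm (mpoly_eval m q (z (s k))) \<le> 1 / real (s k + 1)"
      using z(3) by (intro always_eventually) auto
    have "(\<lambda>k. 1 / real (k + 1)) \<longlonglongrightarrow> 0"
      using LIMSEQ_ignore_initial_segment[OF lim_const_over_n[of 1], of 1] by simp
    from LIMSEQ_subseq_LIMSEQ[OF this s(1)] show "(\<lambda>k. 1 / real (s k + 1)) \<longlonglongrightarrow> 0" by (simp add: o_def)
  qed
  ultimately show False using LIMSEQ_unique by blast
qed

definition circ :: "real \<Rightarrow> real \<Rightarrow> complex" where
  "circ \<rho> \<theta> = of_real \<rho> * exp (2 * of_real pi * \<i> * of_real \<theta>)"

lemma cmod_circ [simp]: "cmod (circ \<rho> \<theta>) = \<bar>\<rho>\<bar>"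
  by (simp add: circ_def norm_mult)

lemma continuous_circ: "continuous_on S (circ \<rho>)"
  unfolding circ_def by (intro continuous_intros)

lemma circ_measurable [measurable]: "circ \<rho> \<in> borel_measurable borel"
  by (intro borel_measurable_continuous_onI continuous_circ)

text \<open>The mean is the contour integral of \<open>f z / z\<close> up to the factor
  \<open>2 * pi * \<i>\<close>, and concentric circles are homotopic in the annulus.\<close>

lemma circle_mean_radius:
  assumes "f holomorphic_on {z. A < cmod z \<and> cmod z < B}" "0 \<le> A" "A < a" "a < B" "A < b" "b < B"
  shows "integral {0..1} (\<lambda>\<theta>. f (circ a \<theta>)) = integral {0..1} (\<lambda>\<theta>. f (circ b \<theta>))"
proof -
  let ?S = "{z::complex. A < cmod z \<and> cmod z < B}"
  have S: "open ?S" by (intro open_Collect_conj open_Collect_less continuous_intros)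
  have cp: "circlepath 0 c \<theta> = circ c \<theta>" for c \<theta> by (simp add: circlepath circ_def)
  have hol: "(\<lambda>z. f z / z) holomorphic_on ?S"
    using assms by (intro holomorphic_on_divide holomorphic_on_id) auto
  have seg: "closed_segment (circlepath 0 a x) (circlepath 0 b x) \<subseteq> ?S" for x
  proof
    fix y assume "y \<in> closed_segment (circlepath 0 a x) (circlepath 0 b x)"
    then obtain u where u: "0 \<le> u" "u \<le> 1" "y = (1 - u) *\<^sub>R circ a x + u *\<^sub>R circ b x"
      unfolding cp by (auto simp: closed_segment_def)
    have y: "y = circ ((1 - u) * a + u * b) x" unfolding u(3) circ_def by (simp add: scaleR_conv_of_real algebra_simps)
    have "(1 - u) * a + u * b > A" "(1 - u) * a + u * b < B"
      using convex_bound_lt[of a B b "1 - u" u] convex_bound_lt[of "- a" "- A" "- b" "1 - u" u] assms u by auto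
    then show "y \<in> ?S" unfolding y using assms by simp
  qed
  have "contour_integral (circlepath 0 a) (\<lambda>z. f z / z) = contour_integral (circlepath 0 b) (\<lambda>z. f z / z)"
    using seg by (intro Cauchy_theorem_homotopic_loops[OF _ S hol] homotopic_loops_linear) auto
  moreover have "contour_integral (circlepath 0 c) (\<lambda>z. f z / z) = 2 * of_real pi * \<i> * integral {0..1} (\<lambda>\<theta>. f (circ c \<theta>))" if "c > 0" for c
  proof -
    have "f (circlepath 0 c x) / circlepath 0 c x * vector_derivative (circlepath 0 c) (at x) = 2 * of_real pi * \<i> * f (circ c x)" for x
      unfolding cp vector_derivative_circlepath using that by (simp add: circ_def)
    then show ?thesis unfolding contour_integral_integral by simp
  qed
  ultimately show ?thesis using assms by simp
qed

text \<open>Normalised arc length in the angle variable, written as a density so that the underlying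
  space is all of \<open>real\<close>.\<close>

definition unitm :: "real measure" where
  "unitm = density lborel (\<lambda>x. ennreal (indicator {0..1} x))"

lemma sets_unitm [measurable_cong, simp]: "sets unitm = sets borel"
  by (simp add: unitm_def)

lemma space_unitm [simp]: "space unitm = UNIV"
  by (simp add: unitm_def)

lemma emeasure_unitm: "emeasure unitm (space unitm) = 1"
  by (simp add: unitm_def emeasure_density ennreal_indicator)

lemma finite_unitm: "finite_measure unitm"
  by (rule finite_measureI) (simp add: emeasure_unitm[simplified])

lemma integral_unitm:
  fixes f :: "real \<Rightarrow> complex"
  assumes "continuous_on UNIV f"
  shows "integral\<^sup>L unitm f = integral {0..1} f"
proof -
  have f: "f \<in> borel_measurable borel" by (rule borel_measurable_continuous_onI[OF assms])
  have "integral\<^sup>L unitm f = (LINT x : {0..1} | lborel. f x)"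
    unfolding unitm_def set_lebesgue_integral_def using f by (subst integral_density) auto
  also have "\<dots> = integral {0..1} f"
    by (intro set_borel_integral_eq_integral borel_integrable_atLeastAtMost' continuous_on_subset[OF assms]) auto
  finally show ?thesis .
qed

lemma integrable_unitm_const: "integrable unitm (\<lambda>_. c :: 'a :: {banach, second_countable_topology})"
  using finite_measure.integrable_const[OF finite_unitm] .

lemma measure_unitm: "measure unitm UNIV = 1"
  using emeasure_unitm by (simp add: measure_def)

interpretation unit_product: product_sigma_finite "\<lambda>_::nat. unitm"
  by (intro product_sigma_finite.intro finite_measure.axioms(1)[OF finite_unitm])

abbreviation torusm :: "nat set \<Rightarrow> (nat \<Rightarrow> real) measure" where
  "torusm I \<equiv> Pi\<^sub>M I (\<lambda>_. unitm)"

lemma integrable_torus_const: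
  assumes "finite I"
  shows "integrable (torusm I) (\<lambda>_. c :: complex)" "integral\<^sup>L (torusm I) (\<lambda>_. 1 :: real) = 1"
    "integrable (torusm I) (\<lambda>_. d :: real)"
proof -
  have 1: "integrable (torusm I) (\<lambda>x. \<Prod>i\<in>I. (1 :: complex))"
    by (rule unit_product.product_integrable_prod[OF assms, of "\<lambda>_ _. 1"]) (rule integrable_unitm_const)
  show "integrable (torusm I) (\<lambda>_. c)" using integrable_mult_right[OF 1, of c] by simp
  have 2: "integrable (torusm I) (\<lambda>x. \<Prod>i\<in>I. (1 :: real))"
    by (rule unit_product.product_integrable_prod[OF assms, of "\<lambda>_ _. 1"]) (rule integrable_unitm_const)
  show "integrable (torusm I) (\<lambda>_. d :: real)" using integrable_mult_right[OF 2, of d] by simp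
  have "integral\<^sup>L (torusm I) (\<lambda>x. \<Prod>i\<in>I. (1 :: real)) = (\<Prod>i\<in>I. integral\<^sup>L unitm (\<lambda>_. 1))"
    by (rule unit_product.product_integral_prod[OF assms, of "\<lambda>_ _. 1"]) (rule integrable_unitm_const)
  then show "integral\<^sup>L (torusm I) (\<lambda>_. 1 :: real) = 1" by (simp add: measure_unitm)
qed

lemma torus_bounded_integrable:
  assumes "finite I" "f \<in> borel_measurable (torusm I)" "\<And>x. cmod (f x) \<le> K"
  shows "integrable (torusm I) f" "cmod (integral\<^sup>L (torusm I) f) \<le> K"
proof -
  show i: "integrable (torusm I) f"
    by (rule Bochner_Integration.integrable_bound[OF integrable_torus_const(3)[OF assms(1), of K] assms(2)])
       (use assms(3) order_trans[OF norm_ge_zero assms(3)] in auto)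
  have "cmod (integral\<^sup>L (torusm I) f) \<le> integral\<^sup>L (torusm I) (\<lambda>x. cmod (f x))"
    by (rule integral_norm_bound)
  also have "\<dots> \<le> integral\<^sup>L (torusm I) (\<lambda>_. K)"
    by (rule integral_mono) (use i assms(3) integrable_torus_const(3)[OF assms(1), of K] in auto)
  also have "\<dots> = K" using integrable_torus_const(2)[OF assms(1)] integral_mult_right_zero[of "torusm I" K "\<lambda>_. 1"] by simp
  finally show "cmod (integral\<^sup>L (torusm I) f) \<le> K" .
qed

definition tpt :: "(nat \<Rightarrow> real) \<Rightarrow> (nat \<Rightarrow> real) \<Rightarrow> nat \<Rightarrow> complex" where
  "tpt \<rho> \<theta> i = circ (\<rho> i) (\<theta> i)"

lemma mpoly_tpt_measurable:
  "(\<lambda>\<theta>. mpoly_eval m q (tpt \<rho> \<theta>)) \<in> borel_measurable (torusm {..<m})"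
  unfolding mpoly_eval_def tpt_def by measurable

lemma prod_powi_tpt_measurable:
  "(\<lambda>\<theta>. \<Prod>i<m. tpt \<rho> \<theta> i powi n i) \<in> borel_measurable (torusm {..<m})"
  unfolding tpt_def power_int_def by measurable

text \<open>Passing to radius 2 leaves the mean unchanged but multiplies it by
  \<open>2 powi k\<close>, which is not 1.\<close>

lemma circle_mean_powi:
  assumes "k \<noteq> 0"
  shows "integral {0..1} (\<lambda>\<theta>. circ 1 \<theta> powi k) = 0"
proof -
  have "(\<lambda>z. z powi k) holomorphic_on {z. 0 < cmod z \<and> cmod z < 3}"
    by (intro holomorphic_intros) auto
  then have "integral {0..1} (\<lambda>\<theta>. circ 2 \<theta> powi k) = integral {0..1} (\<lambda>\<theta>. circ 1 \<theta> powi k)"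
    by (rule circle_mean_radius) auto
  moreover have "circ 2 \<theta> powi k = 2 powi k * circ 1 \<theta> powi k" for \<theta>
    by (simp add: circ_def power_int_mult_distrib)
  ultimately have "(2 powi k - 1) * integral {0..1} (\<lambda>\<theta>. circ 1 \<theta> powi k) = 0"
    by (simp add: algebra_simps)
  moreover have "(2 :: complex) powi k \<noteq> 1"
  proof
    assume "(2 :: complex) powi k = 1"
    then have "cmod ((2 :: complex) powi k) = 1" by simp
    then have *: "(2 :: real) powi k = 1" by (simp add: norm_power_int)
    have "(2::real) ^ nat \<bar>k\<bar> = 1"
      using * by (cases "k \<ge> 0") (auto simp: power_int_def power_inverse power_one_over)
    then show False using assms one_less_power[of "2::real" "nat \<bar>k\<bar>"] by simp
  qed
  ultimately show ?thesis by simp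
qed

section \<open>Laurent coefficients of 1 / q\<close>

context
  fixes r :: real and m :: nat and q :: "(nat \<Rightarrow> nat) \<Rightarrow> complex" and \<epsilon> M :: real
  assumes r: "0 < r" "r < 1" and \<epsilon>: "0 < \<epsilon>" "\<epsilon> < r" and M: "0 < M"
    and q: "q \<in> mpolys m"
    and low: "\<And>z. (\<And>i. i < m \<Longrightarrow> r - \<epsilon> \<le> cmod (z i) \<and> cmod (z i) \<le> 1 + \<epsilon>) \<Longrightarrow>
      mpoly_eval m q z \<noteq> 0 \<and> 1 / cmod (mpoly_eval m q z) \<le> M"
begin

text \<open>Cauchy's integral for the Laurent coefficient of \<open>1 / q\<close> with exponent
  \<open>n\<close>, over the torus with radii \<rho>.\<close>

definition lint :: "(nat \<Rightarrow> real) \<Rightarrow> (nat \<Rightarrow> int) \<Rightarrow> complex" where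
  "lint \<rho> n = integral\<^sup>L (torusm {..<m}) (\<lambda>\<theta>. (\<Prod>i<m. tpt \<rho> \<theta> i powi (- n i)) / mpoly_eval m q (tpt \<rho> \<theta>))"

definition good :: "(nat \<Rightarrow> real) \<Rightarrow> bool" where
  "good \<rho> \<longleftrightarrow> (\<forall>i. r - \<epsilon> < \<rho> i \<and> \<rho> i < 1 + \<epsilon>)"

lemma good_low:
  assumes "good \<rho>"
  shows "mpoly_eval m q (tpt \<rho> \<theta>) \<noteq> 0" "1 / cmod (mpoly_eval m q (tpt \<rho> \<theta>)) \<le> M"
proof -
  have "r - \<epsilon> \<le> cmod (tpt \<rho> \<theta> i) \<and> cmod (tpt \<rho> \<theta> i) \<le> 1 + \<epsilon>" for i
    using assms \<epsilon> unfolding good_def tpt_def by (auto simp: less_imp_le) (smt (verit))+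
  then show "mpoly_eval m q (tpt \<rho> \<theta>) \<noteq> 0" "1 / cmod (mpoly_eval m q (tpt \<rho> \<theta>)) \<le> M"
    using low by blast+
qed

lemma good_pos: "good \<rho> \<Longrightarrow> \<rho> i > 0"
  using \<epsilon> unfolding good_def by (smt (verit))

lemma lint_integrand:
  assumes "good \<rho>"
  shows "(\<lambda>\<theta>. (\<Prod>i<m. tpt \<rho> \<theta> i powi (- n i)) / mpoly_eval m q (tpt \<rho> \<theta>)) \<in> borel_measurable (torusm {..<m})"
    "cmod ((\<Prod>i<m. tpt \<rho> \<theta> i powi (- n i)) / mpoly_eval m q (tpt \<rho> \<theta>)) \<le> M * (\<Prod>i<m. \<rho> i powi (- n i))"
proof -
  show "(\<lambda>\<theta>. (\<Prod>i<m. tpt \<rho> \<theta> i powi (- n i)) / mpoly_eval m q (tpt \<rho> \<theta>)) \<in> borel_measurable (torusm {..<m})"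
    by (intro borel_measurable_divide mpoly_tpt_measurable prod_powi_tpt_measurable)
  have "cmod (\<Prod>i<m. tpt \<rho> \<theta> i powi (- n i)) = (\<Prod>i<m. \<rho> i powi (- n i))"
    using good_pos[OF assms] by (simp add: prod_norm[symmetric] norm_power_int tpt_def less_imp_le)
  then have "cmod ((\<Prod>i<m. tpt \<rho> \<theta> i powi (- n i)) / mpoly_eval m q (tpt \<rho> \<theta>))
      = (1 / cmod (mpoly_eval m q (tpt \<rho> \<theta>))) * (\<Prod>i<m. \<rho> i powi (- n i))"
    by (simp add: norm_divide)
  also have "\<dots> \<le> M * (\<Prod>i<m. \<rho> i powi (- n i))"
    using good_low(2)[OF assms] good_pos[OF assms] by (intro mult_right_mono prod_nonneg) (auto simp: less_imp_le)
  finally show "cmod ((\<Prod>i<m. tpt \<rho> \<theta> i powi (- n i)) / mpoly_eval m q (tpt \<rho> \<theta>)) \<le> M * (\<Prod>i<m. \<rho> i powi (- n i))" .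
qed

lemma lint_integrable:
  assumes "good \<rho>"
  shows "integrable (torusm {..<m}) (\<lambda>\<theta>. (\<Prod>i<m. tpt \<rho> \<theta> i powi (- n i)) / mpoly_eval m q (tpt \<rho> \<theta>))"
    "cmod (lint \<rho> n) \<le> M * (\<Prod>i<m. \<rho> i powi (- n i))"
  unfolding lint_def by (rule torus_bounded_integrable[OF _ lint_integrand(1,2)[OF assms]], simp)+

text \<open>Fubini isolates the variable \<open>i\<close>; the inner integral is then a circle mean
  of a function holomorphic in that variable alone.\<close>

lemma lint_change_radius:
  assumes "good \<rho>" "good (\<rho>(i := c))" "i < m"
  shows "lint (\<rho>(i := c)) n = lint \<rho> n"
proof -
  define I where "I = {..<m} - {i}"
  have I: "{..<m} = insert i I" "finite I" "i \<notin> I" using assms(3) by (auto simp: I_def)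
  let ?F = "\<lambda>\<rho> \<theta>. (\<Prod>j<m. tpt \<rho> \<theta> j powi (- n j)) / mpoly_eval m q (tpt \<rho> \<theta>)"
  define f where "f \<theta> z = (\<Prod>j<m. ((tpt \<rho> \<theta>)(i := z)) j powi (- n j)) / mpoly_eval m q ((tpt \<rho> \<theta>)(i := z))" for \<theta> z
  let ?S = "{z. r - \<epsilon> < cmod z \<and> cmod z < 1 + \<epsilon>}"
  have nz: "mpoly_eval m q ((tpt \<rho> \<theta>)(i := z)) \<noteq> 0" if "z \<in> ?S" for \<theta> z
  proof -
    have "r - \<epsilon> \<le> cmod (((tpt \<rho> \<theta>)(i := z)) j) \<and> cmod (((tpt \<rho> \<theta>)(i := z)) j) \<le> 1 + \<epsilon>" for j
      using assms(1) that good_pos[OF assms(1), of j] unfolding good_def tpt_def by (auto simp: less_imp_le)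
    then show ?thesis using low by blast
  qed
  have hol: "f \<theta> holomorphic_on ?S" for \<theta>
  proof -
    have nz2: "((tpt \<rho> \<theta>)(i := z)) j \<noteq> 0" if "z \<in> ?S" for z j
      using that \<epsilon> good_pos[OF assms(1), of j] by (auto simp: tpt_def circ_def)
    have c: "(\<lambda>z. ((tpt \<rho> \<theta>)(i := z)) j) holomorphic_on ?S" for j
      by (cases "j = i") (auto intro!: holomorphic_intros)
    have p: "(\<lambda>z. \<Prod>j<m. ((tpt \<rho> \<theta>)(i := z)) j powi (- n j)) holomorphic_on ?S"
      by (intro holomorphic_on_prod holomorphic_on_power_int disjI2 ballI c nz2)
    have e: "(\<lambda>z. mpoly_eval m q ((tpt \<rho> \<theta>)(i := z))) holomorphic_on ?S"
      unfolding mpoly_eval_def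
      by (intro holomorphic_on_sum holomorphic_on_mult holomorphic_on_const holomorphic_on_prod holomorphic_on_power c)
    show ?thesis unfolding f_def by (rule holomorphic_on_divide[OF p e nz])
  qed
  have cont: "continuous_on UNIV (\<lambda>y. f \<theta> (circ d y))" if "r - \<epsilon> < d" "d < 1 + \<epsilon>" for \<theta> d
    by (rule continuous_on_compose2[OF holomorphic_on_imp_continuous_on[OF hol] continuous_circ])
       (use that \<epsilon> in auto)
  have ci: "r - \<epsilon> < c" "c < 1 + \<epsilon>" "r - \<epsilon> < \<rho> i" "\<rho> i < 1 + \<epsilon>"
    using assms(1) assms(2)[unfolded good_def, THEN spec, of i] by (simp_all add: good_def)
  have inner: "integral\<^sup>L unitm (\<lambda>y. f \<theta> (circ c y)) = integral\<^sup>L unitm (\<lambda>y. f \<theta> (circ (\<rho> i) y))" for \<theta>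
    unfolding integral_unitm[OF cont[OF ci(1,2)]] integral_unitm[OF cont[OF ci(3,4)]]
    by (rule circle_mean_radius[OF hol]) (use ci \<epsilon> in auto)
  have e1: "?F (\<rho>(i := c)) (x(i := y)) = f x (circ c y)" for x y
  proof -
    have "tpt (\<rho>(i := c)) (x(i := y)) = (tpt \<rho> x)(i := circ c y)" by (auto simp: tpt_def fun_eq_iff)
    then show ?thesis by (simp only: f_def)
  qed
  have e2: "?F \<rho> (x(i := y)) = f x (circ (\<rho> i) y)" for x y
  proof -
    have "tpt \<rho> (x(i := y)) = (tpt \<rho> x)(i := circ (\<rho> i) y)" by (auto simp: tpt_def fun_eq_iff)
    then show ?thesis by (simp only: f_def)
  qed
  note P = unit_product.product_integral_insert[OF I(2,3), folded I(1)]
  show ?thesis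
    unfolding lint_def P[OF lint_integrable(1)[OF assms(2)]] P[OF lint_integrable(1)[OF assms(1)]] e1 e2 inner ..
qed

lemma good_1: "good (\<lambda>_. 1)"
  using r \<epsilon> by (auto simp: good_def)

lemma lint_radius:
  assumes "good \<rho>"
  shows "lint (\<lambda>_. 1) n = lint (\<lambda>i. if i < m then \<rho> i else 1) n"
proof -
  have "lint (\<lambda>_. 1) n = lint (\<lambda>i. if i < k then \<rho> i else 1) n" if "k \<le> m" for k
    using that
  proof (induction k)
    case (Suc k)
    have g: "good (\<lambda>i. if i < j then \<rho> i else 1)" for j
      using assms good_1 by (auto simp: good_def)
    have "(\<lambda>i. if i < Suc k then \<rho> i else 1) = (\<lambda>i. if i < k then \<rho> i else 1)(k := \<rho> k)"
      by (auto simp: fun_eq_iff less_Suc_eq)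
    then show ?case using lint_change_radius[OF g[of k], of k "\<rho> k" n] g[of "Suc k"] Suc by simp
  qed simp
  then show ?thesis by simp
qed

text \<open>The radii follow the signs of the exponents: slightly above 1 where
  \<open>n i \<ge> 0\<close>, slightly below \<open>r\<close> elsewhere. Since
  \<open>max 1 (r powi n i)\<close> is the maximum of \<open>cmod z powi n i\<close> on the closed
  annulus, a geometric factor remains in each variable.\<close>

lemma lint_bound:
  "\<exists>\<sigma>. 0 < \<sigma> \<and> \<sigma> < 1 \<and> (\<forall>n. cmod (lint (\<lambda>_. 1) n) * (\<Prod>i<m. max 1 (r powi n i)) \<le> M * (\<Prod>i<m. \<sigma> ^ nat \<bar>n i\<bar>))"
proof -
  define d where "d = \<epsilon> / 2"
  have d: "0 < d" "d < \<epsilon>" using \<epsilon> by (auto simp: d_def)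
  define \<sigma> where "\<sigma> = max (1 / (1 + d)) ((r - d) / r)"
  have \<sigma>: "0 < \<sigma>" "\<sigma> < 1" unfolding \<sigma>_def using d r by (auto simp: less_max_iff_disj)
  have "cmod (lint (\<lambda>_. 1) n) * (\<Prod>i<m. max 1 (r powi n i)) \<le> M * (\<Prod>i<m. \<sigma> ^ nat \<bar>n i\<bar>)" for n
  proof -
    define \<rho> where "\<rho> i = (if n i \<ge> 0 then 1 + d else r - d)" for i
    have g: "good \<rho>" using d \<epsilon> r by (auto simp: good_def \<rho>_def)
    have g': "good (\<lambda>i. if i < m then \<rho> i else 1)" using g good_1 by (auto simp: good_def)
    have "cmod (lint (\<lambda>_. 1) n) \<le> M * (\<Prod>i<m. \<rho> i powi (- n i))"
      unfolding lint_radius[OF g] using lint_integrable(2)[OF g', of n] by simp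
    then have "cmod (lint (\<lambda>_. 1) n) * (\<Prod>i<m. max 1 (r powi n i)) \<le> M * (\<Prod>i<m. \<rho> i powi (- n i)) * (\<Prod>i<m. max 1 (r powi n i))"
      by (intro mult_right_mono prod_nonneg) auto
    also have "\<dots> = M * (\<Prod>i<m. \<rho> i powi (- n i) * max 1 (r powi n i))" by (simp add: prod.distrib)
    also have "\<dots> \<le> M * (\<Prod>i<m. \<sigma> ^ nat \<bar>n i\<bar>)"
    proof (intro mult_left_mono prod_mono conjI)
      fix i
      show "0 \<le> \<rho> i powi (- n i) * max 1 (r powi n i)" using good_pos[OF g, of i] by (intro mult_nonneg_nonneg) auto
      show "\<rho> i powi (- n i) * max 1 (r powi n i) \<le> \<sigma> ^ nat \<bar>n i\<bar>"
      proof (cases "n i \<ge> 0")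
        case True
        then have "r powi n i \<le> 1" using r by (simp add: power_int_def power_le_one)
        moreover have "(1 + d) powi (- n i) = (1 / (1 + d)) ^ nat (n i)"
          using True d by (cases "n i = 0") (auto simp: power_int_def divide_inverse)
        moreover have "(1 / (1 + d)) ^ nat (n i) \<le> \<sigma> ^ nat (n i)" using d by (intro power_mono) (auto simp: \<sigma>_def)
        ultimately show ?thesis using True by (simp add: \<rho>_def max_absorb1)
      next
        case False
        have "1 \<le> r powi n i" using False r by (simp add: power_int_def one_le_power one_le_inverse)
        moreover have "(r - d) powi (- n i) * r powi n i = ((r - d) / r) ^ nat (- n i)"
          using False r by (simp add: power_int_def power_divide field_simps)
        moreover have "((r - d) / r) ^ nat (- n i) \<le> \<sigma> ^ nat (- n i)" using d \<epsilon> r by (intro power_mono) (auto simp: \<sigma>_def)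
        ultimately show ?thesis using False by (simp add: \<rho>_def max_absorb2)
      qed
    qed (use M in auto)
    finally show ?thesis .
  qed
  then show ?thesis using \<sigma> by blast
qed

text \<open>Under the integral the sum over \<alpha> restores \<open>q\<close> and cancels the
  denominator; what is left is a product of circle means of pure powers.\<close>

lemma lint_convolution:
  "(\<Sum>\<alpha>\<in>{\<alpha>. q \<alpha> \<noteq> 0}. q \<alpha> * lint (\<lambda>_. 1) (\<lambda>i. n i - int (\<alpha> i))) = (if \<forall>i<m. n i = 0 then 1 else 0)"
proof -
  let ?t = "tpt (\<lambda>_. 1)"
  have fin: "finite {\<alpha>. q \<alpha> \<noteq> 0}" using q by (simp add: mpolys_def)
  let ?F = "\<lambda>n \<theta>. (\<Prod>i<m. ?t \<theta> i powi (- n i)) / mpoly_eval m q (?t \<theta>)"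
  have t0: "?t \<theta> i \<noteq> 0" for \<theta> i by (simp add: tpt_def circ_def)
  have "(\<Sum>\<alpha>\<in>{\<alpha>. q \<alpha> \<noteq> 0}. q \<alpha> * lint (\<lambda>_. 1) (\<lambda>i. n i - int (\<alpha> i)))
      = integral\<^sup>L (torusm {..<m}) (\<lambda>\<theta>. \<Sum>\<alpha>\<in>{\<alpha>. q \<alpha> \<noteq> 0}. q \<alpha> * ?F (\<lambda>i. n i - int (\<alpha> i)) \<theta>)"
    unfolding lint_def integral_mult_right_zero[symmetric]
    by (rule Bochner_Integration.integral_sum[symmetric]) (intro integrable_mult_right lint_integrable(1)[OF good_1])
  also have "(\<lambda>\<theta>. \<Sum>\<alpha>\<in>{\<alpha>. q \<alpha> \<noteq> 0}. q \<alpha> * ?F (\<lambda>i. n i - int (\<alpha> i)) \<theta>) = (\<lambda>\<theta>. \<Prod>i<m. circ 1 (\<theta> i) powi (- n i))"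
  proof
    fix \<theta>
    have "q \<alpha> * ?F (\<lambda>i. n i - int (\<alpha> i)) \<theta> = (q \<alpha> * (\<Prod>i<m. ?t \<theta> i ^ \<alpha> i)) * ((\<Prod>i<m. ?t \<theta> i powi (- n i)) / mpoly_eval m q (?t \<theta>))" for \<alpha>
    proof -
      have "?t \<theta> i powi (- (n i - int (\<alpha> i))) = ?t \<theta> i ^ \<alpha> i * ?t \<theta> i powi (- n i)" for i
        using t0[of \<theta> i] power_int_add[of "?t \<theta> i" "int (\<alpha> i)" "- n i"] by simp
      then show ?thesis by (simp add: prod.distrib)
    qed
    then have "(\<Sum>\<alpha>\<in>{\<alpha>. q \<alpha> \<noteq> 0}. q \<alpha> * ?F (\<lambda>i. n i - int (\<alpha> i)) \<theta>)
      = mpoly_eval m q (?t \<theta>) * ((\<Prod>i<m. ?t \<theta> i powi (- n i)) / mpoly_eval m q (?t \<theta>))"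
      unfolding mpoly_eval_def by (simp only: sum_distrib_right)
    also have "\<dots> = (\<Prod>i<m. ?t \<theta> i powi (- n i))" using good_low(1)[OF good_1, of \<theta>] by simp
    finally show "(\<Sum>\<alpha>\<in>{\<alpha>. q \<alpha> \<noteq> 0}. q \<alpha> * ?F (\<lambda>i. n i - int (\<alpha> i)) \<theta>) = (\<Prod>i<m. circ 1 (\<theta> i) powi (- n i))"
      by (simp add: tpt_def)
  qed
  also have "integral\<^sup>L (torusm {..<m}) (\<lambda>\<theta>. \<Prod>i<m. circ 1 (\<theta> i) powi (- n i)) = (\<Prod>i<m. integral\<^sup>L unitm (\<lambda>y. circ 1 y powi (- n i)))"
  proof (rule unit_product.product_integral_prod)
    fix i
    show "integrable unitm (\<lambda>y. circ 1 y powi (- n i))"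
    proof (rule Bochner_Integration.integrable_bound[OF integrable_unitm_const[of "1::real"]])
      show "(\<lambda>y. circ 1 y powi (- n i)) \<in> borel_measurable unitm" unfolding power_int_def by measurable
    qed (simp add: norm_power_int)
  qed simp
  also have "\<dots> = (\<Prod>i<m. if n i = 0 then 1 else 0)"
  proof (rule prod.cong)
    fix i
    have c: "continuous_on UNIV (\<lambda>y. circ 1 y powi (- n i))"
      by (intro continuous_on_power_int continuous_circ) (auto simp: circ_def)
    show "integral\<^sup>L unitm (\<lambda>y. circ 1 y powi (- n i)) = (if n i = 0 then 1 else 0)"
      unfolding integral_unitm[OF c] using circle_mean_powi[of "- n i"] by simp
  qed simp
  also have "\<dots> = (if \<forall>i<m. n i = 0 then 1 else 0)"
    by (auto simp: prod_zero_iff)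
  finally show ?thesis .
qed

end

text \<open>The form in which \<open>1 / q\<close> reaches operators and matrices: coefficients
  summable against the maximum of each monomial on the polyannulus, and the formal identity that
  their product with \<open>q\<close> is 1.\<close>

lemma laurent_inverse:
  assumes "0 < r" "r < 1" "q \<in> mpolys m"
    and "\<And>z. (\<And>i. i < m \<Longrightarrow> z i \<in> closed_annulus r) \<Longrightarrow> mpoly_eval m q z \<noteq> 0"
  obtains a :: "(nat \<Rightarrow> int) \<Rightarrow> complex" where
    "(\<lambda>n. cmod (a n) * (\<Prod>i<m. max 1 (r powi n i))) summable_on zidx m"
    "\<And>n. (\<Sum>\<alpha>\<in>{\<alpha>. q \<alpha> \<noteq> 0}. q \<alpha> * a (\<lambda>i. n i - int (\<alpha> i))) = (if \<forall>i<m. n i = 0 then 1 else 0)"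
proof -
  obtain \<epsilon> M where eM: "0 < \<epsilon>" "\<epsilon> < r" "0 < M" "\<And>z. (\<And>i. i < m \<Longrightarrow> r - \<epsilon> \<le> cmod (z i) \<and> cmod (z i) \<le> 1 + \<epsilon>) \<Longrightarrow>
      mpoly_eval m q z \<noteq> 0 \<and> 1 / cmod (mpoly_eval m q z) \<le> M"
    using polyannulus_enlarge[OF assms(1,2,4)] by blast
  note ctx = assms(1,2) eM(1,2,3) assms(3) eM(4)
  let ?a = "lint m q (\<lambda>_. 1)"
  obtain \<sigma> where \<sigma>: "0 < \<sigma>" "\<sigma> < 1" "\<And>n. cmod (?a n) * (\<Prod>i<m. max 1 (r powi n i)) \<le> M * (\<Prod>i<m. \<sigma> ^ nat \<bar>n i\<bar>)"
    using lint_bound[OF ctx] by blast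
  show ?thesis
  proof (rule that[of ?a])
    show "(\<lambda>n. cmod (?a n) * (\<Prod>i<m. max 1 (r powi n i))) summable_on zidx m"
    proof (rule summable_on_comparison_test[OF _ \<sigma>(3)])
      show "(\<lambda>n. M * (\<Prod>i<m. \<sigma> ^ nat \<bar>n i\<bar>)) summable_on zidx m"
        by (intro summable_on_cmult_right summable_on_zidx_geometric \<sigma>)
    qed (auto intro!: mult_nonneg_nonneg prod_nonneg)
    show "(\<Sum>\<alpha>\<in>{\<alpha>. q \<alpha> \<noteq> 0}. q \<alpha> * ?a (\<lambda>i. n i - int (\<alpha> i))) = (if \<forall>i<m. n i = 0 then 1 else 0)" for n
      by (rule lint_convolution[OF ctx])
  qed
qed

section \<open>Weighted permutations of an orthonormal basis\<close>


lemma infsum_diff_complex: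
  fixes f g :: "_ \<Rightarrow> complex"
  assumes "f summable_on A" "g summable_on A"
  shows "infsum (\<lambda>x. f x - g x) A = infsum f A - infsum g A"
  using infsum_add[OF assms(1) summable_on_uminus[THEN iffD2, OF assms(2)]] by (simp add: infsum_uminus)

lemma mem_l2_iff: "x \<in> l2 \<longleftrightarrow> sqs x"
  unfolding l2_def sqs_def by (simp add: summable_on_UNIV_nonneg_real_iff)

lemma l2_inner_infsum:
  assumes "sqs x" "sqs y"
  shows "l2_inner x y = (\<Sum>\<^sub>\<infinity>n. cnj (x n) * y n)"
proof -
  have "(\<lambda>n. cnj (x n) * y n) summable_on UNIV" by (intro sqs_mult_summable sqs_cnj assms)
  then have "(\<lambda>n. cnj (x n) * y n) sums (\<Sum>\<^sub>\<infinity>n. cnj (x n) * y n)"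
    by (intro has_sum_imp_sums has_sum_infsum)
  then show ?thesis unfolding l2_inner_def by (rule sums_unique[symmetric])
qed

lemma l2_norm_infsum:
  assumes "sqs x"
  shows "l2_norm x = sqrt (\<Sum>\<^sub>\<infinity>n. (cmod (x n))\<^sup>2)"
proof -
  have "(\<lambda>n. (cmod (x n))\<^sup>2) sums (\<Sum>\<^sub>\<infinity>n. (cmod (x n))\<^sup>2)"
    using assms unfolding sqs_def by (intro has_sum_imp_sums has_sum_infsum)
  then show ?thesis unfolding l2_norm_def by (simp add: sums_iff)
qed

lemma sqs_bounded:
  assumes "sqs x"
  obtains C where "0 \<le> C" "\<And>j. cmod (x j) \<le> C"
proof
  show "0 \<le> sqrt (\<Sum>\<^sub>\<infinity>n. (cmod (x n))\<^sup>2)" by (intro real_sqrt_ge_zero infsum_nonneg) auto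
  fix j
  have "(cmod (x j))\<^sup>2 = (\<Sum>n\<in>{j}. (cmod (x n))\<^sup>2)" by simp
  also have "\<dots> \<le> (\<Sum>\<^sub>\<infinity>n. (cmod (x n))\<^sup>2)"
    using assms unfolding sqs_def by (intro finite_sum_le_infsum) auto
  finally show "cmod (x j) \<le> sqrt (\<Sum>\<^sub>\<infinity>n. (cmod (x n))\<^sup>2)" by (rule real_le_rsqrt)
qed

lemma infsum_Cauchy_Schwarz:
  fixes a b :: "'n \<Rightarrow> real"
  assumes "\<And>n. n \<in> N \<Longrightarrow> 0 \<le> a n" "\<And>n. n \<in> N \<Longrightarrow> 0 \<le> b n" "a summable_on N" "(\<lambda>n. a n * (b n)\<^sup>2) summable_on N" "(\<lambda>n. a n * b n) summable_on N"
  shows "(infsum (\<lambda>n. a n * b n) N)\<^sup>2 \<le> infsum a N * infsum (\<lambda>n. a n * (b n)\<^sup>2) N"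
proof -
  let ?R = "infsum a N * infsum (\<lambda>n. a n * (b n)\<^sup>2) N"
  have R0: "0 \<le> ?R" using assms by (intro mult_nonneg_nonneg infsum_nonneg) auto
  have "infsum (\<lambda>n. a n * b n) N \<le> sqrt ?R"
  proof (rule infsum_le_finite_sums[OF assms(5)])
    fix F assume F: "finite F" "F \<subseteq> N"
    have "(\<Sum>n\<in>F. a n * b n)\<^sup>2 = (\<Sum>n\<in>F. sqrt (a n) * (sqrt (a n) * b n))\<^sup>2"
      using assms(1) F by (intro arg_cong[where f = "\<lambda>x. x\<^sup>2"] sum.cong) (auto simp flip: mult.assoc)
    also have "\<dots> \<le> (\<Sum>n\<in>F. (sqrt (a n))\<^sup>2) * (\<Sum>n\<in>F. (sqrt (a n) * b n)\<^sup>2)"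
      by (rule Cauchy_Schwarz_ineq_sum)
    also have "\<dots> = (\<Sum>n\<in>F. a n) * (\<Sum>n\<in>F. a n * (b n)\<^sup>2)"
      using assms(1) F by (intro arg_cong2[where f = "(*)"] sum.cong) (auto simp: power_mult_distrib)
    also have "\<dots> \<le> ?R"
      using assms F by (intro mult_mono finite_sum_le_infsum sum_nonneg infsum_nonneg) auto
    finally show "(\<Sum>n\<in>F. a n * b n) \<le> sqrt ?R" by (rule real_le_rsqrt)
  qed
  moreover have "0 \<le> infsum (\<lambda>n. a n * b n) N" using assms by (intro infsum_nonneg) auto
  ultimately have "(infsum (\<lambda>n. a n * b n) N)\<^sup>2 \<le> (sqrt ?R)\<^sup>2" by (rule power_mono)
  then show ?thesis using R0 by simp
qed

text \<open>Young's inequality for an absolutely summable family of permutations: Cauchy-Schwarz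
  with the weight \<open>A\<close>, then Fubini, where each bijection preserves the norm of
  \<open>x\<close>.\<close>

lemma young_sqs:
  fixes g :: "'n \<Rightarrow> 'j \<Rightarrow> complex" and \<rho> :: "'n \<Rightarrow> 'j \<Rightarrow> 'j"
  assumes "sqs x" "A summable_on N" "\<And>n j. n \<in> N \<Longrightarrow> cmod (g n j) \<le> A n" "\<And>n. n \<in> N \<Longrightarrow> bij (\<rho> n)"
  shows "(\<lambda>n. g n j * x (\<rho> n j)) summable_on N" "sqs (\<lambda>j. infsum (\<lambda>n. g n j * x (\<rho> n j)) N)"
proof -
  have A0: "0 \<le> A n" if "n \<in> N" for n using assms(3)[OF that] order_trans[OF norm_ge_zero] by blast
  obtain C where C: "0 \<le> C" "\<And>j. cmod (x j) \<le> C" using sqs_bounded[OF assms(1)] by blast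
  have gx: "cmod (g n j * x (\<rho> n j)) \<le> A n * cmod (x (\<rho> n j))" if "n \<in> N" for n j
    unfolding norm_mult by (rule mult_right_mono[OF assms(3)[OF that]]) simp
  have S1: "(\<lambda>n. A n * cmod (x (\<rho> n j))) summable_on N" for j
    by (rule summable_on_comparison_test[OF summable_on_cmult_left[OF assms(2), of C]])
       (use A0 C in \<open>auto intro!: mult_left_mono\<close>)
  have S2: "(\<lambda>n. A n * (cmod (x (\<rho> n j)))\<^sup>2) summable_on N" for j
    by (rule summable_on_comparison_test[OF summable_on_cmult_left[OF assms(2), of "C\<^sup>2"]])
       (use A0 C in \<open>auto intro!: mult_left_mono power_mono\<close>)
  show S0: "(\<lambda>n. g n j * x (\<rho> n j)) summable_on N" for j
    by (rule summable_on_norm_comparison[OF S1 gx])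
  define K where "K = infsum A N"
  have K0: "0 \<le> K" unfolding K_def using A0 by (intro infsum_nonneg) auto
  have bound: "(cmod (infsum (\<lambda>n. g n j * x (\<rho> n j)) N))\<^sup>2 \<le> K * infsum (\<lambda>n. A n * (cmod (x (\<rho> n j)))\<^sup>2) N" for j
  proof -
    have "(\<lambda>n. cmod (g n j * x (\<rho> n j))) summable_on N" by (rule summable_on_iff_abs_summable_on_complex[THEN iffD1, OF S0])
    then have "cmod (infsum (\<lambda>n. g n j * x (\<rho> n j)) N) \<le> infsum (\<lambda>n. A n * cmod (x (\<rho> n j))) N"
      by (intro order_trans[OF norm_infsum_bound] infsum_mono S1 gx)
    then have "(cmod (infsum (\<lambda>n. g n j * x (\<rho> n j)) N))\<^sup>2 \<le> (infsum (\<lambda>n. A n * cmod (x (\<rho> n j))) N)\<^sup>2"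
      by (rule power_mono) simp
    also have "\<dots> \<le> K * infsum (\<lambda>n. A n * (cmod (x (\<rho> n j)))\<^sup>2) N"
      unfolding K_def by (rule infsum_Cauchy_Schwarz) (use A0 assms(2) S1 S2 in auto)
    finally show ?thesis .
  qed
  let ?f = "\<lambda>(n, j). A n * (cmod (x (\<rho> n j)))\<^sup>2"
  have "(\<lambda>p. norm (?f p)) summable_on N \<times> UNIV"
    unfolding Infinite_Sum.abs_summable_on_Sigma_iff
  proof (intro conjI ballI)
    fix n assume n: "n \<in> N"
    have x: "(\<lambda>j. (cmod (x (\<rho> n j)))\<^sup>2) summable_on UNIV"
      using assms(1) sqs_reindex[OF assms(4)[OF n], of x] unfolding sqs_def by blast
    then show "(\<lambda>j. norm (?f (n, j))) summable_on UNIV"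
      using summable_on_cmult_right[OF x, of "A n"] A0[OF n] by simp
  next
    have "infsum (\<lambda>j. norm (?f (n, j))) UNIV = A n * infsum (\<lambda>j. (cmod (x j))\<^sup>2) UNIV" if "n \<in> N" for n
      using infsum_reindex_bij_betw[of "\<rho> n" UNIV UNIV "\<lambda>j. (cmod (x j))\<^sup>2"] assms(4)[OF that] A0[OF that]
      by (simp add: infsum_cmult_right')
    then have "(\<lambda>n. infsum (\<lambda>j. norm (?f (n, j))) UNIV) summable_on N"
      using summable_on_cmult_left[OF assms(2), of "infsum (\<lambda>j. (cmod (x j))\<^sup>2) UNIV"]
      by (simp cong: summable_on_cong)
    moreover have "norm (infsum (\<lambda>j. norm (?f (n, j))) UNIV) = infsum (\<lambda>j. norm (?f (n, j))) UNIV" for n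
      by (simp add: infsum_nonneg)
    ultimately show "(\<lambda>n. norm (infsum (\<lambda>j. norm (?f (n, j))) UNIV)) summable_on N" by simp
  qed
  then have "?f summable_on N \<times> UNIV" by (rule Infinite_Sum.abs_summable_summable)
  then have "(\<lambda>(j, n). A n * (cmod (x (\<rho> n j)))\<^sup>2) summable_on UNIV \<times> N"
    using summable_on_swap[of "\<lambda>(n, j). A n * (cmod (x (\<rho> n j)))\<^sup>2" N UNIV] by (simp add: case_prod_unfold)
  then have "(\<lambda>j. infsum (\<lambda>n. A n * (cmod (x (\<rho> n j)))\<^sup>2) N) summable_on UNIV"
    by (rule summable_on_Sigma_banach)
  then have "(\<lambda>j. K * infsum (\<lambda>n. A n * (cmod (x (\<rho> n j)))\<^sup>2) N) summable_on UNIV"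
    by (rule summable_on_cmult_right)
  then show "sqs (\<lambda>j. infsum (\<lambda>n. g n j * x (\<rho> n j)) N)"
    unfolding sqs_def by (rule summable_on_comparison_test) (use bound in auto)
qed

text \<open>An action \<open>Q\<close> of integer exponents on the indices of an orthonormal basis,
  with weights constant on orbits. On each orbit the operator \<open>U i\<close> below is a scalar
  of modulus 1 or \<open>r\<close> times a permutation; this makes the operators commuting and
  normal and puts their spectra on the two circles.\<close>

locale wperm =
  fixes r :: real and m :: nat and Q :: "(nat \<Rightarrow> int) \<Rightarrow> nat \<Rightarrow> nat" and s :: "nat \<Rightarrow> nat \<Rightarrow> complex"
  assumes r: "0 < r" "r < 1"
    and Q_0: "Q (\<lambda>_. 0) j = j"
    and Q_add: "Q n (Q n' j) = Q (\<lambda>i. n i + n' i) j"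
    and s_inv: "s i (Q n j) = s i j"
    and s_mod: "cmod (s i j) = 1 \<or> cmod (s i j) = r"
begin

definition idx1 :: "nat \<Rightarrow> int \<Rightarrow> nat \<Rightarrow> int" where "idx1 i k = (\<lambda>l. if l = i then k else 0)"

definition U :: "nat \<Rightarrow> l2op" where "U i x = (\<lambda>j. s i j * x (Q (idx1 i 1) j))"

definition sm :: "(nat \<Rightarrow> int) \<Rightarrow> nat \<Rightarrow> complex" where "sm n j = (\<Prod>i<m. s i j powi n i)"

definition wmax :: "(nat \<Rightarrow> int) \<Rightarrow> real" where "wmax n = (\<Prod>i<m. max 1 (r powi n i))"

lemma s_nz: "s i j \<noteq> 0"
  using s_mod[of i j] r by auto

lemma s_le_1: "cmod (s i j) \<le> 1"
  using s_mod[of i j] r by auto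

lemma Q_cancel: "Q n (Q (\<lambda>i. - n i) j) = j" "Q (\<lambda>i. - n i) (Q n j) = j"
  by (simp_all add: Q_add Q_0)

lemma bij_Q: "bij (Q n)"
  by (rule bij_betw_byWitness[where f' = "Q (\<lambda>i. - n i)"]) (auto simp: Q_cancel)

lemma Q_idx1_add: "Q (idx1 i k) (Q (idx1 i k') j) = Q (idx1 i (k + k')) j"
proof -
  have "(\<lambda>l. idx1 i k l + idx1 i k' l) = idx1 i (k + k')" by (auto simp: idx1_def)
  then show ?thesis by (simp add: Q_add)
qed

lemma Q_idx1_0: "Q (idx1 i 0) j = j"
proof -
  have "idx1 i 0 = (\<lambda>_. 0)" by (auto simp: idx1_def)
  then show ?thesis by (simp add: Q_0)
qed

lemma Q_commute: "Q n (Q n' j) = Q n' (Q n j)"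
  by (simp add: Q_add add.commute)

lemma U_sqs:
  assumes "sqs x"
  shows "sqs (U i x)"
  unfolding U_def using assms s_le_1 sqs_reindex[OF bij_Q, of x] by (intro sqs_bounded_mult) auto

lemma U_commute: "U i (U k x) = U k (U i x)"
  by (simp add: U_def fun_eq_iff s_inv Q_commute[of "idx1 i 1"] mult.left_commute)

definition Uadj :: "nat \<Rightarrow> l2op" where "Uadj i x = (\<lambda>j. cnj (s i j) * x (Q (idx1 i (- 1)) j))"

lemma weighted_perm_bounded_op:
  assumes "\<And>j. cmod (c j) \<le> 1" "bij \<rho>"
  shows "l2_bounded_op (\<lambda>x j. c j * x (\<rho> j))"
  unfolding l2_bounded_op_def
proof (intro conjI ballI allI)
  have sq: "sqs (\<lambda>j. c j * x (\<rho> j))" if "sqs x" for x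
    using that assms(1) sqs_reindex[OF assms(2), of x] by (intro sqs_bounded_mult) auto
  show "(\<lambda>j. c j * x (\<rho> j)) \<in> l2" if "x \<in> l2" for x using that sq by (simp add: mem_l2_iff)
  show "(\<lambda>j. c j * (a * x (\<rho> j) + b * y (\<rho> j))) = (\<lambda>n. a * (c n * x (\<rho> n)) + b * (c n * y (\<rho> n)))" for x y a b
    by (simp add: fun_eq_iff algebra_simps)
  have "l2_norm (\<lambda>j. c j * x (\<rho> j)) \<le> 1 * l2_norm x" if "x \<in> l2" for x
  proof -
    have x: "sqs x" using that by (simp add: mem_l2_iff)
    have xr: "(\<lambda>j. (cmod (x (\<rho> j)))\<^sup>2) summable_on UNIV" using x sqs_reindex[OF assms(2), of x] unfolding sqs_def by blast
    have "(\<Sum>\<^sub>\<infinity>j. (cmod (c j * x (\<rho> j)))\<^sup>2) \<le> (\<Sum>\<^sub>\<infinity>j. (cmod (x (\<rho> j)))\<^sup>2)"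
    proof (rule infsum_mono)
      show "(\<lambda>j. (cmod (c j * x (\<rho> j)))\<^sup>2) summable_on UNIV" using sq[OF x] unfolding sqs_def .
      show "(cmod (c j * x (\<rho> j)))\<^sup>2 \<le> (cmod (x (\<rho> j)))\<^sup>2" for j
        unfolding norm_mult by (intro power_mono mult_left_le_one_le) (use assms(1) in auto)
    qed (rule xr)
    also have "\<dots> = (\<Sum>\<^sub>\<infinity>j. (cmod (x j))\<^sup>2)"
      using infsum_reindex_bij_betw[of \<rho> UNIV UNIV "\<lambda>j. (cmod (x j))\<^sup>2"] assms(2) by simp
    finally show ?thesis unfolding l2_norm_infsum[OF sq[OF x]] l2_norm_infsum[OF x] by simp
  qed
  then show "\<exists>C. \<forall>x\<in>l2. l2_norm (\<lambda>j. c j * x (\<rho> j)) \<le> C * l2_norm x" by blast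
qed

lemma U_bounded_op: "l2_bounded_op (U i)" "l2_bounded_op (Uadj i)"
proof -
  have "U i = (\<lambda>x j. s i j * x (Q (idx1 i 1) j))" "Uadj i = (\<lambda>x j. cnj (s i j) * x (Q (idx1 i (- 1)) j))"
    by (simp_all add: fun_eq_iff U_def Uadj_def)
  then show "l2_bounded_op (U i)" "l2_bounded_op (Uadj i)"
    using weighted_perm_bounded_op[of "s i" "Q (idx1 i 1)"] weighted_perm_bounded_op[of "\<lambda>j. cnj (s i j)" "Q (idx1 i (- 1))"]
      s_le_1 bij_Q by simp_all
qed

lemma U_normal: "l2_normal (U i)"
  unfolding l2_normal_def
proof (intro conjI exI[of _ "Uadj i"])
  show "l2_bounded_op (U i)" by (rule U_bounded_op)
  have "l2_inner (U i x) y = l2_inner x (Uadj i y)" if "x \<in> l2" "y \<in> l2" for x y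
  proof -
    have xy: "sqs x" "sqs y" using that by (auto simp: mem_l2_iff)
    have "Uadj i y \<in> l2" using U_bounded_op(2) that unfolding l2_bounded_op_def by blast
    then have ay: "sqs (Uadj i y)" by (simp add: mem_l2_iff)
    have bij: "bij_betw (Q (idx1 i 1)) UNIV UNIV" by (rule bij_Q)
    have "l2_inner x (Uadj i y) = infsum (\<lambda>j. cnj (x (Q (idx1 i 1) j)) * Uadj i y (Q (idx1 i 1) j)) UNIV"
      unfolding l2_inner_infsum[OF xy(1) ay] using infsum_reindex_bij_betw[OF bij, of "\<lambda>j. cnj (x j) * Uadj i y j"] by simp
    also have "\<dots> = infsum (\<lambda>j. cnj (U i x j) * y j) UNIV"
      by (simp add: Uadj_def U_def s_inv Q_idx1_add Q_idx1_0 ac_simps)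
    finally show ?thesis unfolding l2_inner_infsum[OF U_sqs[OF xy(1)] xy(2)] by simp
  qed
  then show "l2_is_adjoint (U i) (Uadj i)" unfolding l2_is_adjoint_def using U_bounded_op by blast
  show "\<forall>x\<in>l2. U i (Uadj i x) = Uadj i (U i x)"
    by (simp add: U_def Uadj_def fun_eq_iff s_inv Q_idx1_add Q_idx1_0 mult.left_commute)
qed

text \<open>Off the two circles the resolvent is a Neumann series in \<open>U i\<close> or in its
  inverse, according to whether \<open>cmod c\<close> lies above or below the weight. The weight is
  constant on orbits, so the choice commutes with the permutation.\<close>

lemma U_spectrum: "l2_spectrum (U i) \<subseteq> annulus_boundary r"
proof
  fix c assume "c \<in> l2_spectrum (U i)"
  then have nb: "\<not> bij_betw (\<lambda>x n. U i x n - c * x n) l2 l2" by (simp add: l2_spectrum_def)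
  show "c \<in> annulus_boundary r"
  proof (rule ccontr)
    assume "c \<notin> annulus_boundary r"
    then have c: "cmod c \<noteq> 1" "cmod c \<noteq> r" by (auto simp: annulus_boundary_def)
    \<comment> \<open>The coefficient of the \<open>k\<close>-th translate in the resolvent:
      \<open>c powi (- k - 1) * s i j powi k\<close> over \<open>k < 0\<close> when \<open>c\<close>
      is inside, and its negative over \<open>k \<ge> 0\<close> when \<open>c\<close> is
      outside.\<close>
    define g where "g k j = (if cmod c < cmod (s i j) then (if k < 0 then c powi (- k - 1) * s i j powi k else 0)
      else (if k \<ge> 0 then - (s i j powi k * c powi (- k - 1)) else 0))" for k :: int and j
    define A0 where "A0 d k = (if cmod c < d then (if k < 0 then cmod c powi (- k - 1) * d powi k else 0)
      else (if k \<ge> 0 then d powi k * cmod c powi (- k - 1) else 0))" for d :: real and k :: int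
    have A0nn: "0 \<le> A0 d k" if "d > 0" for d k using that by (simp add: A0_def)
    have A0s: "A0 d summable_on UNIV" if "d > 0" "cmod c \<noteq> d" for d
    proof (cases "cmod c < d")
      case True
      \<comment> \<open>The bound \<open>1 / 2\<close> keeps the ratio positive when
        \<open>c = 0\<close>.\<close>
      define \<tau> where "\<tau> = max (1 / 2) (cmod c / d)"
      have \<tau>: "0 < \<tau>" "\<tau> < 1" unfolding \<tau>_def using True that by (auto simp: less_max_iff_disj)
      have "A0 d k \<le> 1 / d / \<tau> * \<tau> ^ nat \<bar>k\<bar>" for k
      proof (cases "k < 0")
        case neg: True
        define l where "l = nat (- k - 1)"
        have k: "k = - int l - 1" using neg by (simp add: l_def)
        have "A0 d k = (cmod c / d) ^ l / d"
          using True that unfolding A0_def k by (simp add: power_int_diff power_int_minus power_divide field_simps)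
        also have "\<dots> \<le> \<tau> ^ l / d" using that by (intro divide_right_mono power_mono) (auto simp: \<tau>_def)
        also have "\<dots> = 1 / d / \<tau> * \<tau> ^ nat \<bar>k\<bar>"
        proof -
          have "nat \<bar>k\<bar> = Suc l" using k by simp
          then show ?thesis using \<tau> by simp
        qed
        finally show ?thesis .
      next
        case False
        then show ?thesis using True that \<tau> by (simp add: A0_def)
      qed
      then show ?thesis
        by (rule summable_on_comparison_test[OF summable_on_cmult_right[OF summable_on_geometric_int[OF \<tau>]] _ A0nn[OF that(1)]])
    next
      case False
      then have cd: "d < cmod c" using that by simp
      define \<tau> where "\<tau> = d / cmod c"
      have c0: "cmod c > 0" using cd that by linarith
      have \<tau>: "0 < \<tau>" "\<tau> < 1" unfolding \<tau>_def using cd that c0 by (simp_all only: divide_pos_pos divide_less_eq_1_pos)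
      have "A0 d k \<le> 1 / cmod c * \<tau> ^ nat \<bar>k\<bar>" for k
      proof (cases "k \<ge> 0")
        case True
        define l where "l = nat k"
        have k: "k = int l" using True by (simp add: l_def)
        show ?thesis using False c0 unfolding A0_def k \<tau>_def
          by (simp add: power_int_diff power_int_minus power_divide field_simps)
      next
        case neg: False
        then show ?thesis using False \<tau> c0 by (simp add: A0_def)
      qed
      then show ?thesis
        by (rule summable_on_comparison_test[OF summable_on_cmult_right[OF summable_on_geometric_int[OF \<tau>]] _ A0nn[OF that(1)]])
    qed
    have As: "(\<lambda>k. A0 1 k + A0 r k) summable_on UNIV"
      by (intro summable_on_add A0s) (use r c in auto)
    have gA: "cmod (g k j) \<le> A0 1 k + A0 r k" for k j
    proof -
      have "cmod (g k j) = A0 (cmod (s i j)) k" by (simp add: g_def A0_def norm_mult norm_power_int)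
      then show ?thesis using s_mod[of i j] A0nn[of 1 k] A0nn[of r k] r by auto
    qed
    note Y = young_sqs[where \<rho> = "\<lambda>k. Q (idx1 i k)", OF _ As gA bij_Q]
    define R where "R x j = infsum (\<lambda>k. g k j * x (Q (idx1 i k) j)) UNIV" for x :: "nat \<Rightarrow> complex" and j
    have Rsq: "sqs (R x)" if "sqs x" for x unfolding R_def by (rule Y(2)[OF that])
    have gi: "g k (Q n j) = g k j" for k n j by (simp add: g_def s_inv)
    \<comment> \<open>This recurrence in \<open>k\<close> is the resolvent equation for the
      coefficients; the jump at \<open>k = 0\<close> produces the identity.\<close>
    have grec: "s i j * g (k - 1) j - c * g k j = (if k = 0 then 1 else 0)" for k j
    proof (cases "cmod c < cmod (s i j)")
      case True
      have cp: "c powi (- k) = c * c powi (- k - 1)" if "k < 0"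
        using that power_int_add_1'[of c "- k - 1"] by (simp add: power_int_0_left_if)
      have sp: "s i j powi k = s i j * s i j powi (k - 1)" using power_int_add[of "s i j" 1 "k - 1"] s_nz[of i j] by simp
      show ?thesis using True s_nz[of i j] cp sp by (cases "k < 0"; cases "k = 0") (auto simp: g_def power_int_minus)
    next
      case False
      then have c0: "c \<noteq> 0" using s_nz[of i j] by auto
      have sp: "s i j powi k = s i j * s i j powi (k - 1)" using power_int_add[of "s i j" 1 "k - 1"] s_nz[of i j] by simp
      have cp: "c powi (- k) = c * c powi (- k - 1)" using power_int_add[of c 1 "- k - 1"] c0 by simp
      show ?thesis using False sp cp c0 by (cases "k > 0"; cases "k = 0") (auto simp: g_def power_int_minus field_simps)
    qed
    have key: "infsum (\<lambda>k. g k j * (s i j * x (Q (idx1 i (k + 1)) j))) UNIV - c * R x j = x j" if xs: "sqs x" for x j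
    proof -
      let ?h = "\<lambda>k. g k j * x (Q (idx1 i k) j)"
      let ?h' = "\<lambda>k. s i j * g (k - 1) j * x (Q (idx1 i k) j)"
      have s1: "?h summable_on UNIV" by (rule Y(1)[OF xs])
      obtain C where C: "0 \<le> C" "\<And>j. cmod (x j) \<le> C" using sqs_bounded[OF xs] by blast
      have s2: "?h' summable_on UNIV"
      proof (rule summable_on_norm_comparison)
        have "(\<lambda>k. A0 1 (k + (- 1)) + A0 r (k + (- 1))) summable_on UNIV"
          using As summable_on_shift_int[of "\<lambda>k. A0 1 k + A0 r k" "- 1"] by blast
        then show "(\<lambda>k. (A0 1 (k - 1) + A0 r (k - 1)) * C) summable_on UNIV"
          using summable_on_cmult_left by fastforce
        show "cmod (?h' k) \<le> (A0 1 (k - 1) + A0 r (k - 1)) * C" for k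
        proof -
          have "cmod (s i j) * cmod (g (k - 1) j) \<le> 1 * (A0 1 (k - 1) + A0 r (k - 1))"
            by (intro mult_mono s_le_1 gA) auto
          then show ?thesis unfolding norm_mult using C A0nn[of 1] A0nn[of r] r by (intro mult_mono) auto
        qed
      qed
      have "infsum (\<lambda>k. g k j * (s i j * x (Q (idx1 i (k + 1)) j))) UNIV = infsum ?h' UNIV"
        using infsum_shift_int[of ?h' 1] by (simp add: ac_simps)
      moreover have "c * R x j = infsum (\<lambda>k. c * ?h k) UNIV" unfolding R_def by (simp add: infsum_cmult_right')
      ultimately have "infsum (\<lambda>k. g k j * (s i j * x (Q (idx1 i (k + 1)) j))) UNIV - c * R x j
        = infsum (\<lambda>k. ?h' k - c * ?h k) UNIV"
        using infsum_diff_complex[OF s2 summable_on_cmult_right[OF s1, of c]] by simp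
      also have "\<dots> = infsum (\<lambda>k. (if k = 0 then 1 else 0) * x (Q (idx1 i k) j)) UNIV"
      proof (rule infsum_cong)
        fix k
        have "?h' k - c * ?h k = (s i j * g (k - 1) j - c * g k j) * x (Q (idx1 i k) j)" by (simp add: algebra_simps)
        then show "?h' k - c * ?h k = (if k = 0 then 1 else 0) * x (Q (idx1 i k) j)" unfolding grec .
      qed
      also have "\<dots> = infsum (\<lambda>k. (if k = 0 then 1 else 0) * x (Q (idx1 i k) j)) {0}"
        by (rule infsum_cong_neutral) auto
      finally show ?thesis by (simp add: Q_idx1_0)
    qed
    have UR: "U i (R x) j - c * R x j = x j" if "sqs x" for x j
    proof -
      have "U i (R x) j = infsum (\<lambda>k. g k j * (s i j * x (Q (idx1 i (k + 1)) j))) UNIV"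
        unfolding U_def R_def gi Q_idx1_add infsum_cmult_right'[symmetric] by (simp add: ac_simps)
      then show ?thesis using key[OF that] by simp
    qed
    have RU: "R (\<lambda>j. U i x j - c * x j) j = x j" if "sqs x" for x j
    proof -
      have "g k j * (U i x (Q (idx1 i k) j) - c * x (Q (idx1 i k) j))
          = g k j * (s i j * x (Q (idx1 i (k + 1)) j)) - c * (g k j * x (Q (idx1 i k) j))" for k
        by (simp add: U_def s_inv Q_idx1_add algebra_simps)
      then have "R (\<lambda>j. U i x j - c * x j) j = infsum (\<lambda>k. g k j * (s i j * x (Q (idx1 i (k + 1)) j)) - c * (g k j * x (Q (idx1 i k) j))) UNIV"
        unfolding R_def by simp
      also have "\<dots> = infsum (\<lambda>k. g k j * (s i j * x (Q (idx1 i (k + 1)) j))) UNIV - infsum (\<lambda>k. c * (g k j * x (Q (idx1 i k) j))) UNIV"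
      proof (rule infsum_diff_complex)
        have "(\<lambda>k. g k j * U i x (Q (idx1 i k) j)) summable_on UNIV" by (rule Y(1)[OF U_sqs[OF that]])
        then show "(\<lambda>k. g k j * (s i j * x (Q (idx1 i (k + 1)) j))) summable_on UNIV"
          by (simp add: U_def s_inv Q_idx1_add add.commute)
        show "(\<lambda>k. c * (g k j * x (Q (idx1 i k) j))) summable_on UNIV"
          by (rule summable_on_cmult_right[OF Y(1)[OF that]])
      qed
      also have "\<dots> = x j" using key[OF that, of j] unfolding R_def by (simp add: infsum_cmult_right')
      finally show ?thesis .
    qed
    have Tsq: "sqs (\<lambda>j. U i x j - c * x j)" if "sqs x" for x
    proof -
      have "(\<lambda>j. (cmod (U i x j))\<^sup>2) summable_on UNIV" "(\<lambda>j. (cmod (c * x j))\<^sup>2) summable_on UNIV"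
        using U_sqs[OF that] sqs_scale[OF that, of c] unfolding sqs_def by auto
      then have "(\<lambda>j. 2 * (cmod (U i x j))\<^sup>2 + 2 * (cmod (c * x j))\<^sup>2) summable_on UNIV"
        by (intro summable_on_add summable_on_cmult_right)
      moreover have "(cmod (u - v))\<^sup>2 \<le> 2 * (cmod u)\<^sup>2 + 2 * (cmod v)\<^sup>2" for u v
      proof -
        have "(cmod (u - v))\<^sup>2 \<le> (cmod u + cmod v)\<^sup>2" by (intro power_mono norm_triangle_ineq4) auto
        also have "\<dots> \<le> 2 * (cmod u)\<^sup>2 + 2 * (cmod v)\<^sup>2" using zero_le_power2[of "cmod u - cmod v"] by (simp add: power2_eq_square algebra_simps)
        finally show ?thesis .
      qed
      ultimately show ?thesis unfolding sqs_def by (rule summable_on_comparison_test) auto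
    qed
    have "bij_betw (\<lambda>x n. U i x n - c * x n) l2 l2"
      by (rule bij_betw_byWitness[where f' = R]) (auto simp: mem_l2_iff Tsq Rsq RU UR fun_eq_iff)
    then show False using nb by blast
  qed
qed

lemma U_unitary: "Ar_unitary r (U i)"
  unfolding Ar_unitary_def using U_normal U_spectrum by blast

end

section \<open>Laurent series of weighted permutations\<close>


lemma infsum_finite_sum:
  fixes f :: "'c \<Rightarrow> 'd \<Rightarrow> complex"
  assumes "finite F" "\<And>c. c \<in> F \<Longrightarrow> f c summable_on A"
  shows "(\<lambda>n. \<Sum>c\<in>F. f c n) summable_on A \<and> infsum (\<lambda>n. \<Sum>c\<in>F. f c n) A = (\<Sum>c\<in>F. infsum (f c) A)"
  using assms
proof (induction F rule: finite_induct)
  case (insert x F)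
  then show ?case by (auto intro!: summable_on_add simp: infsum_add)
qed simp

lemma mult_le_sum_squares:
  fixes x y :: real
  assumes "0 \<le> x" "0 \<le> y"
  shows "x * y \<le> x\<^sup>2 + y\<^sup>2"
proof -
  have "2 * x * y \<le> x\<^sup>2 + y\<^sup>2" by (rule sum_squares_bound)
  moreover have "0 \<le> x * y" using assms by simp
  ultimately show ?thesis by linarith
qed

definition pconv :: "((nat \<Rightarrow> nat) \<Rightarrow> complex) \<Rightarrow> ((nat \<Rightarrow> int) \<Rightarrow> complex) \<Rightarrow> (nat \<Rightarrow> int) \<Rightarrow> complex" where
  "pconv p a n = (\<Sum>\<alpha>\<in>{\<alpha>. p \<alpha> \<noteq> 0}. p \<alpha> * a (\<lambda>i. n i - int (\<alpha> i)))"

lemma bij_zidx_shift: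
  assumes "\<forall>i\<ge>m. \<alpha> i = (0::nat)"
  shows "bij_betw (\<lambda>n i. n i + int (\<alpha> i)) (zidx m) (zidx m)"
  by (rule bij_betw_byWitness[where f' = "\<lambda>n i. n i - int (\<alpha> i)"]) (use assms in \<open>auto simp: zidx_def\<close>)

context wperm
begin

definition wsum :: "((nat \<Rightarrow> int) \<Rightarrow> complex) \<Rightarrow> bool" where
  "wsum a \<longleftrightarrow> (\<lambda>n. cmod (a n) * wmax n) summable_on zidx m"

lemma wmax_pos: "wmax n > 0"
  unfolding wmax_def by (intro prod_pos) (simp add: less_max_iff_disj)

lemma sm_le_wmax: "cmod (sm n j) \<le> wmax n"
proof -
  have "cmod (s i j) powi n i \<le> max 1 (r powi n i)" for i
    using s_mod[of i j] by auto
  then show ?thesis unfolding sm_def wmax_def prod_norm[symmetric] norm_power_int by (intro prod_mono) auto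
qed

lemma wmax_add: "wmax (\<lambda>i. n i + n' i) \<le> wmax n * wmax n'"
proof -
  have "max 1 (r powi (n i + n' i)) \<le> max 1 (r powi n i) * max 1 (r powi n' i)" for i
  proof -
    have "r powi (n i + n' i) = r powi n i * r powi n' i" using r by (simp add: power_int_add)
    also have "\<dots> \<le> max 1 (r powi n i) * max 1 (r powi n' i)"
      using r by (intro mult_mono) (auto simp: less_imp_le)
    moreover have "1 * 1 \<le> max 1 (r powi n i) * max 1 (r powi n' i)" by (rule mult_mono) auto
    ultimately show ?thesis by simp
  qed
  then show ?thesis unfolding wmax_def prod.distrib[symmetric] by (intro prod_mono) (auto simp: le_max_iff_disj)
qed

lemma sm_add: "sm (\<lambda>i. n i + n' i) j = sm n j * sm n' j"
  unfolding sm_def prod.distrib[symmetric] using s_nz by (intro prod.cong) (auto simp: power_int_add)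

lemma sm_inv: "sm n (Q n' j) = sm n j"
  by (simp add: sm_def s_inv)

lemma sm_0: "sm (\<lambda>_. 0) j = 1"
  by (simp add: sm_def)

lemma wsum_mult_summable:
  assumes "wsum a" "\<And>n. n \<in> zidx m \<Longrightarrow> cmod (\<phi> n) \<le> C * wmax n"
  shows "(\<lambda>n. a n * \<phi> n) summable_on zidx m"
proof (rule summable_on_norm_comparison)
  show "(\<lambda>n. (cmod (a n) * wmax n) * C) summable_on zidx m"
    using assms(1) unfolding wsum_def by (rule summable_on_cmult_left)
  show "cmod (a n * \<phi> n) \<le> cmod (a n) * wmax n * C" if "n \<in> zidx m" for n
    unfolding norm_mult using mult_left_mono[OF assms(2)[OF that] norm_ge_zero[of "a n"]] by (simp add: ac_simps)
qed

text \<open>Shifting the summation index moves the polynomial from the coefficients to the test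
  function. It is used for values of \<open>U\<close>-monomials, for entries of matrix powers, and
  for \<open>wmax\<close> itself.\<close>

lemma pconv_sum:
  assumes "wsum a" "p \<in> mpolys m" "\<And>n. n \<in> zidx m \<Longrightarrow> cmod (\<phi> n) \<le> C * wmax n"
  shows "infsum (\<lambda>n. pconv p a n * \<phi> n) (zidx m)
    = (\<Sum>\<alpha>\<in>{\<alpha>. p \<alpha> \<noteq> 0}. p \<alpha> * infsum (\<lambda>n. a n * \<phi> (\<lambda>i. n i + int (\<alpha> i))) (zidx m))"
    and "(\<lambda>n. pconv p a n * \<phi> n) summable_on zidx m"
    and "p \<alpha> \<noteq> 0 \<Longrightarrow> (\<lambda>n. a n * \<phi> (\<lambda>i. n i + int (\<alpha> i))) summable_on zidx m"
proof -
  have supp: "\<forall>i\<ge>m. \<alpha> i = 0" if "p \<alpha> \<noteq> 0" for \<alpha> using assms(2) that by (auto simp: mpolys_def)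
  have S: "(\<lambda>n. a n * \<phi> (\<lambda>i. n i + int (\<alpha> i))) summable_on zidx m" if "p \<alpha> \<noteq> 0" for \<alpha>
  proof (rule wsum_mult_summable[OF assms(1)])
    fix n assume n: "n \<in> zidx m"
    have "(\<lambda>i. n i + int (\<alpha> i)) \<in> zidx m" using n supp[OF that] by (auto simp: zidx_def)
    then have "cmod (\<phi> (\<lambda>i. n i + int (\<alpha> i))) \<le> C * wmax (\<lambda>i. n i + int (\<alpha> i))" by (rule assms(3))
    moreover have "0 \<le> C"
    proof -
      have "0 \<le> C * wmax n" using assms(3)[OF n] order_trans[OF norm_ge_zero] by blast
      then show ?thesis using wmax_pos[of n] by (simp add: zero_le_mult_iff)
    qed
    ultimately show "cmod (\<phi> (\<lambda>i. n i + int (\<alpha> i))) \<le> (C * wmax (\<lambda>i. int (\<alpha> i))) * wmax n"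
      using mult_left_mono[OF wmax_add[of n "\<lambda>i. int (\<alpha> i)"]] by (smt (verit) mult.assoc mult.commute)
  qed
  show "p \<alpha> \<noteq> 0 \<Longrightarrow> (\<lambda>n. a n * \<phi> (\<lambda>i. n i + int (\<alpha> i))) summable_on zidx m" by (rule S)
  have R: "infsum (\<lambda>n. a (\<lambda>i. n i - int (\<alpha> i)) * \<phi> n) (zidx m) = infsum (\<lambda>n. a n * \<phi> (\<lambda>i. n i + int (\<alpha> i))) (zidx m)"
    "(\<lambda>n. a (\<lambda>i. n i - int (\<alpha> i)) * \<phi> n) summable_on zidx m" if "p \<alpha> \<noteq> 0" for \<alpha>
    using infsum_reindex_bij_betw[OF bij_zidx_shift[OF supp[OF that]], of "\<lambda>n. a (\<lambda>i. n i - int (\<alpha> i)) * \<phi> n"]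
      summable_on_reindex_bij_betw[OF bij_zidx_shift[OF supp[OF that]], of "\<lambda>n. a (\<lambda>i. n i - int (\<alpha> i)) * \<phi> n"] S[OF that]
    by simp_all
  have fin: "finite {\<alpha>. p \<alpha> \<noteq> 0}" using assms(2) by (simp add: mpolys_def)
  have eq: "pconv p a n * \<phi> n = (\<Sum>\<alpha>\<in>{\<alpha>. p \<alpha> \<noteq> 0}. p \<alpha> * (a (\<lambda>i. n i - int (\<alpha> i)) * \<phi> n))" for n
    unfolding pconv_def sum_distrib_right by (simp add: mult.assoc)
  show "(\<lambda>n. pconv p a n * \<phi> n) summable_on zidx m"
    unfolding eq by (rule infsum_finite_sum[OF fin, THEN conjunct1]) (intro summable_on_cmult_right R(2), simp)
  have "infsum (\<lambda>n. pconv p a n * \<phi> n) (zidx m) = (\<Sum>\<alpha>\<in>{\<alpha>. p \<alpha> \<noteq> 0}. infsum (\<lambda>n. p \<alpha> * (a (\<lambda>i. n i - int (\<alpha> i)) * \<phi> n)) (zidx m))"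
    unfolding eq by (rule infsum_finite_sum[OF fin, THEN conjunct2]) (intro summable_on_cmult_right R(2), simp)
  also have "\<dots> = (\<Sum>\<alpha>\<in>{\<alpha>. p \<alpha> \<noteq> 0}. p \<alpha> * infsum (\<lambda>n. a n * \<phi> (\<lambda>i. n i + int (\<alpha> i))) (zidx m))"
    by (intro sum.cong) (auto simp: infsum_cmult_right' R(1))
  finally show "infsum (\<lambda>n. pconv p a n * \<phi> n) (zidx m)
    = (\<Sum>\<alpha>\<in>{\<alpha>. p \<alpha> \<noteq> 0}. p \<alpha> * infsum (\<lambda>n. a n * \<phi> (\<lambda>i. n i + int (\<alpha> i))) (zidx m))" .
qed

lemma pconv_wsum:
  assumes "wsum a" "p \<in> mpolys m"
  shows "wsum (pconv p a)"
proof -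
  have "(\<lambda>n. pconv p a n * of_real (wmax n)) summable_on zidx m"
    by (rule pconv_sum(2)[OF assms, of _ 1]) (use wmax_pos in \<open>auto simp: less_imp_le\<close>)
  then have "(\<lambda>n. cmod (pconv p a n * of_real (wmax n))) summable_on zidx m"
    by (rule summable_on_iff_abs_summable_on_complex[THEN iffD1])
  then show ?thesis using wmax_pos unfolding wsum_def by (simp add: norm_mult abs_of_pos)
qed

text \<open>The operator Laurent series with coefficients \<open>a\<close>:
  \<open>sm n j * x (Q n j)\<close> is the monomial in the \<open>U i\<close> with exponent
  \<open>n\<close>, applied to \<open>x\<close>.\<close>

definition L :: "((nat \<Rightarrow> int) \<Rightarrow> complex) \<Rightarrow> l2op" where
  "L a x = (\<lambda>j. infsum (\<lambda>n. a n * (sm n j * x (Q n j))) (zidx m))"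

lemma L_sqs:
  assumes "wsum a" "sqs x"
  shows "sqs (L a x)"
proof -
  have "sqs (\<lambda>j. infsum (\<lambda>n. (a n * sm n j) * x (Q n j)) (zidx m))"
  proof (rule young_sqs(2)[OF assms(2), of "\<lambda>n. cmod (a n) * wmax n"])
    show "(\<lambda>n. cmod (a n) * wmax n) summable_on zidx m" using assms(1) unfolding wsum_def .
    show "cmod (a n * sm n j) \<le> cmod (a n) * wmax n" for n j
      unfolding norm_mult by (intro mult_left_mono sm_le_wmax) auto
  qed (rule bij_Q)
  then show ?thesis unfolding L_def by (simp add: mult.assoc)
qed

lemma sm_x_bound:
  assumes "sqs x"
  obtains C where "\<And>n j. cmod (sm n j * x (Q n j)) \<le> C * wmax n"
proof -
  obtain C where C: "0 \<le> C" "\<And>j. cmod (x j) \<le> C" using sqs_bounded[OF assms] by blast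
  have "cmod (sm n j * x (Q n j)) \<le> C * wmax n" for n j
    unfolding norm_mult mult.commute[of C] using C wmax_pos[of n] by (intro mult_mono sm_le_wmax) (auto simp: less_imp_le)
  then show ?thesis by (rule that)
qed

definition pop :: "((nat \<Rightarrow> nat) \<Rightarrow> complex) \<Rightarrow> l2op" where
  "pop p x = (\<lambda>j. \<Sum>\<alpha>\<in>{\<alpha>. p \<alpha> \<noteq> 0}. p \<alpha> * (sm (\<lambda>i. int (\<alpha> i)) j * x (Q (\<lambda>i. int (\<alpha> i)) j)))"

text \<open>Both orders are needed: when the convolution of \<open>q\<close> and \<open>a\<close> is
  1, they make \<open>L a\<close> a two-sided inverse of \<open>pop q\<close> on \<open>l2\<close>,
  which identifies the \<open>inv_into\<close> in \<open>mrat_op\<close>.\<close>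

lemma pop_L:
  assumes "wsum a" "p \<in> mpolys m" "sqs x"
  shows "pop p (L a x) = L (pconv p a) x" "L a (pop p x) = L (pconv p a) x"
proof -
  obtain C where C: "\<And>n j. cmod (sm n j * x (Q n j)) \<le> C * wmax n" using sm_x_bound[OF assms(3)] by blast
  let ?f = "\<lambda>j n. sm n j * x (Q n j)"
  note P = pconv_sum[OF assms(1,2), of "?f _" C, OF C]
  show "pop p (L a x) = L (pconv p a) x"
  proof
    fix j
    have "sm (\<lambda>i. int (\<alpha> i)) j * L a x (Q (\<lambda>i. int (\<alpha> i)) j) = infsum (\<lambda>n. a n * ?f j (\<lambda>i. n i + int (\<alpha> i))) (zidx m)" for \<alpha>
      unfolding L_def infsum_cmult_right'[symmetric] by (simp add: sm_inv Q_add sm_add ac_simps)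
    then show "pop p (L a x) j = L (pconv p a) x j"
      unfolding pop_def L_def[of "pconv p a"] P(1) by simp
  qed
  show "L a (pop p x) = L (pconv p a) x"
  proof
    fix j
    have "a n * (sm n j * pop p x (Q n j)) = (\<Sum>\<alpha>\<in>{\<alpha>. p \<alpha> \<noteq> 0}. p \<alpha> * (a n * ?f j (\<lambda>i. n i + int (\<alpha> i))))" for n
      unfolding pop_def sum_distrib_left by (simp add: sm_inv Q_add sm_add ac_simps)
    then have "L a (pop p x) j = infsum (\<lambda>n. \<Sum>\<alpha>\<in>{\<alpha>. p \<alpha> \<noteq> 0}. p \<alpha> * (a n * ?f j (\<lambda>i. n i + int (\<alpha> i)))) (zidx m)"
      unfolding L_def by simp
    also have "\<dots> = (\<Sum>\<alpha>\<in>{\<alpha>. p \<alpha> \<noteq> 0}. infsum (\<lambda>n. p \<alpha> * (a n * ?f j (\<lambda>i. n i + int (\<alpha> i)))) (zidx m))"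
      using assms(2) by (intro infsum_finite_sum[THEN conjunct2] summable_on_cmult_right P(3)) (auto simp: mpolys_def)
    also have "\<dots> = L (pconv p a) x j"
      unfolding L_def[of "pconv p a"] P(1) by (simp add: infsum_cmult_right')
    finally show "L a (pop p x) j = L (pconv p a) x j" .
  qed
qed

lemma L_delta:
  assumes "\<And>n. n \<in> zidx m \<Longrightarrow> d n = (if n = (\<lambda>_. 0) then 1 else 0)"
  shows "L d x = x"
proof
  fix j
  have "L d x j = infsum (\<lambda>n. d n * (sm n j * x (Q n j))) {\<lambda>_. 0}"
    unfolding L_def by (rule infsum_cong_neutral) (auto simp: assms, auto simp: zidx_def)
  also have "\<dots> = x j" using assms[of "\<lambda>_. 0"] by (simp add: zidx_def sm_0 Q_0)
  finally show "L d x j = x j" .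
qed

lemma U_power: "(U i ^^ k) x = (\<lambda>j. s i j ^ k * x (Q (idx1 i (int k)) j))"
proof (induction k)
  case 0
  then show ?case by (simp add: Q_idx1_0)
next
  case (Suc k)
  then show ?case
    by (simp add: U_def s_inv Q_idx1_add fun_eq_iff add.commute)
qed

lemma foldr_U:
  assumes "distinct xs"
  shows "foldr (\<lambda>i V. (U i ^^ \<alpha> i) \<circ> V) xs id x
    = (\<lambda>j. (\<Prod>i\<in>set xs. s i j ^ \<alpha> i) * x (Q (\<lambda>i. if i \<in> set xs then int (\<alpha> i) else 0) j))"
  using assms
proof (induction xs)
  case Nil
  then show ?case by (simp add: Q_0)
next
  case (Cons k xs)
  have e: "(\<lambda>i. (if i \<in> set xs then int (\<alpha> i) else 0) + idx1 k (int (\<alpha> k)) i) = (\<lambda>i. if i \<in> set (k # xs) then int (\<alpha> i) else 0)"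
    using Cons.prems by (auto simp: idx1_def fun_eq_iff)
  have "foldr (\<lambda>i V. (U i ^^ \<alpha> i) \<circ> V) (k # xs) id x = (U k ^^ \<alpha> k) (foldr (\<lambda>i V. (U i ^^ \<alpha> i) \<circ> V) xs id x)"
    by simp
  also have "\<dots> = (U k ^^ \<alpha> k) (\<lambda>j. (\<Prod>i\<in>set xs. s i j ^ \<alpha> i) * x (Q (\<lambda>i. if i \<in> set xs then int (\<alpha> i) else 0) j))"
    using Cons.IH Cons.prems by (simp only: distinct.simps simp_thms)
  also have "\<dots> = (\<lambda>j. s k j ^ \<alpha> k * ((\<Prod>i\<in>set xs. s i j ^ \<alpha> i) * x (Q (\<lambda>i. if i \<in> set (k # xs) then int (\<alpha> i) else 0) j)))"
    unfolding U_power by (simp add: s_inv Q_add e del: list.set(2))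
  also have "\<dots> = (\<lambda>j. (\<Prod>i\<in>set (k # xs). s i j ^ \<alpha> i) * x (Q (\<lambda>i. if i \<in> set (k # xs) then int (\<alpha> i) else 0) j))"
    using Cons.prems by (simp add: mult.assoc fun_eq_iff)
  finally show ?case .
qed

lemma mpoly_op_eq:
  assumes "p \<in> mpolys m"
  shows "mpoly_op m p U = pop p"
proof (intro ext)
  fix x j
  have "foldr (\<lambda>i V. (U i ^^ \<alpha> i) \<circ> V) [0..<m] id x j = sm (\<lambda>i. int (\<alpha> i)) j * x (Q (\<lambda>i. int (\<alpha> i)) j)" if "p \<alpha> \<noteq> 0" for \<alpha>
  proof -
    have "(\<lambda>i. if i \<in> set [0..<m] then int (\<alpha> i) else 0) = (\<lambda>i. int (\<alpha> i))"
      using assms that by (auto simp: mpolys_def fun_eq_iff)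
    moreover have "set [0..<m] = {..<m}" by auto
    ultimately show ?thesis unfolding foldr_U[OF distinct_upt] sm_def by simp
  qed
  then show "mpoly_op m p U x j = pop p x j" unfolding mpoly_op_def pop_def by simp
qed

text \<open>Fubini reduces a Laurent series to its monomials. The outer conjugation appears because
  \<open>l2_inner\<close> is antilinear in its first argument.\<close>

lemma inner_L:
  assumes "wsum f" "sqs v" "sqs w"
  shows "l2_inner (L f v) w = cnj (infsum (\<lambda>n. f n * infsum (\<lambda>j. sm n j * v (Q n j) * cnj (w j)) UNIV) (zidx m))"
proof -
  let ?h = "\<lambda>n j. f n * (sm n j * v (Q n j) * cnj (w j))"
  have ns: "(\<lambda>j. cmod (v (Q n j)) * cmod (w j)) summable_on UNIV" for n
  proof -
    have "sqs (\<lambda>j. v (Q n j))" using assms(2) sqs_reindex[OF bij_Q] by blast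
    then have "(\<lambda>j. v (Q n j) * w j) summable_on UNIV" by (intro sqs_mult_summable assms(3))
    from summable_on_iff_abs_summable_on_complex[THEN iffD1, OF this] show ?thesis by (simp add: norm_mult)
  qed
  define K where "K = infsum (\<lambda>j. (cmod (v j))\<^sup>2) UNIV + infsum (\<lambda>j. (cmod (w j))\<^sup>2) UNIV"
  have nK: "infsum (\<lambda>j. cmod (v (Q n j)) * cmod (w j)) UNIV \<le> K" for n
  proof -
    have vs: "(\<lambda>j. (cmod (v (Q n j)))\<^sup>2) summable_on UNIV" using assms(2) sqs_reindex[OF bij_Q, of v n] unfolding sqs_def by blast
    have ws: "(\<lambda>j. (cmod (w j))\<^sup>2) summable_on UNIV" using assms(3) unfolding sqs_def .
    have "infsum (\<lambda>j. cmod (v (Q n j)) * cmod (w j)) UNIV \<le> infsum (\<lambda>j. (cmod (v (Q n j)))\<^sup>2 + (cmod (w j))\<^sup>2) UNIV"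
    proof (rule infsum_mono[OF ns summable_on_add[OF vs ws]])
      fix j
      show "cmod (v (Q n j)) * cmod (w j) \<le> (cmod (v (Q n j)))\<^sup>2 + (cmod (w j))\<^sup>2"
        by (rule mult_le_sum_squares) auto
    qed
    also have "\<dots> = K"
      unfolding K_def infsum_add[OF vs ws]
      using infsum_reindex_bij_betw[of "Q n" UNIV UNIV "\<lambda>j. (cmod (v j))\<^sup>2"] bij_Q[of n] by simp
    finally show ?thesis .
  qed
  have bnd: "cmod (?h n j) \<le> cmod (f n) * wmax n * (cmod (v (Q n j)) * cmod (w j))" for n j
  proof -
    have "cmod (sm n j) * (cmod (v (Q n j)) * cmod (w j)) \<le> wmax n * (cmod (v (Q n j)) * cmod (w j))"
      by (intro mult_right_mono sm_le_wmax) auto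
    from mult_left_mono[OF this, of "cmod (f n)"] show ?thesis by (simp add: norm_mult mult.assoc)
  qed
  have S: "(\<lambda>(n, j). ?h n j) summable_on zidx m \<times> UNIV"
  proof (rule summable_on_norm_comparison[of "\<lambda>(n, j). cmod (f n) * wmax n * (cmod (v (Q n j)) * cmod (w j))"])
    have "(\<lambda>p. norm ((\<lambda>(n, j). cmod (f n) * wmax n * (cmod (v (Q n j)) * cmod (w j))) p)) summable_on zidx m \<times> UNIV"
      unfolding Infinite_Sum.abs_summable_on_Sigma_iff
    proof (intro conjI ballI)
      fix n
      show "(\<lambda>j. norm ((\<lambda>(n, j). cmod (f n) * wmax n * (cmod (v (Q n j)) * cmod (w j))) (n, j))) summable_on UNIV"
        using summable_on_cmult_right[OF ns, of "cmod (f n) * wmax n" n] wmax_pos[of n] by (simp add: abs_mult)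
    next
      have eq: "infsum (\<lambda>j. norm ((\<lambda>(n, j). cmod (f n) * wmax n * (cmod (v (Q n j)) * cmod (w j))) (n, j))) UNIV
          = cmod (f n) * wmax n * infsum (\<lambda>j. cmod (v (Q n j)) * cmod (w j)) UNIV" for n
        using wmax_pos[of n] by (simp add: abs_mult infsum_cmult_right')
      show "(\<lambda>n. norm (infsum (\<lambda>j. norm ((\<lambda>(n, j). cmod (f n) * wmax n * (cmod (v (Q n j)) * cmod (w j))) (n, j))) UNIV)) summable_on zidx m"
        unfolding eq
      proof (rule Infinite_Sum.abs_summable_on_comparison_test'[OF summable_on_cmult_left[of "\<lambda>n. cmod (f n) * wmax n" _ K]])
        show "(\<lambda>n. cmod (f n) * wmax n) summable_on zidx m" using assms(1) unfolding wsum_def .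
        fix n
        have "0 \<le> infsum (\<lambda>j. cmod (v (Q n j)) * cmod (w j)) UNIV" by (intro infsum_nonneg) auto
        then show "norm (cmod (f n) * wmax n * infsum (\<lambda>j. cmod (v (Q n j)) * cmod (w j)) UNIV) \<le> cmod (f n) * wmax n * K"
          using nK[of n] wmax_pos[of n] by (simp add: abs_mult mult_left_mono)
      qed
    qed
    then show "(\<lambda>(n, j). cmod (f n) * wmax n * (cmod (v (Q n j)) * cmod (w j))) summable_on zidx m \<times> UNIV"
      by (rule Infinite_Sum.abs_summable_summable)
  qed (use bnd in auto)
  have "l2_inner (L f v) w = infsum (\<lambda>j. cnj (L f v j * cnj (w j))) UNIV"
    unfolding l2_inner_infsum[OF L_sqs[OF assms(1,2)] assms(3)] by simp
  also have "\<dots> = cnj (infsum (\<lambda>j. L f v j * cnj (w j)) UNIV)" by (rule infsum_cnj)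
  also have "infsum (\<lambda>j. L f v j * cnj (w j)) UNIV = infsum (\<lambda>j. infsum (\<lambda>n. ?h n j) (zidx m)) UNIV"
    unfolding L_def infsum_cmult_left'[symmetric] by (simp add: mult.assoc)
  also have "\<dots> = infsum (\<lambda>n. infsum (\<lambda>j. ?h n j) UNIV) (zidx m)"
    by (rule infsum_swap_banach[OF S, symmetric])
  also have "\<dots> = infsum (\<lambda>n. f n * infsum (\<lambda>j. sm n j * v (Q n j) * cnj (w j)) UNIV) (zidx m)"
    by (simp add: infsum_cmult_right')
  finally show ?thesis .
qed

lemma gram_bound:
  assumes "sqs v" "sqs w"
  obtains C where "\<And>n. cmod (infsum (\<lambda>j. sm n j * v (Q n j) * cnj (w j)) UNIV) \<le> C * wmax n"
proof -
  define K where "K = infsum (\<lambda>j. (cmod (v j))\<^sup>2) UNIV + infsum (\<lambda>j. (cmod (w j))\<^sup>2) UNIV"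
  have "cmod (infsum (\<lambda>j. sm n j * v (Q n j) * cnj (w j)) UNIV) \<le> K * wmax n" for n
  proof -
    have vs: "(\<lambda>j. (cmod (v (Q n j)))\<^sup>2) summable_on UNIV" using assms(1) sqs_reindex[OF bij_Q, of v n] unfolding sqs_def by blast
    have ws: "(\<lambda>j. (cmod (w j))\<^sup>2) summable_on UNIV" using assms(2) unfolding sqs_def .
    have b: "cmod (sm n j * v (Q n j) * cnj (w j)) \<le> wmax n * ((cmod (v (Q n j)))\<^sup>2 + (cmod (w j))\<^sup>2)" for j
    proof -
      have "cmod (v (Q n j)) * cmod (w j) \<le> (cmod (v (Q n j)))\<^sup>2 + (cmod (w j))\<^sup>2"
        by (rule mult_le_sum_squares) auto
      then have "cmod (sm n j) * (cmod (v (Q n j)) * cmod (w j)) \<le> wmax n * ((cmod (v (Q n j)))\<^sup>2 + (cmod (w j))\<^sup>2)"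
        using wmax_pos[of n] by (intro mult_mono sm_le_wmax) (auto simp: less_imp_le)
      then show ?thesis by (simp add: norm_mult mult.assoc)
    qed
    have S: "(\<lambda>j. wmax n * ((cmod (v (Q n j)))\<^sup>2 + (cmod (w j))\<^sup>2)) summable_on UNIV"
      by (intro summable_on_cmult_right summable_on_add vs ws)
    have "cmod (infsum (\<lambda>j. sm n j * v (Q n j) * cnj (w j)) UNIV) \<le> infsum (\<lambda>j. wmax n * ((cmod (v (Q n j)))\<^sup>2 + (cmod (w j))\<^sup>2)) UNIV"
      using Infinite_Sum.abs_summable_on_comparison_test'[OF S b]
      by (intro order_trans[OF norm_infsum_bound] infsum_mono S b)
    also have "\<dots> = wmax n * K"
      unfolding K_def infsum_cmult_right' infsum_add[OF vs ws]
      using infsum_reindex_bij_betw[of "Q n" UNIV UNIV "\<lambda>j. (cmod (v j))\<^sup>2"] bij_Q[of n] by simp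
    finally show ?thesis by (simp add: mult.commute)
  qed
  then show ?thesis by (rule that)
qed

end

lemma cinner2_expand: "cinner2 x y = cnj (x $ 1) * y $ 1 + cnj (x $ 2) * y $ 2"
  by (simp add: cinner2_def UNIV_2)

lemma matrix_vector_mult_2: "(A *v x) $ i = A $ i $ 1 * x $ 1 + A $ i $ 2 * x $ 2" for A :: cmat2
  by (simp add: matrix_vector_mult_def sum_2)

lemma matrix_matrix_mult_2: "(A ** B) $ i $ j = A $ i $ 1 * B $ 1 $ j + A $ i $ 2 * B $ 2 $ j" for A B :: cmat2
  by (simp add: matrix_matrix_mult_def sum_2)

context wperm
begin

lemma mat_pow_hom:
  assumes "M (\<lambda>_. 0) = mat 1" "\<And>n n'. M (\<lambda>i. n i + n' i) = M n ** M n'" "M (idx1 i 1) = B i"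
  shows "mat_pow (B i) k = M (idx1 i (int k))"
proof (induction k)
  case 0
  have "idx1 i 0 = (\<lambda>_. 0)" by (auto simp: idx1_def)
  then show ?case using assms(1) by (simp add: mat_pow_def)
next
  case (Suc k)
  have "(\<lambda>l. idx1 i 1 l + idx1 i (int k) l) = idx1 i (int (Suc k))" by (auto simp: idx1_def)
  then have "M (idx1 i (int (Suc k))) = B i ** M (idx1 i (int k))" using assms(2)[of "idx1 i 1" "idx1 i (int k)"] assms(3) by simp
  then show ?case using Suc by (simp add: mat_pow_def)
qed

lemma foldr_hom:
  assumes "M (\<lambda>_. 0) = mat 1" "\<And>n n'. M (\<lambda>i. n i + n' i) = M n ** M n'" "\<And>i. i \<in> set xs \<Longrightarrow> M (idx1 i 1) = B i" "distinct xs"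
  shows "foldr (\<lambda>i X. mat_pow (B i) (\<alpha> i) ** X) xs (mat 1) = M (\<lambda>i. if i \<in> set xs then int (\<alpha> i) else 0)"
  using assms(3,4)
proof (induction xs)
  case Nil
  then show ?case using assms(1) by simp
next
  case (Cons k xs)
  have e: "(\<lambda>i. idx1 k (int (\<alpha> k)) i + (if i \<in> set xs then int (\<alpha> i) else 0)) = (\<lambda>i. if i \<in> set (k # xs) then int (\<alpha> i) else 0)"
    using Cons.prems by (auto simp: idx1_def fun_eq_iff)
  have "mat_pow (B k) (\<alpha> k) = M (idx1 k (int (\<alpha> k)))" by (rule mat_pow_hom[OF assms(1,2)]) (use Cons.prems in auto)
  then have "foldr (\<lambda>i X. mat_pow (B i) (\<alpha> i) ** X) (k # xs) (mat 1) = M (idx1 k (int (\<alpha> k))) ** M (\<lambda>i. if i \<in> set xs then int (\<alpha> i) else 0)"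
    using Cons by simp
  then show ?case using assms(2)[of "idx1 k (int (\<alpha> k))" "\<lambda>i. if i \<in> set xs then int (\<alpha> i) else 0"] unfolding e by simp
qed

text \<open>\<open>M n\<close> plays the role of the product of powers of the \<open>B i\<close>,
  negative exponents included. With \<open>f\<close> the convolution of \<open>p\<close> and the
  coefficients of \<open>1 / q\<close>, one side is the series \<open>L f\<close>, the other the
  series of the \<open>f n * M n\<close>, so the agreement on monomials passes to all rational
  functions.\<close>

lemma rational_dilation:
  assumes V: "isometric_embedding V"
    and M0: "M (\<lambda>_. 0) = mat 1" and Madd: "\<And>n n'. M (\<lambda>i. n i + n' i) = M n ** M n'"
    and MB: "\<And>i. i < m \<Longrightarrow> M (idx1 i 1) = B i"
    and gram: "\<And>n x y. (\<Sum>\<^sub>\<infinity>j. sm n j * V x (Q n j) * cnj (V y j)) = cnj (cinner2 (M n *v x) y)"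
    and pq: "(p, q) \<in> Rat_polyannulus r m"
  shows "l2_inner (mrat_op m p q U (V x)) (V y) = cinner2 (mrat_mat m p q B *v x) y"
proof -
  have p: "p \<in> mpolys m" and q: "q \<in> mpolys m" using pq by (auto simp: Rat_polyannulus_def)
  have zf: "mpoly_eval m q z \<noteq> 0" if "\<And>i. i < m \<Longrightarrow> z i \<in> closed_annulus r" for z
    using pq that by (auto simp: Rat_polyannulus_def)
  obtain a where a: "(\<lambda>n. cmod (a n) * (\<Prod>i<m. max 1 (r powi n i))) summable_on zidx m"
    "\<And>n. (\<Sum>\<alpha>\<in>{\<alpha>. q \<alpha> \<noteq> 0}. q \<alpha> * a (\<lambda>i. n i - int (\<alpha> i))) = (if \<forall>i<m. n i = 0 then 1 else 0)"
    using laurent_inverse[OF r q zf] by blast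
  have wa: "wsum a" using a(1) unfolding wsum_def wmax_def .
  have delta: "pconv q a n = (if n = (\<lambda>_. 0) then 1 else 0)" if "n \<in> zidx m" for n
    using a(2)[of n] that unfolding pconv_def zidx_def by (auto simp: fun_eq_iff) (meson not_le)
  have Vs: "sqs (V x)" for x using V unfolding isometric_embedding_def mem_l2_iff by blast
  define f where "f = pconv p a"
  have wf: "wsum f" unfolding f_def by (rule pconv_wsum[OF wa p])
  have op: "mrat_op m p q U (V x) = L f (V x)"
  proof -
    have qL: "pop q (L a u) = u" "L a (pop q u) = u" if "sqs u" for u
      using pop_L[OF wa q that] L_delta[OF delta] by simp_all
    have "inj_on (pop q) l2" by (rule inj_on_inverseI[of _ "L a"]) (simp add: mem_l2_iff qL)
    then have "inv_into l2 (pop q) (V x) = L a (V x)"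
      by (rule inv_into_f_eq) (simp_all add: mem_l2_iff qL Vs L_sqs wa)
    then show ?thesis unfolding mrat_op_def mpoly_op_eq[OF p] mpoly_op_eq[OF q] f_def
      using pop_L(1)[OF wa p Vs] by simp
  qed
  \<comment> \<open>The hypothesis \<open>gram\<close> expresses the entries of \<open>M n\<close>
    through unit vectors, so their growth is controlled by \<open>wmax\<close> without any norm
    estimate for the matrices.\<close>
  have ent: "M n $ i $ l = (\<Sum>\<^sub>\<infinity>j. sm n j * V (axis l 1) (Q n j) * cnj (V (axis i 1) j))" for n i l
    unfolding gram using exhaust_2[of i] exhaust_2[of l]
    by (auto simp: cinner2_expand matrix_vector_mult_2 axis_def)
  have bound: "\<exists>C. \<forall>n. cmod (M n $ i $ l) \<le> C * wmax n" for i l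
    unfolding ent using gram_bound[OF Vs Vs] by metis
  have summ: "(\<lambda>n. g n * M n $ i $ l) summable_on zidx m" if g: "wsum g" for g i l
  proof -
    obtain C where "\<And>n. cmod (M n $ i $ l) \<le> C * wmax n" using bound by blast
    then show ?thesis by (rule wsum_mult_summable[OF g])
  qed
  define Fm where "Fm g = (\<chi> i l. infsum (\<lambda>n. g n * M n $ i $ l) (zidx m))" for g
  have mp: "mpoly_mat m c B $ i $ l = (\<Sum>\<alpha>\<in>{\<alpha>. c \<alpha> \<noteq> 0}. c \<alpha> * M (\<lambda>i. int (\<alpha> i)) $ i $ l)" if c: "c \<in> mpolys m" for c i l
  proof -
    have "foldr (\<lambda>i X. mat_pow (B i) (\<alpha> i) ** X) [0..<m] (mat 1) = M (\<lambda>i. int (\<alpha> i))" if "c \<alpha> \<noteq> 0" for \<alpha>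
    proof -
      have "(\<lambda>i. if i \<in> set [0..<m] then int (\<alpha> i) else 0) = (\<lambda>i. int (\<alpha> i))"
        using c that by (auto simp: mpolys_def fun_eq_iff)
      then show ?thesis using foldr_hom[where M = M and xs = "[0..<m]" and B = B and \<alpha> = \<alpha>, OF M0 Madd] MB by simp
    qed
    then have "mpoly_mat m c B = (\<Sum>\<alpha>\<in>{\<alpha>. c \<alpha> \<noteq> 0}. mat (c \<alpha>) ** M (\<lambda>i. int (\<alpha> i)))"
      unfolding mpoly_mat_def by (intro sum.cong) auto
    moreover have "(mat z ** A) $ i $ l = z * A $ i $ l" for z and A :: cmat2
      using exhaust_2[of i] by (auto simp: mat_m22 matrix_matrix_mult_2)
    ultimately show ?thesis by simp
  qed
  have mF: "mpoly_mat m c B ** Fm a = Fm (pconv c a)" if c: "c \<in> mpolys m" for c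
  proof -
    have "(mpoly_mat m c B ** Fm a) $ i $ l = Fm (pconv c a) $ i $ l" for i l
    proof -
      obtain C where C: "\<And>n. cmod (M n $ i $ l) \<le> C * wmax n" using bound by blast
      have inner: "infsum (\<lambda>n. a n * M (\<lambda>k. n k + int (\<alpha> k)) $ i $ l) (zidx m)
         = M (\<lambda>k. int (\<alpha> k)) $ i $ 1 * Fm a $ 1 $ l + M (\<lambda>k. int (\<alpha> k)) $ i $ 2 * Fm a $ 2 $ l" for \<alpha>
      proof -
        have "M (\<lambda>k. n k + int (\<alpha> k)) = M (\<lambda>k. int (\<alpha> k)) ** M n" for n
          using Madd[of "\<lambda>k. int (\<alpha> k)" n] by (simp add: add.commute)
        then have "a n * M (\<lambda>k. n k + int (\<alpha> k)) $ i $ l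
          = M (\<lambda>k. int (\<alpha> k)) $ i $ 1 * (a n * M n $ 1 $ l) + M (\<lambda>k. int (\<alpha> k)) $ i $ 2 * (a n * M n $ 2 $ l)" for n
          by (simp add: matrix_matrix_mult_2 algebra_simps)
        then show ?thesis using summ[OF wa, of 1 l] summ[OF wa, of 2 l]
          by (simp add: infsum_add summable_on_cmult_right infsum_cmult_right' Fm_def)
      qed
      have "Fm (pconv c a) $ i $ l = (\<Sum>\<alpha>\<in>{\<alpha>. c \<alpha> \<noteq> 0}. c \<alpha> * infsum (\<lambda>n. a n * M (\<lambda>k. n k + int (\<alpha> k)) $ i $ l) (zidx m))"
        unfolding Fm_def using pconv_sum(1)[OF wa c, of "\<lambda>n. M n $ i $ l" C] C by simp
      also have "\<dots> = (mpoly_mat m c B ** Fm a) $ i $ l"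
        unfolding inner matrix_matrix_mult_2[of "mpoly_mat m c B"] mp[OF c] sum_distrib_right sum.distrib[symmetric]
        by (intro sum.cong) (simp_all add: algebra_simps)
      finally show ?thesis by simp
    qed
    then show ?thesis by (simp add: vec_eq_iff)
  qed
  have "Fm (pconv q a) = mat 1"
  proof -
    have "infsum (\<lambda>n. pconv q a n * M n $ i $ l) (zidx m) = M (\<lambda>_. 0) $ i $ l" for i l
    proof -
      have "infsum (\<lambda>n. pconv q a n * M n $ i $ l) (zidx m) = infsum (\<lambda>n. pconv q a n * M n $ i $ l) {\<lambda>_. 0}"
        by (rule infsum_cong_neutral) (auto simp: delta, auto simp: zidx_def)
      then show ?thesis using delta[of "\<lambda>_. 0"] by (simp add: zidx_def)
    qed
    then show ?thesis unfolding Fm_def M0 by (simp add: vec_eq_iff)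
  qed
  then have "mpoly_mat m q B ** Fm a = mat 1" using mF[OF q] by simp
  then have "matrix_inv (mpoly_mat m q B) = Fm a" by (rule matrix_inv_eqI)
  then have mr: "mrat_mat m p q B = Fm f" unfolding mrat_mat_def f_def using mF[OF p] by simp
  have S: "(\<lambda>n. f n * M n $ i $ l) summable_on zidx m" for i l by (rule summ[OF wf])
  have fi: "Fm f $ i $ l = infsum (\<lambda>n. f n * M n $ i $ l) (zidx m)" for i l by (simp add: Fm_def)
  have "l2_inner (mrat_op m p q U (V x)) (V y) = cnj (infsum (\<lambda>n. f n * cnj (cinner2 (M n *v x) y)) (zidx m))"
    unfolding op inner_L[OF wf Vs Vs] gram ..
  also have "infsum (\<lambda>n. f n * cnj (cinner2 (M n *v x) y)) (zidx m)
    = infsum (\<lambda>n. (x $ 1 * cnj (y $ 1)) * (f n * M n $ 1 $ 1) + (x $ 2 * cnj (y $ 1)) * (f n * M n $ 1 $ 2)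
      + (x $ 1 * cnj (y $ 2)) * (f n * M n $ 2 $ 1) + (x $ 2 * cnj (y $ 2)) * (f n * M n $ 2 $ 2)) (zidx m)"
    by (rule infsum_cong) (simp add: cinner2_expand matrix_vector_mult_2 algebra_simps)
  also have "\<dots> = (x $ 1 * cnj (y $ 1)) * Fm f $ 1 $ 1 + (x $ 2 * cnj (y $ 1)) * Fm f $ 1 $ 2
      + (x $ 1 * cnj (y $ 2)) * Fm f $ 2 $ 1 + (x $ 2 * cnj (y $ 2)) * Fm f $ 2 $ 2"
    unfolding fi using S by (simp add: infsum_add summable_on_add summable_on_cmult_right infsum_cmult_right')
  also have "cnj \<dots> = cinner2 (mrat_mat m p q B *v x) y"
    unfolding mr by (simp add: cinner2_expand matrix_vector_mult_2 algebra_simps)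
  finally show ?thesis .
qed

end

text \<open>Basis vectors of the tensor product are \<open>m\<close>-tuples of labelled integers.
  Coordinate \<open>i\<close> moves only its own entry, so inner products factorise. As
  \<open>m \<ge> 1\<close>, the tuples form a countably infinite set and can be numbered by
  \<open>nat\<close>.\<close>

lemma tensor_model:
  fixes sI :: "nat \<Rightarrow> bool \<times> bool \<Rightarrow> complex" and e :: "nat \<Rightarrow> bool \<times> bool \<Rightarrow> int"
    and v :: "nat \<Rightarrow> bool \<Rightarrow> int \<times> bool \<times> bool \<Rightarrow> complex"
  assumes r: "0 < r" "r < 1" and m: "1 \<le> m"
    and cm: "\<And>i. i < m \<Longrightarrow> coord_model r (sI i) (e i) (v i) (G i)"
  shows "\<exists>Q s w. wperm r Q s \<and> (\<forall>p. sqs (w p)) \<and>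
    (\<forall>n p p'. (\<Sum>\<^sub>\<infinity>j. wperm.sm m s n j * w p (Q n j) * cnj (w p' j)) = (\<Prod>i<m. G i p p' (n i)))"
proof -
  define J where "J = PiE {..<m} (\<lambda>_. UNIV :: (int \<times> bool \<times> bool) set)"
  have J: "countable J" "infinite J"
  proof -
    show "countable J" unfolding J_def by (intro countable_PiE) auto
    show "infinite J"
    proof
      assume "finite J"
      have "inj (\<lambda>k::int. restrict (\<lambda>_. (k, False, False)) {..<m})"
      proof (rule injI)
        fix k k' :: int assume "restrict (\<lambda>_. (k, False, False)) {..<m} = restrict (\<lambda>_. (k', False, False)) {..<m}"
        then have "restrict (\<lambda>_. (k, False, False)) {..<m} 0 = restrict (\<lambda>_. (k', False, False)) {..<m} 0" by simp
        then show "k = k'" using m by simp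
      qed
      moreover have "range (\<lambda>k::int. restrict (\<lambda>_. (k, False, False)) {..<m}) \<subseteq> J"
        by (simp add: J_def image_subset_iff)
      ultimately have "finite (UNIV :: int set)" using \<open>finite J\<close> by (meson finite_imageD finite_subset)
      then show False by (simp add: infinite_UNIV_int)
    qed
  qed
  define \<phi> where "\<phi> = from_nat_into J"
  have \<phi>: "bij_betw \<phi> UNIV J" unfolding \<phi>_def by (rule bij_betw_from_nat_into[OF J])
  define \<psi> where "\<psi> = inv_into UNIV \<phi>"
  have \<phi>\<psi>: "\<phi> (\<psi> g) = g" if "g \<in> J" for g using \<phi> that unfolding \<psi>_def by (meson bij_betw_inv_into_right)
  have \<psi>\<phi>: "\<psi> (\<phi> j) = j" for j using \<phi> unfolding \<psi>_def by (simp add: bij_betw_inv_into_left)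
  have \<phi>J: "\<phi> j \<in> J" for j using \<phi> by (auto simp: bij_betw_def)
  define act where "act n g = restrict (\<lambda>i. lshift (e i) (n i) (g i)) {..<m}" for n :: "nat \<Rightarrow> int" and g
  have actJ: "act n g \<in> J" for n g unfolding act_def J_def by auto
  define Q where "Q n j = \<psi> (act n (\<phi> j))" for n j
  \<comment> \<open>The weight 1 for \<open>i \<ge> m\<close> is a filler that satisfies the modulus
    condition of \<open>wperm\<close>.\<close>
  define s where "s i j = (if i < m then sI i (snd (\<phi> j i)) else 1)" for i j
  have \<phi>Q: "\<phi> (Q n j) = act n (\<phi> j)" for n j unfolding Q_def by (rule \<phi>\<psi>[OF actJ])
  have W: "wperm r Q s"
  proof
    show "Q (\<lambda>_. 0) j = j" for j
    proof -
      have "act (\<lambda>_. 0) (\<phi> j) = \<phi> j" using \<phi>J[of j] unfolding act_def J_def by (auto simp: lshift_def PiE_iff extensional_def fun_eq_iff)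
      then show ?thesis by (simp add: Q_def \<psi>\<phi>)
    qed
    show "Q n (Q n' j) = Q (\<lambda>i. n i + n' i) j" for n n' j
    proof -
      have "act n (act n' (\<phi> j)) = act (\<lambda>i. n i + n' i) (\<phi> j)" unfolding act_def by (auto simp: lshift_def fun_eq_iff algebra_simps)
      then show ?thesis unfolding Q_def[of n "Q n' j"] \<phi>Q by (simp add: Q_def)
    qed
    show "s i (Q n j) = s i j" for i n j unfolding s_def \<phi>Q by (simp add: act_def lshift_def)
    show "cmod (s i j) = 1 \<or> cmod (s i j) = r" for i j
    proof (cases "i < m")
      case True
      have "\<forall>l. cmod (sI i l) = 1 \<or> cmod (sI i l) = r" using cm[OF True] unfolding coord_model_def by blast
      then show ?thesis using True unfolding s_def by (simp only: if_True)
    qed (simp add: s_def)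
  qed (use r in auto)
  define w where "w p j = (\<Prod>i<m. v i p (\<phi> j i))" for p j
  have sq: "sqs (v i p)" if "i < m" for i p using cm[OF that] by (simp add: coord_model_def)
  have ws: "sqs (w p)" for p
  proof -
    have "(\<lambda>g. \<Prod>i<m. (cmod (v i p (g i)))\<^sup>2) summable_on J"
      unfolding J_def by (rule summable_on_prod_PiE[of _ _ "\<lambda>i x. (cmod (v i p x))\<^sup>2"]) (use sq in \<open>auto simp: sqs_def\<close>)
    then have "(\<lambda>j. \<Prod>i<m. (cmod (v i p (\<phi> j i)))\<^sup>2) summable_on UNIV"
      by (rule summable_on_reindex_bij_betw[OF \<phi>, THEN iffD2])
    moreover have "(\<Prod>i<m. (cmod (v i p (\<phi> j i)))\<^sup>2) = (cmod (w p j))\<^sup>2" for j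
      unfolding w_def prod_norm[symmetric] by (rule prod_power_distrib[symmetric])
    ultimately show ?thesis unfolding sqs_def by simp
  qed
  have "(\<Sum>\<^sub>\<infinity>j. wperm.sm m s n j * w p (Q n j) * cnj (w p' j)) = (\<Prod>i<m. G i p p' (n i))" for n p p'
  proof -
    let ?f = "\<lambda>i x. sI i (snd x) powi n i * v i p (lshift (e i) (n i) x) * cnj (v i p' x)"
    have "wperm.sm m s n j * w p (Q n j) * cnj (w p' j) = (\<Prod>i<m. ?f i (\<phi> j i))" for j
    proof -
      have "wperm.sm m s n j = (\<Prod>i<m. sI i (snd (\<phi> j i)) powi n i)"
        unfolding wperm.sm_def[OF W] by (rule prod.cong) (auto simp: s_def)
      moreover have "w p (Q n j) = (\<Prod>i<m. v i p (lshift (e i) (n i) (\<phi> j i)))"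
        unfolding w_def \<phi>Q by (rule prod.cong) (auto simp: act_def)
      ultimately show ?thesis by (simp add: w_def prod.distrib)
    qed
    then have "(\<Sum>\<^sub>\<infinity>j. wperm.sm m s n j * w p (Q n j) * cnj (w p' j)) = (\<Sum>\<^sub>\<infinity>j. \<Prod>i<m. ?f i (\<phi> j i))"
      by (simp only:)
    also have "\<dots> = infsum (\<lambda>g. \<Prod>i<m. ?f i (g i)) J"
      by (rule infsum_reindex_bij_betw[OF \<phi>])
    also have "\<dots> = (\<Prod>i<m. infsum (?f i) UNIV)"
      unfolding J_def
    proof (rule infsum_prod_PiE_abs)
      show "(\<lambda>x. norm (?f i x)) summable_on UNIV" if "i \<in> {..<m}" for i
        by (rule summable_on_iff_abs_summable_on_complex[THEN iffD1, OF gram_summable]) (use that sq in auto)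
    qed simp
    also have "\<dots> = (\<Prod>i<m. G i p p' (n i))"
      by (rule prod.cong) (use cm in \<open>auto simp: coord_model_def gram_def\<close>)
    finally show ?thesis .
  qed
  then show ?thesis using W ws by blast
qed

section \<open>Reduction to triangular matrices\<close>


definition unitary2 :: "cmat2 \<Rightarrow> bool" where
  "unitary2 W \<longleftrightarrow> mat_adj W ** W = mat 1"

lemma mat_adj_m22: "mat_adj (m22 p q u v) = m22 (cnj p) (cnj u) (cnj q) (cnj v)"
  by (simp add: m22_eq_iff mat_adj_def)

lemma mat_adj_mult: "mat_adj (A ** B) = mat_adj B ** mat_adj A"
  by (simp add: m22_eq_iff mat_adj_def matrix_matrix_mult_2 mult.commute)

lemma mat_adj_adj: "mat_adj (mat_adj A) = A"
  by (simp add: m22_eq_iff mat_adj_def)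

lemma unitary2_right: "unitary2 W \<Longrightarrow> W ** mat_adj W = mat 1"
  unfolding unitary2_def using matrix_left_right_inverse by blast

lemma cinner2_adj: "cinner2 (A *v x) y = cinner2 x (mat_adj A *v y)"
  by (simp add: cinner2_expand matrix_vector_mult_2 mat_adj_def algebra_simps)

lemma cinner2_self: "cinner2 x x = of_real ((norm x)\<^sup>2)"
proof -
  have "(norm x)\<^sup>2 = (cmod (x $ 1))\<^sup>2 + (cmod (x $ 2))\<^sup>2"
    by (simp add: norm_vec_def L2_set_def UNIV_2)
  then show ?thesis by (simp add: cinner2_expand complex_norm_square mult.commute del: of_real_power)
qed

lemma norm_unitary2:
  assumes "W ** mat_adj W = mat 1 \<or> mat_adj W ** W = mat 1"
  shows "norm (W *v x) = norm x" "norm (mat_adj W *v x) = norm x"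
proof -
  have W: "W ** mat_adj W = mat 1" "mat_adj W ** W = mat 1" using assms matrix_left_right_inverse by blast+
  have *: "norm (X *v x) = norm x" if "mat_adj X ** X = mat 1" for X :: cmat2
  proof -
    have "complex_of_real ((norm (X *v x))\<^sup>2) = of_real ((norm x)\<^sup>2)"
      unfolding cinner2_self[symmetric] cinner2_adj by (simp add: matrix_vector_mul_assoc that)
    then show ?thesis by (simp only: of_real_eq_iff power2_eq_iff_nonneg norm_ge_zero)
  qed
  show "norm (W *v x) = norm x" "norm (mat_adj W *v x) = norm x" using *[of W] *[of "mat_adj W"] W by (simp_all add: mat_adj_adj)
qed

lemma mat_vec_bounded_linear: "bounded_linear (\<lambda>x. (A::cmat2) *v x)"
  by (intro linear_conv_bounded_linear[THEN iffD1] linearI)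
     (simp_all add: vec_eq_iff forall_2 matrix_vector_mult_2 algebra_simps)

lemma mat_norm_unitary_conj:
  assumes "unitary2 W"
  shows "mat_norm (mat_adj W ** A ** W) \<le> mat_norm A"
  unfolding mat_norm_def
proof (rule onorm_bound)
  show "0 \<le> onorm ((*v) A)" by (rule onorm_pos_le[OF mat_vec_bounded_linear])
  fix x
  have "norm ((mat_adj W ** A ** W) *v x) = norm (mat_adj W *v (A *v (W *v x)))"
    by (simp add: matrix_vector_mul_assoc matrix_mul_assoc)
  also have "\<dots> = norm (A *v (W *v x))" using norm_unitary2[of W] assms unfolding unitary2_def by simp
  also have "\<dots> \<le> onorm ((*v) A) * norm (W *v x)" by (rule onorm[OF mat_vec_bounded_linear])
  also have "norm (W *v x) = norm x" using norm_unitary2[of W] assms unfolding unitary2_def by simp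
  finally show "norm ((mat_adj W ** A ** W) *v x) \<le> onorm ((*v) A) * norm x" .
qed

lemma unitary_conj_mult:
  assumes "unitary2 W"
  shows "(mat_adj W ** A ** W) ** (mat_adj W ** B ** W) = mat_adj W ** (A ** B) ** W"
proof -
  have "(mat_adj W ** A ** W) ** (mat_adj W ** B ** W) = mat_adj W ** A ** (W ** mat_adj W) ** B ** W"
    by (simp add: matrix_mul_assoc)
  then show ?thesis using unitary2_right[OF assms] by (simp add: matrix_mul_assoc)
qed

lemma unitary_conj_undo:
  assumes "unitary2 W"
  shows "W ** (mat_adj W ** A ** W) ** mat_adj W = A"
proof -
  have "W ** (mat_adj W ** A ** W) ** mat_adj W = (W ** mat_adj W) ** A ** (W ** mat_adj W)"
    by (simp add: matrix_mul_assoc)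
  then show ?thesis using unitary2_right[OF assms] by simp
qed

lemma unitary_conj_pow:
  assumes "unitary2 W"
  shows "mat_pow (mat_adj W ** A ** W) k = mat_adj W ** mat_pow A k ** W"
proof (induction k)
  case 0
  then show ?case using assms by (simp add: mat_pow_def unitary2_def)
next
  case (Suc k)
  then show ?case using unitary_conj_mult[OF assms] by (simp add: mat_pow_def)
qed

lemma mat_scalar_comm: "mat c ** A = A ** mat c" for A :: cmat2
  by (simp add: m22_eq_iff mat_m22 matrix_matrix_mult_2 mult.commute)

lemma unitary_conj_sum:
  "mat_adj W ** (\<Sum>i\<in>I. F i) ** W = (\<Sum>i\<in>I. mat_adj W ** F i ** W)" for F :: "_ \<Rightarrow> cmat2"
proof -
  have z: "mat_adj W ** 0 ** W = 0" by (simp add: m22_eq_iff matrix_matrix_mult_2)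
  have rd: "(X + Y) ** W = X ** W + Y ** W" for X Y :: cmat2
    by (simp add: m22_eq_iff matrix_matrix_mult_2 algebra_simps)
  show ?thesis
    by (induction I rule: infinite_finite_induct) (simp_all add: z matrix_add_ldistrib rd)
qed

lemma unitary_conj_poly:
  assumes "unitary2 W"
  shows "mat_poly p (mat_adj W ** A ** W) = mat_adj W ** mat_poly p A ** W"
proof -
  have "mat (coeff p i) ** (mat_adj W ** mat_pow A i ** W) = mat_adj W ** (mat (coeff p i) ** mat_pow A i) ** W" for i
    by (metis mat_scalar_comm matrix_mul_assoc)
  then show ?thesis unfolding mat_poly_def unitary_conj_pow[OF assms] unitary_conj_sum by simp
qed

lemma not_invertible_ltri:
  "\<not> invertible (m22 x 0 y z) \<longleftrightarrow> x * z = 0"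
  by (simp add: invertible_det_nz det_2)

lemma spectrum_unitary_conj:
  assumes "unitary2 W"
  shows "mat_spectrum (mat_adj W ** A ** W) = mat_spectrum A"
proof -
  have "det (mat_adj W ** A ** W - mat c) = det (A - mat c)" for c
  proof -
    have "mat_adj W ** A ** W - mat c = mat_adj W ** (A - mat c) ** W"
    proof -
      have "mat_adj W ** (A - mat c) ** W = mat_adj W ** A ** W - mat_adj W ** mat c ** W"
        by (simp add: m22_eq_iff matrix_matrix_mult_2 algebra_simps)
      moreover have "mat_adj W ** mat c ** W = mat c"
        using assms unfolding unitary2_def by (metis mat_scalar_comm matrix_mul_assoc matrix_mul_rid)
      ultimately show ?thesis by simp
    qed
    then have "det (mat_adj W ** A ** W - mat c) = det (mat_adj W) * det W * det (A - mat c)" by (simp add: det_mul)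
    moreover have "det (mat_adj W) * det W = 1" using assms unfolding unitary2_def by (metis det_I det_mul)
    ultimately show ?thesis by simp
  qed
  then show ?thesis by (simp add: mat_spectrum_def invertible_det_nz)
qed

lemma spectrum_ltri: "mat_spectrum (m22 b 0 g a) = {a, b}"
  by (auto simp: mat_spectrum_def mat_m22 m22_diff not_invertible_ltri)

text \<open>Conjugation by a unitary commutes with the rational calculus as soon as the denominator
  is invertible; in triangular form its diagonal entries are the nonzero values of \<open>q\<close>
  at the eigenvalues.\<close>

lemma Ar_contraction_ltri:
  assumes W: "unitary2 W" and A: "Ar_contraction_mat r A" and L: "mat_adj W ** A ** W = m22 b 0 g a" and r: "0 < r"
  shows "Ar_contraction_mat r (m22 b 0 g a)" "a \<in> closed_annulus r" "b \<in> closed_annulus r"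
proof -
  have sp: "mat_spectrum (m22 b 0 g a) \<subseteq> closed_annulus r"
    unfolding L[symmetric] spectrum_unitary_conj[OF W] using A unfolding Ar_contraction_mat_def by blast
  then show ac: "a \<in> closed_annulus r" and bc: "b \<in> closed_annulus r" unfolding spectrum_ltri by auto
  have ab: "a \<noteq> 0" "b \<noteq> 0" using ac bc r by (auto simp: closed_annulus_def)
  have "mat_norm (mat_rat p q (m22 b 0 g a)) \<le> (SUP z\<in>closed_annulus r. cmod (poly p z / poly q z))"
    if q: "\<forall>z\<in>closed_annulus r. poly q z \<noteq> 0" for p q
  proof -
    let ?X = "mat_poly q A"
    have "mat_adj W ** ?X ** W = mat_poly q (m22 b 0 g a)" using unitary_conj_poly[OF W, of q A] L by simp
    also have "\<dots> ** m22 (1 / poly q b) 0 (- (g * (\<Sum>i\<le>degree q. coeff q i * dpow a b (int i))) / (poly q b * poly q a)) (1 / poly q a) = mat 1"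
      unfolding mat_poly_ltri[OF ab order_refl] using q ac bc by (simp add: m22_mult mat_m22 field_simps)
    finally have "\<exists>Y. (mat_adj W ** ?X ** W) ** Y = mat 1" by (auto simp: L)
    then obtain Y where Y: "(mat_adj W ** ?X ** W) ** Y = mat 1" by blast
    have YY: "Y = mat_adj W ** (W ** Y ** mat_adj W) ** W"
      using unitary_conj_undo[of "mat_adj W" Y] unitary2_right[OF W] W unfolding unitary2_def
      by (simp add: mat_adj_adj matrix_mul_assoc)
    have "mat_adj W ** (?X ** (W ** Y ** mat_adj W)) ** W = mat 1"
      using Y YY unitary_conj_mult[OF W, of ?X "W ** Y ** mat_adj W"] by simp
    then have "W ** mat 1 ** mat_adj W = ?X ** (W ** Y ** mat_adj W)"
      using unitary_conj_undo[OF W, of "?X ** (W ** Y ** mat_adj W)"] by simp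
    then have X1: "?X ** (W ** Y ** mat_adj W) = mat 1" using unitary2_right[OF W] by simp
    have "matrix_inv (mat_poly q (m22 b 0 g a)) = Y"
      using Y unitary_conj_poly[OF W, of q A] L by (intro matrix_inv_eqI) simp
    also have "\<dots> = mat_adj W ** matrix_inv ?X ** W" using YY matrix_inv_eqI(1)[OF X1] by simp
    finally have "mat_rat p q (m22 b 0 g a) = mat_adj W ** mat_rat p q A ** W"
      unfolding mat_rat_def L[symmetric] unitary_conj_poly[OF W] by (simp add: unitary_conj_mult[OF W])
    then have "mat_norm (mat_rat p q (m22 b 0 g a)) \<le> mat_norm (mat_rat p q A)"
      using mat_norm_unitary_conj[OF W] by simp
    also have "\<dots> \<le> (SUP z\<in>closed_annulus r. cmod (poly p z / poly q z))"
      using A q unfolding Ar_contraction_mat_def by blast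
    finally show ?thesis .
  qed
  then show "Ar_contraction_mat r (m22 b 0 g a)" unfolding Ar_contraction_mat_def using sp by blast
qed

lemma mat_norm_col:
  "(cmod (A $ 1 $ i))\<^sup>2 + (cmod (A $ 2 $ i))\<^sup>2 \<le> (mat_norm A)\<^sup>2"
proof -
  have "A *v axis i 1 = (\<chi> j. A $ j $ i)"
    using exhaust_2[of i] by (auto simp: vec_eq_iff matrix_vector_mult_2 axis_def)
  then have "(norm (A *v axis i 1))\<^sup>2 = (cmod (A $ 1 $ i))\<^sup>2 + (cmod (A $ 2 $ i))\<^sup>2"
    by (simp add: norm_vec_def L2_set_def UNIV_2)
  moreover have "norm (A *v axis i 1) \<le> mat_norm A"
    using onorm[OF mat_vec_bounded_linear, of A "axis i 1"] unfolding mat_norm_def by simp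
  ultimately show ?thesis by (metis norm_ge_zero power_mono)
qed

text \<open>Test the condition on \<open>z\<close> and \<open>1 / z\<close>: the norms are at most 1
  and \<open>1 / r\<close>. Each eigenvalue shares a row or a column with the nonzero off-diagonal
  entry, which makes its bound strict.\<close>

lemma ltri_strict:
  assumes r: "0 < r" "r < 1" and A: "Ar_contraction_mat r (m22 b 0 g a)" and g: "g \<noteq> 0"
  shows "annulus_pair r a b"
proof -
  have ab: "a \<in> closed_annulus r" "b \<in> closed_annulus r"
    using A unfolding Ar_contraction_mat_def spectrum_ltri by auto
  have nz: "a \<noteq> 0" "b \<noteq> 0" using ab r by (auto simp: closed_annulus_def)
  have sup: "mat_norm (mat_rat p q (m22 b 0 g a)) \<le> (SUP z\<in>closed_annulus r. cmod (poly p z / poly q z))"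
    if "\<forall>z\<in>closed_annulus r. poly q z \<noteq> 0" for p q
    using A that unfolding Ar_contraction_mat_def by blast
  have X: "mat_poly [:0, 1:] (m22 b 0 g a) = m22 b 0 g a"
    using mat_poly_ltri[OF nz order_refl, of "[:0, 1:]" g] by simp
  have I: "mat_poly 1 (m22 b 0 g a) = m22 1 0 0 1"
    using mat_poly_ltri[OF nz order_refl, of 1 g] by simp
  have "mat_norm (mat_rat [:0, 1:] 1 (m22 b 0 g a)) \<le> (SUP z\<in>closed_annulus r. cmod (poly [:0, 1:] z / poly 1 z))"
    by (rule sup) simp
  also have "\<dots> \<le> 1"
    by (rule cSUP_least) (use ab in \<open>auto simp: closed_annulus_def\<close>)
  finally have n1: "(mat_norm (m22 b 0 g a))\<^sup>2 \<le> 1"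
    unfolding mat_rat_def X I using onorm_pos_le[OF mat_vec_bounded_linear, of "m22 b 0 g a"]
    by (simp add: matrix_inv_ltri m22_mult mat_norm_def power_le_one)
  have "mat_norm (mat_rat 1 [:0, 1:] (m22 b 0 g a)) \<le> (SUP z\<in>closed_annulus r. cmod (poly 1 z / poly [:0, 1:] z))"
    by (rule sup) (use r in \<open>auto simp: closed_annulus_def\<close>)
  also have "\<dots> \<le> 1 / r"
  proof (rule cSUP_least)
    show "closed_annulus r \<noteq> {}" using ab by blast
    show "cmod (poly 1 z / poly [:0, 1:] z) \<le> 1 / r" if "z \<in> closed_annulus r" for z
    proof -
      have "r \<le> cmod z" using that by (simp add: closed_annulus_def)
      moreover from this have "0 < cmod z" using r by linarith
      ultimately show ?thesis using r by (simp add: norm_divide frac_le)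
    qed
  qed
  finally have "mat_norm (m22 (1 / b) 0 (- g / (b * a)) (1 / a)) \<le> 1 / r"
    unfolding mat_rat_def X I by (simp add: matrix_inv_ltri nz m22_mult)
  then have n2: "(mat_norm (m22 (1 / b) 0 (- g / (b * a)) (1 / a)))\<^sup>2 \<le> (1 / r)\<^sup>2"
    using onorm_pos_le[OF mat_vec_bounded_linear] by (intro power_mono) (auto simp: mat_norm_def)
  have lt1: "cmod x < 1" if "(cmod g)\<^sup>2 + (cmod x)\<^sup>2 \<le> 1" for x
  proof -
    have "(cmod x)\<^sup>2 < 1\<^sup>2" using that g by (smt (verit) power_one zero_less_norm_iff zero_less_power)
    then show ?thesis by (rule power2_less_imp_less) simp
  qed
  have ltr: "r < cmod x" if "(cmod (- g / (b * a)))\<^sup>2 + (cmod (1 / x))\<^sup>2 \<le> (1 / r)\<^sup>2" "x \<noteq> 0" for x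
  proof -
    have "0 < cmod (- g / (b * a))" using g nz by simp
    then have "(cmod (1 / x))\<^sup>2 < (1 / r)\<^sup>2" using that(1) by (smt (verit) zero_less_power)
    then have "cmod (1 / x) < 1 / r" by (rule power2_less_imp_less) (use r in simp)
    then show ?thesis using that(2) r by (simp add: norm_divide field_simps)
  qed
  have "cmod a < 1" by (rule lt1) (use mat_norm_row[of "m22 b 0 g a" 2] n1 in simp)
  moreover have "cmod b < 1" by (rule lt1) (use mat_norm_col[of "m22 b 0 g a" 1] n1 in simp)
  moreover have "r < cmod a"
    by (rule ltr[OF order_trans[OF _ n2] nz(1)])
       (use mat_norm_row[of "m22 (1 / b) 0 (- g / (b * a)) (1 / a)" 2] in \<open>simp only: m22_nth\<close>)
  moreover have "r < cmod b"
    by (rule ltr[OF order_trans[OF _ n2] nz(2)])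
       (use mat_norm_col[of "m22 (1 / b) 0 (- g / (b * a)) (1 / a)" 1] in \<open>simp only: m22_nth add.commute\<close>)
  ultimately show ?thesis using r by unfold_locales
qed

lemma schur_lower_triangular: "\<exists>W. unitary2 W \<and> (mat_adj W ** T ** W) $ 1 $ 2 = 0"
proof (cases "T $ 1 $ 2 = 0")
  case True
  then show ?thesis by (intro exI[of _ "mat 1"]) (simp add: unitary2_def mat_m22 mat_adj_m22 m22_mult matrix_matrix_mult_2)
next
  case False
  obtain p q u v where T: "T = m22 p q u v" using m22_surj by blast
  have q: "q \<noteq> 0" using False T by simp
  \<comment> \<open>An eigenvalue of \<open>T\<close>, by the quadratic formula;
    \<open>(q, \<nu> - p)\<close> is a corresponding eigenvector, nonzero because \<open>q\<close>
    is.\<close>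
  define \<nu> where "\<nu> = (p + v + csqrt ((p - v)\<^sup>2 + 4 * q * u)) / 2"
  have "(csqrt ((p - v)\<^sup>2 + 4 * q * u))\<^sup>2 = (p - v)\<^sup>2 + 4 * q * u" by simp
  moreover have "2 * \<nu> = p + v + csqrt ((p - v)\<^sup>2 + 4 * q * u)" unfolding \<nu>_def by simp
  then have "csqrt ((p - v)\<^sup>2 + 4 * q * u) = 2 * \<nu> - p - v" by (simp only: diff_diff_eq) simp
  ultimately have "(2 * \<nu> - p - v)\<^sup>2 = (p - v)\<^sup>2 + 4 * q * u" by simp
  then have "4 * ((\<nu> - p) * (\<nu> - v)) = 4 * (q * u)" by (simp add: power2_eq_square algebra_simps)
  then have ev: "(\<nu> - p) * (\<nu> - v) = q * u" by simp
  define N where "N = sqrt ((cmod q)\<^sup>2 + (cmod (\<nu> - p))\<^sup>2)"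
  have N2: "N\<^sup>2 = (cmod q)\<^sup>2 + (cmod (\<nu> - p))\<^sup>2" unfolding N_def by simp
  have N0: "N > 0" unfolding N_def using q by (simp add: add_pos_nonneg)
  define x where "x = q / of_real N"
  define y where "y = (\<nu> - p) / of_real N"
  have xy: "x * cnj x + y * cnj y = 1"
  proof -
    have "x * cnj x + y * cnj y = (q * cnj q + (\<nu> - p) * cnj (\<nu> - p)) / (of_real N * of_real N)"
      by (simp add: x_def y_def add_divide_distrib)
    also have "q * cnj q + (\<nu> - p) * cnj (\<nu> - p) = of_real (N\<^sup>2)"
      unfolding N2 of_real_add complex_norm_square ..
    finally show ?thesis using N0 by (simp add: power2_eq_square)
  qed
  \<comment> \<open>The normalised eigenvector is the second column, so the second column of the
    conjugated matrix is \<nu> times the second unit vector.\<close>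
  let ?W = "m22 (cnj y) x (- cnj x) y"
  have "unitary2 ?W"
    unfolding unitary2_def mat_adj_m22 m22_mult mat_m22 using xy by (simp add: m22_eq_iff algebra_simps)
  moreover have "(mat_adj ?W ** T ** ?W) $ 1 $ 2 = 0"
  proof -
    have "(mat_adj ?W ** T ** ?W) $ 1 $ 2 = y * (p * x + q * y) - x * (u * x + v * y)"
      unfolding T mat_adj_m22 m22_mult by (simp add: algebra_simps)
    also have "\<dots> = (\<nu> - p) * (p * q + q * (\<nu> - p)) / of_real (N * N) - q * (u * q + v * (\<nu> - p)) / of_real (N * N)"
      using N0 by (simp add: x_def y_def field_simps)
    also have "\<dots> = q * ((\<nu> - p) * (\<nu> - v) - q * u) / of_real (N * N)"
      by (simp add: diff_divide_distrib[symmetric] algebra_simps)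
    finally show ?thesis using ev by simp
  qed
  ultimately show ?thesis by blast
qed

definition has_annulus_dilation :: "real \<Rightarrow> nat \<Rightarrow> (nat \<Rightarrow> cmat2) \<Rightarrow> bool" where
  "has_annulus_dilation r m B \<longleftrightarrow> (\<exists>V U. isometric_embedding V \<and>
           (\<forall>i<m. Ar_unitary r (U i)) \<and>
           (\<forall>i<m. \<forall>j<m. \<forall>x\<in>l2. U i (U j x) = U j (U i x)) \<and>
           (\<forall>(p, q)\<in>Rat_polyannulus r m. \<forall>x y.
              l2_inner (mrat_op m p q U (V x)) (V y) = cinner2 (mrat_mat m p q B *v x) y))"

abbreviation bidx :: "bool \<Rightarrow> 2" where "bidx p \<equiv> (if p then 2 else 1)"

text \<open>\<open>Ml\<close> is the power map in the basis given by \<open>W\<close>. The Gram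
  entry for \<open>p\<close>, \<open>p'\<close> pairs the image of vector \<open>p\<close> with
  vector \<open>p'\<close>, hence it is the matrix entry in row \<open>p'\<close> and column
  \<open>p\<close>.\<close>

lemma dilation_from_coordinates:
  assumes r: "0 < r" "r < 1" and m: "1 \<le> m" and W: "unitary2 W"
    and M0: "Ml (\<lambda>_. 0) = mat 1" and Madd: "\<And>n n'. Ml (\<lambda>i. n i + n' i) = Ml n ** Ml n'"
    and MB: "\<And>i. i < m \<Longrightarrow> Ml (\<lambda>l. if l = i then 1 else 0) = mat_adj W ** B i ** W"
    and cm: "\<And>i. i < m \<Longrightarrow> \<exists>s e v. coord_model r s e v (G i)"
    and G: "\<And>n p p'. (\<Prod>i<m. G i p p' (n i)) = Ml n $ bidx p' $ bidx p"
  shows "has_annulus_dilation r m B"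
proof -
  obtain sI e v where sev: "\<And>i. i < m \<Longrightarrow> coord_model r (sI i) (e i) (v i) (G i)"
    using cm by metis
  obtain Q s w where Q: "wperm r Q s" and ws: "\<And>p. sqs (w p)"
    and gw: "\<And>n p p'. (\<Sum>\<^sub>\<infinity>j. wperm.sm m s n j * w p (Q n j) * cnj (w p' j)) = Ml n $ bidx p' $ bidx p"
    using tensor_model[where sI = sI and e = e and v = v and G = G, OF r m sev] unfolding G by blast
  interpret wperm r m Q s by (rule Q)
  define V where "V x j = (mat_adj W *v x) $ 1 * w False j + (mat_adj W *v x) $ 2 * w True j" for x j
  define M where "M n = W ** Ml n ** mat_adj W" for n
  have WW: "W ** mat_adj W = mat 1" by (rule unitary2_right[OF W])
  have Vs: "sqs (V x)" for x
  proof -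
    let ?a = "(mat_adj W *v x) $ 1" and ?b = "(mat_adj W *v x) $ 2"
    have "(\<lambda>j. 2 * (cmod (?a * w False j))\<^sup>2 + 2 * (cmod (?b * w True j))\<^sup>2) summable_on UNIV"
      using sqs_scale[OF ws[of False], of ?a] sqs_scale[OF ws[of True], of ?b] unfolding sqs_def
      by (intro summable_on_add summable_on_cmult_right)
    moreover have "(cmod (V x j))\<^sup>2 \<le> 2 * (cmod (?a * w False j))\<^sup>2 + 2 * (cmod (?b * w True j))\<^sup>2" for j
    proof -
      have "(cmod (V x j))\<^sup>2 \<le> (cmod (?a * w False j) + cmod (?b * w True j))\<^sup>2"
        unfolding V_def by (intro power_mono norm_triangle_ineq) auto
      also have "\<dots> \<le> 2 * (cmod (?a * w False j))\<^sup>2 + 2 * (cmod (?b * w True j))\<^sup>2"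
        using sum_squares_bound[of "cmod (?a * w False j)" "cmod (?b * w True j)"] unfolding power2_sum by simp
      finally show ?thesis .
    qed
    ultimately show ?thesis unfolding sqs_def by (rule summable_on_comparison_test) auto
  qed
  have gram: "(\<Sum>\<^sub>\<infinity>j. sm n j * V x (Q n j) * cnj (V y j)) = cnj (cinner2 (M n *v x) y)" for n x y
  proof -
    let ?X = "mat_adj W *v x" and ?Y = "mat_adj W *v y"
    let ?t = "\<lambda>p p' j. sm n j * w p (Q n j) * cnj (w p' j)"
    have S: "(\<lambda>j. ?t p p' j) summable_on UNIV" for p p'
    proof -
      have "sqs (\<lambda>j. w p (Q n j))" using ws sqs_reindex[OF bij_Q] by blast
      then have "sqs (\<lambda>j. sm n j * w p (Q n j))" by (rule sqs_bounded_mult[OF _ sm_le_wmax])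
      then show ?thesis by (intro sqs_mult_summable sqs_cnj ws)
    qed
    have "(\<Sum>\<^sub>\<infinity>j. sm n j * V x (Q n j) * cnj (V y j))
      = (\<Sum>\<^sub>\<infinity>j. (?X $ 1 * cnj (?Y $ 1)) * ?t False False j + (?X $ 2 * cnj (?Y $ 1)) * ?t True False j
        + (?X $ 1 * cnj (?Y $ 2)) * ?t False True j + (?X $ 2 * cnj (?Y $ 2)) * ?t True True j)"
      by (rule infsum_cong) (simp add: V_def algebra_simps)
    also have "\<dots> = (?X $ 1 * cnj (?Y $ 1)) * infsum (?t False False) UNIV + (?X $ 2 * cnj (?Y $ 1)) * infsum (?t True False) UNIV
        + (?X $ 1 * cnj (?Y $ 2)) * infsum (?t False True) UNIV + (?X $ 2 * cnj (?Y $ 2)) * infsum (?t True True) UNIV"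
      using S by (simp add: infsum_add summable_on_add summable_on_cmult_right infsum_cmult_right')
    also have "\<dots> = cnj (cinner2 (Ml n *v ?X) ?Y)"
      unfolding gw by (simp add: cinner2_expand matrix_vector_mult_2 algebra_simps)
    also have "cinner2 (Ml n *v ?X) ?Y = cinner2 (M n *v x) y"
      unfolding M_def matrix_vector_mul_assoc[symmetric] using cinner2_adj[of W] by simp
    finally show ?thesis .
  qed
  have Mz: "M (\<lambda>_. 0) = mat 1" unfolding M_def M0 using WW by simp
  have Ma: "M (\<lambda>i. n i + n' i) = M n ** M n'" for n n'
  proof -
    have "M n ** M n' = W ** Ml n ** (mat_adj W ** W) ** Ml n' ** mat_adj W"
      unfolding M_def by (simp add: matrix_mul_assoc)
    then show ?thesis using W unfolding M_def Madd unitary2_def by (simp add: matrix_mul_assoc)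
  qed
  have Mb: "M (idx1 i 1) = B i" if "i < m" for i
    unfolding M_def idx1_def MB[OF that] by (rule unitary_conj_undo[OF W])
  have V: "isometric_embedding V"
    unfolding isometric_embedding_def
  proof (intro conjI allI)
    show "V x \<in> l2" for x using Vs by (simp add: mem_l2_iff)
    show "V (a *s x + b *s y) = (\<lambda>n. a * V x n + b * V y n)" for x y a b
      by (simp add: V_def fun_eq_iff matrix_vector_mult_2 algebra_simps)
    fix x y
    have "l2_inner (V x) (V y) = (\<Sum>\<^sub>\<infinity>j. cnj (sm (\<lambda>_. 0) j * V x (Q (\<lambda>_. 0) j) * cnj (V y j)))"
      unfolding l2_inner_infsum[OF Vs Vs] by (simp add: sm_0 Q_0)
    also have "\<dots> = cnj (cnj (cinner2 (M (\<lambda>_. 0) *v x) y))" unfolding infsum_cnj gram ..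
    finally show "l2_inner (V x) (V y) = cinner2 x y" by (simp add: Mz)
  qed
  show ?thesis
    unfolding has_annulus_dilation_def
  proof (intro exI[of _ V] exI[of _ U] conjI allI impI ballI)
    show "isometric_embedding V" by (rule V)
    show "Ar_unitary r (U i)" for i by (rule U_unitary)
    show "U i (U j x) = U j (U i x)" for i j x by (rule U_commute)
    show "case pq of (p, q) \<Rightarrow> \<forall>x y. l2_inner (mrat_op m p q U (V x)) (V y) = cinner2 (mrat_mat m p q B *v x) y"
      if "pq \<in> Rat_polyannulus r m" for pq
      using rational_dilation[OF V Mz Ma Mb gram] that by (cases pq) auto
  qed
qed

lemma dilation_diagonal:
  assumes r: "0 < r" "r < 1" and m: "1 \<le> m" and W: "unitary2 W"
    and L: "\<And>i. i < m \<Longrightarrow> mat_adj W ** B i ** W = m22 (b i) 0 0 (a i)"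
    and A: "\<And>i. i < m \<Longrightarrow> Ar_contraction_mat r (B i)"
  shows "has_annulus_dilation r m B"
proof -
  have ab: "a i \<in> closed_annulus r" "b i \<in> closed_annulus r" if "i < m" for i
    using Ar_contraction_ltri(2,3)[OF W A[OF that] L[OF that] r(1)] by auto
  have nz: "a i \<noteq> 0" "b i \<noteq> 0" if "i < m" for i using ab[OF that] r by (auto simp: closed_annulus_def)
  define Ml where "Ml n = m22 (\<Prod>i<m. b i powi n i) 0 0 (\<Prod>i<m. a i powi n i)" for n
  define G where "G i = (\<lambda>p p' k. if p = p' then (if p then a i powi k else b i powi k) else 0)" for i
  show ?thesis
  proof (rule dilation_from_coordinates[OF r m W, of Ml B G])
    show "Ml (\<lambda>_. 0) = mat 1" by (simp add: Ml_def mat_m22)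
    show "Ml (\<lambda>i. n i + n' i) = Ml n ** Ml n'" for n n'
    proof -
      have "(\<Prod>i<m. c i powi (n i + n' i)) = (\<Prod>i<m. c i powi n i) * (\<Prod>i<m. c i powi n' i)"
        if "\<And>i. i < m \<Longrightarrow> c i \<noteq> 0" for c :: "nat \<Rightarrow> complex"
        unfolding prod.distrib[symmetric] using that by (intro prod.cong) (auto simp: power_int_add)
      then show ?thesis using nz by (simp add: Ml_def m22_mult)
    qed
    show "Ml (\<lambda>l. if l = i then 1 else 0) = mat_adj W ** B i ** W" if "i < m" for i
    proof -
      have "(\<Prod>l<m. c l powi (if l = i then 1 else 0)) = c i" for c :: "nat \<Rightarrow> complex"
      proof -
        have "(\<Prod>l<m. c l powi (if l = i then 1 else 0)) = (\<Prod>l<m. if l = i then c l else 1)"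
          by (rule prod.cong) auto
        then show ?thesis using that by simp
      qed
      then show ?thesis by (simp add: Ml_def L[OF that])
    qed
    show "\<exists>s e v. coord_model r s e v (G i)" if "i < m" for i
      unfolding G_def by (rule coord_model_diag[OF r ab[OF that]])
    show "(\<Prod>i<m. G i p p' (n i)) = Ml n $ bidx p' $ bidx p" for n p p'
    proof -
      \<comment> \<open>Off the diagonal all factors are 0; with \<open>m = 0\<close> the empty
        product would be 1 instead.\<close>
      have "(\<Prod>i<m. 0 :: complex) = 0" using m by simp
      then show ?thesis by (cases p; cases p') (simp_all add: G_def Ml_def)
    qed
  qed
qed

text \<open>The scalar coordinates contribute the common factor \<open>P n\<close> to all Gram
  entries, so the tensor product reproduces the triangular matrix of coordinate \<open>k\<close>
  times this scalar.\<close>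

lemma dilation_triangular:
  assumes r: "0 < r" "r < 1" and m: "1 \<le> m" and W: "unitary2 W" and k: "k < m"
    and Lk: "mat_adj W ** B k ** W = m22 b 0 g a" and g: "g \<noteq> 0"
    and L: "\<And>i. i < m \<Longrightarrow> i \<noteq> k \<Longrightarrow> mat_adj W ** B i ** W = m22 (c i) 0 0 (c i)"
    and A: "\<And>i. i < m \<Longrightarrow> Ar_contraction_mat r (B i)"
  shows "has_annulus_dilation r m B"
proof -
  have Ak: "Ar_contraction_mat r (m22 b 0 g a)" by (rule Ar_contraction_ltri(1)[OF W A[OF k] Lk r(1)])
  interpret annulus_pair r a b by (rule ltri_strict[OF r Ak g])
  have cc: "c i \<in> closed_annulus r" if "i < m" "i \<noteq> k" for i
    using Ar_contraction_ltri(2)[OF W A[OF that(1)] L[OF that] r(1)] by auto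
  have cnz: "c i \<noteq> 0" if "i < m" "i \<noteq> k" for i using cc[OF that] r by (auto simp: closed_annulus_def)
  define I where "I = {..<m} - {k}"
  have I: "{..<m} = insert k I" "finite I" "k \<notin> I" using k by (auto simp: I_def)
  define P where "P n = (\<Prod>i\<in>I. c i powi n i)" for n
  define Ml where "Ml n = m22 (b powi n k * P n) 0 (g * dpow a b (n k) * P n) (a powi n k * P n)" for n
  define Gk where "Gk = (\<lambda>p p' k. if p then (if p' then a powi k else 0) else (if p' then g * dpow a b k else b powi k))"
  define G where "G i = (if i = k then Gk else (\<lambda>p p' n. c i powi n))" for i
  show ?thesis
  proof (rule dilation_from_coordinates[OF r m W, of Ml B G])
    show "Ml (\<lambda>_. 0) = mat 1" by (simp add: Ml_def mat_m22 P_def)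
    show "Ml (\<lambda>i. n i + n' i) = Ml n ** Ml n'" for n n'
    proof -
      have "P (\<lambda>i. n i + n' i) = P n * P n'"
        unfolding P_def prod.distrib[symmetric] using cnz by (intro prod.cong) (auto simp: I_def power_int_add)
      then show ?thesis
        using nz by (simp add: Ml_def m22_mult power_int_add dpow_add[OF nz(1,2)] m22_eq_iff algebra_simps)
    qed
    show "Ml (\<lambda>l. if l = i then 1 else 0) = mat_adj W ** B i ** W" if "i < m" for i
    proof (cases "i = k")
      case True
      have "P (\<lambda>l. if l = i then 1 else 0) = 1" unfolding P_def using True by (intro prod.neutral) (auto simp: I_def)
      then show ?thesis using True by (simp add: Ml_def Lk)
    next
      case False
      have "P (\<lambda>l. if l = i then 1 else 0) = (\<Prod>l\<in>I. if l = i then c l else 1)"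
        unfolding P_def by (rule prod.cong) auto
      also have "\<dots> = c i" using False that I(2) by (simp add: I_def)
      finally show ?thesis using False by (simp add: Ml_def L[OF that False])
    qed
    show "\<exists>s e v. coord_model r s e v (G i)" if "i < m" for i
    proof (cases "i = k")
      case True
      then show ?thesis using coord_model_triangular[OF spectral_inequality[OF Ak]] by (simp add: G_def Gk_def)
    next
      case False
      then show ?thesis using coord_model_scalar[OF r cc[OF that False]] by (simp add: G_def)
    qed
    show "(\<Prod>i<m. G i p p' (n i)) = Ml n $ bidx p' $ bidx p" for n p p'
    proof -
      have "(\<Prod>i<m. G i p p' (n i)) = Gk p p' (n k) * (\<Prod>i\<in>I. G i p p' (n i))"
        unfolding I(1) using I(2,3) by (simp add: G_def)
      also have "(\<Prod>i\<in>I. G i p p' (n i)) = P n" unfolding P_def by (rule prod.cong) (auto simp: G_def I_def)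
      finally show ?thesis by (cases p; cases p') (simp_all add: Gk_def Ml_def)
    qed
  qed
qed

theorem mainTheorem15:
  fixes r :: real and m :: nat and B :: "nat \<Rightarrow> complex^2^2"
  assumes "0 < r" and "r < 1" and "1 \<le> m"
    and "doubly_commuting_mat m B"
    and "\<forall>i<m. Ar_contraction_mat r (B i)"
  shows "\<exists>V U. isometric_embedding V \<and>
           (\<forall>i<m. Ar_unitary r (U i)) \<and>
           (\<forall>i<m. \<forall>j<m. \<forall>x\<in>l2. U i (U j x) = U j (U i x)) \<and>
           (\<forall>(p, q)\<in>Rat_polyannulus r m. \<forall>x y.
              l2_inner (mrat_op m p q U (V x)) (V y) = cinner2 (mrat_mat m p q B *v x) y)"
proof -
  have A: "Ar_contraction_mat r (B i)" if "i < m" for i using assms(5) that by blast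
  have comm: "B i ** B j = B j ** B i" if "i < m" "j < m" for i j
    using assms(4) that unfolding doubly_commuting_mat_def by blast
  have dcomm: "B i ** mat_adj (B j) = mat_adj (B j) ** B i" if "i < m" "j < m" "i \<noteq> j" for i j
    using assms(4) that unfolding doubly_commuting_mat_def by blast
  have "has_annulus_dilation r m B"
  proof (cases "\<forall>i<m. \<exists>c. B i = mat c")
    case True
    then obtain c where c: "\<And>i. i < m \<Longrightarrow> B i = mat (c i)" by metis
    have U1: "unitary2 (mat 1)" by (simp add: unitary2_def mat_m22 mat_adj_m22 m22_mult)
    have eq: "mat_adj (mat 1) ** B i ** mat 1 = m22 (c i) 0 0 (c i)" if "i < m" for i
      using c[OF that] by (simp add: mat_m22 mat_adj_m22 m22_mult)
    show ?thesis by (rule dilation_diagonal[where B = B and b = c and a = c, OF assms(1-3) U1 eq A])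
  next
    case False
    then obtain k where k: "k < m" "\<And>c. B k \<noteq> mat c" by blast
    obtain W where W: "unitary2 W" "(mat_adj W ** B k ** W) $ 1 $ 2 = 0" using schur_lower_triangular by blast
    define L where "L i = mat_adj W ** B i ** W" for i
    define b where "b = L k $ 1 $ 1"
    define g where "g = L k $ 2 $ 1"
    define a where "a = L k $ 2 $ 2"
    have Lk: "L k = m22 b 0 g a" using W(2) by (simp add: m22_eq_iff L_def b_def g_def a_def)
    have Lc: "L i ** L k = L k ** L i" if "i < m" for i
      unfolding L_def unitary_conj_mult[OF W(1)] comm[OF that k(1)] ..
    have Ld: "L i ** mat_adj (L k) = mat_adj (L k) ** L i" if "i < m" "i \<noteq> k" for i
    proof -
      have adj: "mat_adj (L k) = mat_adj W ** mat_adj (B k) ** W"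
        unfolding L_def mat_adj_mult mat_adj_adj by (simp add: matrix_mul_assoc)
      show ?thesis unfolding adj unfolding L_def unitary_conj_mult[OF W(1)] dcomm[OF that(1) k(1) that(2)] ..
    qed
    show ?thesis
    proof (cases "g = 0")
      case True
      \<comment> \<open>A diagonal matrix that is not scalar has distinct eigenvalues, and whatever
        commutes with it is diagonal.\<close>
      have ab: "a \<noteq> b"
      proof
        assume "a = b"
        then have "L k = mat b" using Lk True by (simp add: mat_m22)
        then have "B k = W ** mat b ** mat_adj W" using unitary_conj_undo[OF W(1), of "B k"] unfolding L_def by simp
        also have "\<dots> = mat b ** (W ** mat_adj W)" by (metis mat_scalar_comm matrix_mul_assoc)
        also have "\<dots> = mat b" using unitary2_right[OF W(1)] by simp
        finally show False using k(2) by blast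
      qed
      have "L i = m22 (L i $ 1 $ 1) 0 0 (L i $ 2 $ 2)" if "i < m" for i
      proof -
        obtain p q u v where Li: "L i = m22 p q u v" using m22_surj by blast
        have "q * a = b * q" "u * b = a * u"
          using Lc[OF that] unfolding Li Lk True m22_mult by (auto simp: m22_eq_iff)
        then have "q * (a - b) = 0" "u * (a - b) = 0" by (auto simp: algebra_simps)
        then show ?thesis using ab Li by simp
      qed
      then show ?thesis
        by (intro dilation_diagonal[OF assms(1-3) W(1), of B "\<lambda>i. L i $ 1 $ 1" "\<lambda>i. L i $ 2 $ 2"] A) (simp_all add: L_def)
    next
      case False
      \<comment> \<open>Commuting with the triangular matrix removes the upper entry, commuting with
        its adjoint the lower one; the remaining equation then equates the diagonal entries.\<close>
      have "L i = m22 (L i $ 1 $ 1) 0 0 (L i $ 1 $ 1)" if "i < m" "i \<noteq> k" for i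
      proof -
        obtain p q u v where Li: "L i = m22 p q u v" using m22_surj by blast
        have 1: "q * g = 0" "u * b + v * g = g * p + a * u"
          using Lc[OF that(1)] unfolding Li Lk m22_mult by (auto simp: m22_eq_iff)
        have 2: "u * cnj g = 0"
          using Ld[OF that] unfolding Li Lk mat_adj_m22 m22_mult by (auto simp: m22_eq_iff algebra_simps)
        have "q = 0" "u = 0" using 1(1) 2 False by auto
        moreover have "v = p" using 1(2) \<open>u = 0\<close> False by (simp add: mult.commute)
        ultimately show ?thesis using Li by simp
      qed
      then show ?thesis
        using Lk False unfolding L_def
        by (intro dilation_triangular[OF assms(1-3) W(1) k(1) _ False _ A]) auto
    qed
  qed
  then show ?thesis unfolding has_annulus_dilation_def .
qed

end
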